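(* Let $\mathbb L(\lambda)=\mathbb M_{(\tau_1,\sigma_1)}(Y_1,X_1)\,(\lambda\mathbb M^{\mathcal S}_\tau-\mathbb M^{\mathcal S}_\sigma)\,\mathbb M_{(\sigma_2,\tau_2)}(X_2,Y_2)$ be a GFPR of $\mathcal S(\lambda)$ with nonsingular matrix assignments $X_1,X_2,Y_1,Y_2$. Let $Z(\lambda)=\begin{bmatrix}Z_{mn}(\lambda)\\ Z_r(\lambda)\end{bmatrix}$ be an $(mn+r)\times p$ matrix polynomial, where $Z_{mn}(\lambda)$ has $mn$ rows and $Z_r(\lambda)$ has $r$ rows. (a) If $Z(\lambda)$ is a right (resp., left) minimal basis of $\mathbb L(\lambda)$ then $\begin{bmatrix}(e^T_{m-c_0(\sigma,\sigma_2)}\otimes I_n)Z_{mn}(\lambda)\\ Z_r(\lambda)\end{bmatrix}$ (resp., $\begin{bmatrix}(e^T_{m-i_0(\sigma_1,\sigma)}\otimes I_n)Z_{mn}(\lambda)\\ Z_r(\lambda)\end{bmatrix}$) is a right (resp., left) minimal basis of $\mathcal S(\lambda)$. (b) Let $\tau$ be given by $\tau=(\tau_l,-m,\tau_r)$. Set $\alpha=(-\mathrm{rev}(\tau_l),\sigma,-\mathrm{rev}(\tau_r))$, and let $c(\alpha)$ and $i(\alpha)$ be the total number of consecutions and inversions of the permutation $\alpha$. If $\varepsilon_1\le\cdots\le\varepsilon_p$ are the right (resp., left) minimal indices of $\mathbb L(\lambda)$ then $\varepsilon_1-i(\alpha)\le\cdots\le\varepsilon_p-i(\alpha)$ (resp.,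 $\varepsilon_1-c(\alpha)\le\cdots\le\varepsilon_p-c(\alpha)$) are the right (resp., left) minimal indices of $\mathcal S(\lambda)$.
   Context: Setting: $P(\lambda)=\sum_{i=0}^m\lambda^iA_i$ with $A_i\in\mathbb C^{n\times n}$, $A_m\neq0$, $m\ge1$; $G(\lambda)=P(\lambda)+C(\lambda E-A)^{-1}B$ is a minimal realization ($r$ smallest possible) with $A,E\in\mathbb C^{r\times r}$, $E$ nonsingular, $C\in\mathbb C^{n\times r}$, $B\in\mathbb C^{r\times n}$; system matrix $\mathcal S(\lambda)=\left[\begin{array}{c|c}P(\lambda)&C\\ \hline B&A-\lambda E\end{array}\right]$. $e_j$ is the $j$-th column of $I_m$. Elementary matrices: for $X\in\mathbb C^{n\times n}$, $M_0(X)=\mathrm{diag}(I_{(m-1)n},X)$, $M_{-m}(X)=\mathrm{diag}(X,I_{(m-1)n})$, and for $1\le i\le m-1$, $M_i(X)=\mathrm{diag}\big(I_{(m-i-1)n},\begin{bmatrix}X&I_n\\ I_n&0\end{bmatrix},I_{(i-1)n}\big)$, $M_{-i}(X)=\mathrm{diag}\big(I_{(m-i-1)n},\begin{bmatrix}0&I_n\\ I_n&X\end{bmatrix},I_{(i-1)n}\big)$. For $i\in\{-m,\dots,m-1\}$: $\mathbb M_i(X)=\mathrm{diag}(M_i(X),I_r)$; $M_i^P=M_i(-A_i)$ if $i\ge0$, $M_i^P=M_i(A_{-i})$ if $i<0$. Fiedler matrices: $\mathbb M_0^{\mathcal S}=\left[\begin{array}{c|c}M_0^P&-e_m\otimes C\\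 \hline -e_m^T\otimes B&-A\end{array}\right]$, $\mathbb M_{-m}^{\mathcal S}=\mathrm{diag}(M_{-m}^P,-E)$, $\mathbb M_i^{\mathcal S}=\mathrm{diag}(M_i^P,I_r)$ and $\mathbb M_{-i}^{\mathcal S}=(\mathbb M_i^{\mathcal S})^{-1}$ for $1\le i\le m-1$. Index tuples: $\mathbf t=(t_1,\dots,t_k)$ is an ordered tuple of integers (possibly empty); permutations are regarded as tuples; $(\alpha,\beta)$ is concatenation; $-\mathbf t$ negates every entry; $\mathrm{rev}$ reverses. A matrix assignment for $\mathbf t$ is a tuple $X=(X_1,\dots,X_k)$ of $n\times n$ matrices; it is nonsingular if the matrices at positions occupied by the indices $0$ and $-m$ are nonsingular. $\mathbb M_{\mathbf t}(X)=\mathbb M_{t_1}(X_1)\cdots\mathbb M_{t_k}(X_k)$, $\mathbb M^{\mathcal S}_{\mathbf t}=\mathbb M^{\mathcal S}_{t_1}\cdots\mathbb M^{\mathcal S}_{t_k}$ (empty product $=$ identity); $\mathbb M_{(\tau_1,\sigma_1)}(Y_1,X_1)=\mathbb M_{\tau_1}(Y_1)\mathbb M_{\sigma_1}(X_1)$, etc. $\mathbf t$ satisfies the SIP if whenever $t_a=t_b$, $a<b$, there is $a<c<b$ with $t_c=t_a+1$. For a tuple $\beta$ of nonnegative indices containing $0$, $c_0(\beta)$ (resp. $i_0(\beta)$) is the largest $p\ge0$ such that $(0,1,\dots,p)$ (resp. $(p,\dots,1,0)$) is a subtuple of $\beta$ (obtained by deleting entries). A permutation $\alpha$ of $\{0,\dots,m-1\}$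 has a consecution at $t\in\{0,\dots,m-2\}$ if $t$ appears to the left of $t+1$ in $\alpha$, and an inversion at $t$ otherwise. GFPR of $\mathcal S(\lambda)$: a pencil of the form displayed in the claim, where $0\le h\le m-1$; $\sigma,\tau$ are permutations of $\{0,\dots,h\}$ and $\{-m,\dots,-h-1\}$; $\sigma_1,\sigma_2$ are index tuples from $\{0,\dots,h-1\}$ with $(\sigma_1,\sigma,\sigma_2)$ satisfying the SIP; $\tau_1,\tau_2$ are index tuples from $\{-m,\dots,-h-2\}$ with $(\tau_1,\tau,\tau_2)$ satisfying the SIP; $X_j,Y_j$ are matrix assignments for $\sigma_j,\tau_j$. Minimal bases: for a $k\times k$ rational matrix $F(\lambda)$, $\mathcal N_r(F)=\{x\in\mathbb C(\lambda)^k:F x=0\}$ and $\mathcal N_l(F)=\{y\in\mathbb C(\lambda)^k:y^TF=0\}$. A minimal basis of such a subspace is a basis of vector polynomials whose sum of degrees is minimal among all polynomial bases. A matrix polynomial is a right (left) minimal basis of $F$ if its columns form a minimal basis of $\mathcal N_r(F)$ (resp. $\mathcal N_l(F)$); the ordered degrees of the basis vectors are the right (left) minimal indices of $F$. *)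

theory Defs
  imports
    Complex_Main
    "HOL-Library.Sublist"
    "HOL-Computational_Algebra.Polynomial_Factorial"
    "Jordan_Normal_Form.Matrix_Kernel"
    "Jordan_Normal_Form.Gauss_Jordan_Elimination"
begin

text \<open>
  The field \<open>\<complex>(\<lambda>)\<close> is rendered as \<open>complex poly fract\<close>, with embedding \<^const>\<open>to_fract\<close>.
  Throughout, \<open>As i\<close> is the coefficient \<open>A\<^sub>i\<close> of \<open>P(\<lambda>)\<close>, only relevant for \<open>i \<le> m\<close>.
\<close>

definition const_mat :: "complex mat \<Rightarrow> complex poly mat" where
  "const_mat = map_mat (\<lambda>a. [:a:])"

definition rat_mat :: "complex poly mat \<Rightarrow> complex poly fract mat" where
  "rat_mat = map_mat to_fract"

abbreviation mat_inv :: "'a::field mat \<Rightarrow> 'a mat" where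
  "mat_inv M \<equiv> the (mat_inverse M)"

definition kronecker :: "'a::times mat \<Rightarrow> 'a mat \<Rightarrow> 'a mat" (infixl "\<otimes>\<^sub>k" 70) where
  "M \<otimes>\<^sub>k N = mat (dim_row M * dim_row N) (dim_col M * dim_col N)
     (\<lambda>(i, j). M $$ (i div dim_row N, j div dim_col N) * N $$ (i mod dim_row N, j mod dim_col N))"

text \<open>The \<open>j\<close>-th column of \<open>I\<^sub>m\<close> as an \<open>m \<times> 1\<close> matrix; \<open>j\<close> counts from 1.\<close>
definition ecol :: "nat \<Rightarrow> nat \<Rightarrow> 'a::zero_neq_one mat" where
  "ecol m j = mat m 1 (\<lambda>(i, _). if Suc i = j then 1 else 0)"


subsection \<open>Realizations and the system matrix\<close>

definition poly_mat :: "nat \<Rightarrow> nat \<Rightarrow> (nat \<Rightarrow> complex mat) \<Rightarrow> complex poly mat" where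
  "poly_mat n m As = mat n n (\<lambda>(i, j). \<Sum>k\<le>m. monom (As k $$ (i, j)) k)"

text \<open>The pencil \<open>\<lambda>M - N\<close>.\<close>
definition pencil :: "complex mat \<Rightarrow> complex mat \<Rightarrow> complex poly mat" where
  "pencil M N = [:0, 1:] \<cdot>\<^sub>m const_mat M - const_mat N"

text \<open>\<open>G(\<lambda>) = P(\<lambda>) + C (\<lambda>E - A)\<^sup>-\<^sup>1 B\<close>\<close>
definition realization ::
  "nat \<Rightarrow> nat \<Rightarrow> complex poly fract mat \<Rightarrow> complex poly mat \<Rightarrow>
   complex mat \<Rightarrow> complex mat \<Rightarrow> complex mat \<Rightarrow> complex mat \<Rightarrow> bool" where
  "realization n r G P A B C E \<longleftrightarrow>
     P \<in> carrier_mat n n \<and>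
     A \<in> carrier_mat r r \<and> B \<in> carrier_mat r n \<and> C \<in> carrier_mat n r \<and>
     E \<in> carrier_mat r r \<and> invertible_mat E \<and>
     G = rat_mat P
       + rat_mat (const_mat C) * mat_inv (rat_mat (pencil E A)) * rat_mat (const_mat B)"

definition minimal_realization ::
  "nat \<Rightarrow> nat \<Rightarrow> complex poly fract mat \<Rightarrow> complex poly mat \<Rightarrow>
   complex mat \<Rightarrow> complex mat \<Rightarrow> complex mat \<Rightarrow> complex mat \<Rightarrow> bool" where
  "minimal_realization n r G P A B C E \<longleftrightarrow>
     realization n r G P A B C E \<and>
     (\<forall>r' P' A' B' C' E'. realization n r' G P' A' B' C' E' \<longrightarrow> r \<le> r')"

definition system_matrix ::
  "complex poly mat \<Rightarrow> complex mat \<Rightarrow> complex mat \<Rightarrow> complex mat \<Rightarrow> complex mat \<Rightarrow>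
   complex poly mat" where
  "system_matrix P A B C E =
     four_block_mat P (const_mat C) (const_mat B) (const_mat A - [:0, 1:] \<cdot>\<^sub>m const_mat E)"


subsection \<open>Elementary matrices and Fiedler matrices\<close>

definition elem_mat :: "nat \<Rightarrow> nat \<Rightarrow> int \<Rightarrow> complex mat \<Rightarrow> complex mat" where
  "elem_mat m n i X =
     (if i = 0 then diag_block_mat [1\<^sub>m ((m - 1) * n), X]
      else if i = - int m then diag_block_mat [X, 1\<^sub>m ((m - 1) * n)]
      else if i > 0 then
        diag_block_mat [1\<^sub>m ((m - nat i - 1) * n),
          four_block_mat X (1\<^sub>m n) (1\<^sub>m n) (0\<^sub>m n n),
          1\<^sub>m ((nat i - 1) * n)]
      else
        diag_block_mat [1\<^sub>m ((m - nat (- i) - 1) * n),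
          four_block_mat (0\<^sub>m n n) (1\<^sub>m n) (1\<^sub>m n) X,
          1\<^sub>m ((nat (- i) - 1) * n)])"

definition ext_elem_mat :: "nat \<Rightarrow> nat \<Rightarrow> nat \<Rightarrow> int \<Rightarrow> complex mat \<Rightarrow> complex mat" where
  "ext_elem_mat m n r i X = diag_block_mat [elem_mat m n i X, 1\<^sub>m r]"

definition fiedler_poly :: "nat \<Rightarrow> nat \<Rightarrow> (nat \<Rightarrow> complex mat) \<Rightarrow> int \<Rightarrow> complex mat" where
  "fiedler_poly m n As i =
     (if i \<ge> 0 then elem_mat m n i (- As (nat i)) else elem_mat m n i (As (nat (- i))))"

definition fiedler_sys ::
  "nat \<Rightarrow> nat \<Rightarrow> nat \<Rightarrow> (nat \<Rightarrow> complex mat) \<Rightarrow>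
   complex mat \<Rightarrow> complex mat \<Rightarrow> complex mat \<Rightarrow> complex mat \<Rightarrow> int \<Rightarrow> complex mat" where
  "fiedler_sys m n r As A B C E i =
     (if i = 0 then
        four_block_mat (fiedler_poly m n As 0) (- (ecol m m \<otimes>\<^sub>k C))
          (- (transpose_mat (ecol m m) \<otimes>\<^sub>k B)) (- A)
      else if i = - int m then diag_block_mat [fiedler_poly m n As (- int m), - E]
      else if i > 0 then diag_block_mat [fiedler_poly m n As i, 1\<^sub>m r]
      else mat_inv (diag_block_mat [fiedler_poly m n As (- i), 1\<^sub>m r]))"


subsection \<open>Index tuples\<close>

definition matrix_assignment :: "nat \<Rightarrow> int list \<Rightarrow> complex mat list \<Rightarrow> bool" where
  "matrix_assignment n t X \<longleftrightarrow> length X = length t \<and> set X \<subseteq> carrier_mat n n"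

definition nonsingular_assignment :: "nat \<Rightarrow> nat \<Rightarrow> int list \<Rightarrow> complex mat list \<Rightarrow> bool" where
  "nonsingular_assignment m n t X \<longleftrightarrow>
     matrix_assignment n t X \<and>
     (\<forall>j < length t. t ! j \<in> {0, - int m} \<longrightarrow> invertible_mat (X ! j))"

definition mat_prod :: "nat \<Rightarrow> complex mat list \<Rightarrow> complex mat" where
  "mat_prod k Ms = foldr (*) Ms (1\<^sub>m k)"

definition elem_prod ::
  "nat \<Rightarrow> nat \<Rightarrow> nat \<Rightarrow> int list \<Rightarrow> complex mat list \<Rightarrow> complex mat" where
  "elem_prod m n r t X = mat_prod (m * n + r) (map2 (ext_elem_mat m n r) t X)"

definition fiedler_prod ::
  "nat \<Rightarrow> nat \<Rightarrow> nat \<Rightarrow> (nat \<Rightarrow> complex mat) \<Rightarrow>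
   complex mat \<Rightarrow> complex mat \<Rightarrow> complex mat \<Rightarrow> complex mat \<Rightarrow> int list \<Rightarrow> complex mat" where
  "fiedler_prod m n r As A B C E t =
     mat_prod (m * n + r) (map (fiedler_sys m n r As A B C E) t)"

definition SIP :: "int list \<Rightarrow> bool" where
  "SIP t \<longleftrightarrow>
     (\<forall>a b. a < b \<and> b < length t \<and> t ! a = t ! b \<longrightarrow>
        (\<exists>c. a < c \<and> c < b \<and> t ! c = t ! a + 1))"

definition is_permutation_of :: "int list \<Rightarrow> int set \<Rightarrow> bool" where
  "is_permutation_of t I \<longleftrightarrow> distinct t \<and> set t = I"

text \<open>Both are meant for tuples containing \<open>0\<close>, so that the sets are nonempty.\<close>
definition c0 :: "int list \<Rightarrow> nat" where
  "c0 \<beta> = Max {p. subseq [0..int p] \<beta>}"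

definition i0 :: "int list \<Rightarrow> nat" where
  "i0 \<beta> = Max {p. subseq (rev [0..int p]) \<beta>}"

definition has_consecution_at :: "int list \<Rightarrow> int \<Rightarrow> bool" where
  "has_consecution_at \<alpha> t \<longleftrightarrow> (\<exists>a b. a < b \<and> b < length \<alpha> \<and> \<alpha> ! a = t \<and> \<alpha> ! b = t + 1)"

definition consecutions :: "nat \<Rightarrow> int list \<Rightarrow> nat" where
  "consecutions m \<alpha> = card {t \<in> {0..int m - 2}. has_consecution_at \<alpha> t}"

definition inversions :: "nat \<Rightarrow> int list \<Rightarrow> nat" where
  "inversions m \<alpha> = card {t \<in> {0..int m - 2}. \<not> has_consecution_at \<alpha> t}"

text \<open>The index data of a GFPR (the matrix assignments are treated separately).\<close>
definition gfpr_indices ::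
  "nat \<Rightarrow> nat \<Rightarrow> int list \<Rightarrow> int list \<Rightarrow> int list \<Rightarrow> int list \<Rightarrow> int list \<Rightarrow> int list \<Rightarrow> bool" where
  "gfpr_indices m h \<sigma> \<tau> \<sigma>\<^sub>1 \<sigma>\<^sub>2 \<tau>\<^sub>1 \<tau>\<^sub>2 \<longleftrightarrow>
     h \<le> m - 1 \<and>
     is_permutation_of \<sigma> {0..int h} \<and>
     is_permutation_of \<tau> {- int m..- int h - 1} \<and>
     set \<sigma>\<^sub>1 \<subseteq> {0..int h - 1} \<and> set \<sigma>\<^sub>2 \<subseteq> {0..int h - 1} \<and> SIP (\<sigma>\<^sub>1 @ \<sigma> @ \<sigma>\<^sub>2) \<and>
     set \<tau>\<^sub>1 \<subseteq> {- int m..- int h - 2} \<and> set \<tau>\<^sub>2 \<subseteq> {- int m..- int h - 2} \<and> SIP (\<tau>\<^sub>1 @ \<tau> @ \<tau>\<^sub>2)"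


subsection \<open>Minimal bases and minimal indices\<close>

definition vec_degree :: "complex poly vec \<Rightarrow> nat" where
  "vec_degree v = Max (degree ` set\<^sub>v v)"

definition right_null_space :: "complex poly fract mat \<Rightarrow> complex poly fract vec set" where
  "right_null_space F = mat_kernel F"

text \<open>\<open>y\<^sup>T F = 0\<close> is read as \<open>F\<^sup>T y = 0\<close>.\<close>
definition left_null_space :: "complex poly fract mat \<Rightarrow> complex poly fract vec set" where
  "left_null_space F = mat_kernel (transpose_mat F)"

text \<open>
  The list \<open>vs\<close> of polynomial vectors is a basis over \<open>\<complex>(\<lambda>)\<close> of the subspace \<open>N\<close> of
  \<open>\<complex>(\<lambda>)\<^sup>k\<close>; distinctness excludes repetitions, which the set of the entries does not see.
\<close>
definition polynomial_basis ::
  "nat \<Rightarrow> complex poly fract vec set \<Rightarrow> complex poly vec list \<Rightarrow> bool" where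
  "polynomial_basis k N vs \<longleftrightarrow>
     distinct vs \<and> set vs \<subseteq> carrier_vec k \<and>
     vectorspace.basis class_ring
       ((module_vec TYPE(complex poly fract) k)\<lparr>carrier := N\<rparr>)
       (map_vec to_fract ` set vs)"

definition minimal_basis ::
  "nat \<Rightarrow> complex poly fract vec set \<Rightarrow> complex poly vec list \<Rightarrow> bool" where
  "minimal_basis k N vs \<longleftrightarrow>
     polynomial_basis k N vs \<and>
     (\<forall>ws. polynomial_basis k N ws \<longrightarrow>
        sum_list (map vec_degree vs) \<le> sum_list (map vec_degree ws))"

definition right_minimal_basis :: "complex poly fract mat \<Rightarrow> complex poly mat \<Rightarrow> bool" where
  "right_minimal_basis F Z \<longleftrightarrow>
     dim_row Z = dim_col F \<and> minimal_basis (dim_col F) (right_null_space F) (cols Z)"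

definition left_minimal_basis :: "complex poly fract mat \<Rightarrow> complex poly mat \<Rightarrow> bool" where
  "left_minimal_basis F Z \<longleftrightarrow>
     dim_row Z = dim_row F \<and> minimal_basis (dim_row F) (left_null_space F) (cols Z)"

text \<open>\<open>\<epsilon>s\<close> is the ordered list of degrees of the vectors of a minimal basis (every minimal
  basis gives the same list).\<close>
definition right_minimal_indices :: "complex poly fract mat \<Rightarrow> nat list \<Rightarrow> bool" where
  "right_minimal_indices F \<epsilon>s \<longleftrightarrow>
     (\<exists>Z. right_minimal_basis F Z \<and> \<epsilon>s = sort (map vec_degree (cols Z)))"

definition left_minimal_indices :: "complex poly fract mat \<Rightarrow> nat list \<Rightarrow> bool" where
  "left_minimal_indices F \<epsilon>s \<longleftrightarrow>
     (\<exists>Z. left_minimal_basis F Z \<and> \<epsilon>s = sort (map vec_degree (cols Z)))"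

end

theory Submission
  imports Defs
begin

text \<open>
  Minimality of a basis only compares degree sums of polynomial bases of the same null space. It is
  therefore enough to find a linear isomorphism from the null space of the GFPR onto that of the
  system matrix under which polynomial vectors correspond to each other and which lowers all
  degrees by the same constant (\<open>minimal_basis_transfer\<close>). The isomorphism is the map \<open>recover\<close>, which
  keeps one block and the tail of a vector.

  \<^bold>\<open>Reduction to a Fiedler pencil.\<close> The outer factors of the GFPR are constant and invertible.
  Write \<open>\<tau> = (\<tau>l, -m, \<tau>r)\<close> and multiply from the left by the inverse of the product over \<open>\<tau>l\<close>.
  The vector \<open>z\<close> is annihilated by the GFPR if and only if \<open>w = W z\<close>, with an invertible constant matrix
  \<open>W\<close>, satisfies \<open>\<lambda> M\<^sub>-\<^sub>m w = M\<^sub>\<alpha> w\<close> (\<open>kernel_iff\<close>).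

  \<^bold>\<open>Solution of the Fiedler pencil.\<close> Number the blocks of \<open>w\<close> from the bottom, starting with 0. The
  factor with index \<open>i > 0\<close> maps the blocks \<open>i\<close> and \<open>i - 1\<close>, say \<open>a i\<close> and \<open>b i\<close>, to \<open>b i - A\<^sub>i (a i)\<close> and \<open>a i\<close>.
  When \<open>w\<close> is followed through the factors of \<open>M\<^sub>\<alpha>\<close>, the equation becomes a pair of recurrences
  (\<open>flow\<close>). At a consecution \<open>a (i + 1) = a i\<close> and \<open>\<lambda> b (i + 1) = b i - A\<^sub>i (a i)\<close>, and at an inversion
  \<open>a (i + 1) = \<lambda> a i\<close> and \<open>b (i + 1) = b i - A\<^sub>i (a i)\<close>. Let \<open>u = a 0\<close> and let \<open>v\<close> be the tail of \<open>w\<close>.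
  Then \<open>a i\<close> is \<open>u\<close> times a power of \<open>\<lambda>\<close> that counts inversions, \<open>b i\<close> is up to a power of \<open>\<lambda>\<close> a partial sum
  of \<open>- C v - P(\<lambda>) u\<close>, and the last equation says that \<open>P(\<lambda>) u + C v = 0\<close>. The tail of the equation is
  \<open>B u + (A - \<lambda> E) v = 0\<close>. So \<open>u\<close> over \<open>v\<close> is annihilated by the system matrix, and conversely every such
  vector determines \<open>w\<close> (\<open>flow_system_kernel\<close>, \<open>flow_exists\<close>, \<open>kernel_flow\<close>, \<open>flow_kernel\<close>).

  \<^bold>\<open>Degrees.\<close> The top block of \<open>w\<close> is \<open>\<lambda>\<close> to the number of inversions of \<open>\<alpha>\<close> times \<open>u\<close>. The recurrences
  bound the degrees of the other blocks by the same number (\<open>flow_degree_le\<close>), and the degree of \<open>v\<close> does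
  not exceed that of \<open>u\<close> because \<open>E\<close> is invertible (\<open>tail_degree_le\<close>). So the degree drops exactly by the
  number of inversions (\<open>recover_degree\<close>).

  \<^bold>\<open>Position of \<open>u\<close>.\<close> The block rows of elementary matrices are mostly unit blocks. By the successor
  infix property, only these are met when \<open>u\<close> is traced back from factor 0 to a block of \<open>z\<close>, and the
  search for that block is the greedy search that defines \<open>c0\<close> (\<open>chase_acts\<close>, \<open>SIP_undisturbed\<close>).

  \<^bold>\<open>Left minimal bases.\<close> The transpose of a GFPR is a GFPR of the transposed system matrix with reversed
  tuples, which exchanges \<open>c0\<close> with \<open>i0\<close> and inversions with consecutions (\<open>left_recovery\<close>).
\<close>

section \<open>Constant matrices acting on rational vectors, and degree bounds\<close>

definition ratc :: "complex \<Rightarrow> complex poly fract" where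
  "ratc a = to_fract [:a:]"

definition lam :: "complex poly fract" where
  "lam = to_fract [:0, 1:]"

lemma lam_nonzero [simp]: "lam \<noteq> 0"
  by (simp add: lam_def)

lemma ratc_hom [simp]:
  "ratc 0 = 0" "ratc 1 = 1" "ratc (a + b) = ratc a + ratc b"
  "ratc (a * b) = ratc a * ratc b" "ratc (- a) = - ratc a"
  by (auto simp: ratc_def one_pCons simp flip: to_fract_add to_fract_mult to_fract_uminus to_fract_1)

interpretation ratc: comm_ring_hom ratc
  by unfold_locales auto

abbreviation rat_const :: "complex mat \<Rightarrow> complex poly fract mat" where
  "rat_const M \<equiv> rat_mat (const_mat M)"

lemma rat_const_eq: "rat_const M = map_mat ratc M"
  by (auto simp: rat_mat_def const_mat_def ratc_def)

text \<open>
  A rational vector is a function on the natural numbers of which only the entries below the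
  dimension matter, and \<open>act M\<close> multiplies it by a complex matrix. With functions, a block of a long
  vector is the same function with a shifted argument, and block matrices act by the rule
  \<open>act_four_block\<close> below.
\<close>
definition act :: "complex mat \<Rightarrow> (nat \<Rightarrow> complex poly fract) \<Rightarrow> nat \<Rightarrow> complex poly fract" where
  "act M f p = (\<Sum>q<dim_col M. ratc (M $$ (p, q)) * f q)"

lemma act_cong:
  assumes "\<And>q. q < dim_col M \<Longrightarrow> f q = g q"
  shows "act M f p = act M g p"
  unfolding act_def using assms by (intro sum.cong) auto

lemma act_mult:
  assumes "M \<in> carrier_mat a b" "N \<in> carrier_mat b c" "p < a"
  shows "act (M * N) f p = act M (act N f) p"
proof -
  have "act (M * N) f p = (\<Sum>q<c. \<Sum>l<b. ratc (M $$ (p, l)) * ratc (N $$ (l, q)) * f q)"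
    unfolding act_def using assms
    by (auto simp: scalar_prod_def ratc.hom_sum sum_distrib_right lessThan_atLeast0 intro!: sum.cong)
  also have "\<dots> = act M (act N f) p"
    unfolding act_def using assms by (subst sum.swap) (auto simp: sum_distrib_left mult.assoc intro!: sum.cong)
  finally show ?thesis .
qed

lemma act_one [simp]: "p < k \<Longrightarrow> act (1\<^sub>m k) f p = f p"
  unfolding act_def by (subst sum.remove[of _ p]) auto

lemma act_zero [simp]: "p < a \<Longrightarrow> act (0\<^sub>m a b) f p = 0"
  unfolding act_def by auto

lemma act_uminus [simp]: "p < dim_row M \<Longrightarrow> act (- M) f p = - act M f p"
  unfolding act_def by (auto simp: sum_negf[symmetric] intro!: sum.cong)

lemma act_scale: "act M (\<lambda>q. c * f q) p = c * act M f p"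
  unfolding act_def by (auto simp: sum_distrib_left intro!: sum.cong)

lemma sum_lessThan_add:
  fixes g :: "nat \<Rightarrow> 'a::comm_monoid_add"
  shows "sum g {..<b + d} = sum g {..<b} + (\<Sum>q<d. g (b + q))"
  by (induction d) (auto simp: ac_simps)

lemma act_four_block:
  assumes "A \<in> carrier_mat a b" "B \<in> carrier_mat a d" "C \<in> carrier_mat c b" "D \<in> carrier_mat c d"
    and "p < a + c"
  shows "act (four_block_mat A B C D) f p =
    (if p < a then act A f p + act B (\<lambda>q. f (b + q)) p
     else act C f (p - a) + act D (\<lambda>q. f (b + q)) (p - a))"
  unfolding act_def using assms by (auto simp: sum_lessThan_add)

text \<open>
  A matrix is determined by its action, which is tested on the unit vectors. Products of block
  matrices are compared in this way without being multiplied out.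
\<close>
lemma mat_eq_by_act:
  assumes "M \<in> carrier_mat a b" "N \<in> carrier_mat a b"
    and "\<And>f p. p < a \<Longrightarrow> act M f p = act N f p"
  shows "M = N"
proof (rule eq_matI)
  fix i j assume ij: "i < dim_row N" "j < dim_col N"
  have *: "act K (\<lambda>q. if q = j then 1 else 0) i = ratc (K $$ (i, j))" if "K \<in> carrier_mat a b" for K
    unfolding act_def using that ij assms(2) by (subst sum.remove[of _ j]) auto
  have "ratc (M $$ (i, j)) = ratc (N $$ (i, j))"
    using assms(3)[of i "\<lambda>q. if q = j then 1 else 0"] ij assms(1,2) by (simp add: *)
  thus "M $$ (i, j) = N $$ (i, j)" by (simp add: ratc_def)
qed (use assms in auto)

lemma rat_const_mult_vec:
  assumes "p < dim_row M" "z \<in> carrier_vec (dim_col M)"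
  shows "(rat_const M *\<^sub>v z) $ p = act M (($) z) p"
  using assms unfolding act_def rat_const_eq
  by (auto simp: scalar_prod_def lessThan_atLeast0 intro!: sum.cong)

text \<open>
  The bound is an integer, and a negative bound leaves only zero. An equivalence of degree bounds
  for all integers therefore contains that one vector vanishes if and only if the other one does.
\<close>
definition degree_le :: "int \<Rightarrow> complex poly fract set" where
  "degree_le d = to_fract ` {p. p = 0 \<or> int (degree p) \<le> d}"

lemma to_fract_degree_le: "to_fract p \<in> degree_le d \<longleftrightarrow> p = 0 \<or> int (degree p) \<le> d"
  unfolding degree_le_def by auto

lemma degree_le_zero [simp]: "0 \<in> degree_le d"
  using to_fract_degree_le[of 0 d] by simp

lemma degree_le_mono: "x \<in> degree_le d \<Longrightarrow> d \<le> e \<Longrightarrow> x \<in> degree_le e"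
  unfolding degree_le_def by auto

lemma degree_le_add:
  assumes "x \<in> degree_le d" "y \<in> degree_le d" shows "x + y \<in> degree_le d"
proof -
  obtain p q where *: "x = to_fract p" "y = to_fract q" "p = 0 \<or> int (degree p) \<le> d" "q = 0 \<or> int (degree q) \<le> d"
    using assms unfolding degree_le_def by auto
  show ?thesis unfolding * to_fract_add[symmetric] to_fract_degree_le
    using *(3,4) degree_add_le_max[of p q] by auto
qed

lemma degree_le_ratc:
  assumes "x \<in> degree_le d" shows "ratc a * x \<in> degree_le d"
proof -
  obtain p where *: "x = to_fract p" "p = 0 \<or> int (degree p) \<le> d"
    using assms unfolding degree_le_def by auto
  show ?thesis unfolding * ratc_def to_fract_mult[symmetric] to_fract_degree_le
    using *(2) by auto
qed

lemma degree_le_uminus: "x \<in> degree_le d \<Longrightarrow> - x \<in> degree_le d"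
  using degree_le_ratc[of x d "-1"] by simp

lemma degree_le_diff: "x \<in> degree_le d \<Longrightarrow> y \<in> degree_le d \<Longrightarrow> x - y \<in> degree_le d"
  using degree_le_add[of x d "- y"] degree_le_uminus[of y] by simp

lemma degree_le_lam: "x \<in> degree_le d \<Longrightarrow> lam * x \<in> degree_le (d + 1)"
  unfolding degree_le_def lam_def
  by (auto simp: degree_pCons_eq simp flip: to_fract_mult intro!: imageI)

text \<open>
  The first assumption says that \<open>x\<close> is a polynomial, of whatever degree; it excludes a constant
  divided by \<open>\<lambda>\<close>.
\<close>
lemma degree_le_lam_cancel:
  assumes "x \<in> degree_le e" "lam * x \<in> degree_le (d + 1)"
  shows "x \<in> degree_le d"
proof -
  obtain p where x: "x = to_fract p" using assms(1) unfolding degree_le_def by auto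
  have "lam * x = to_fract (pCons 0 p)" by (simp add: x lam_def flip: to_fract_mult)
  with assms(2) show ?thesis by (auto simp: x to_fract_degree_le degree_pCons_eq split: if_splits)
qed

lemma degree_le_lam_power_cancel:
  assumes "x \<in> degree_le e" "lam ^ k * x \<in> degree_le (d + int k)"
  shows "x \<in> degree_le d"
  using assms
proof (induction k arbitrary: d)
  case (Suc k)
  have "lam ^ k * x \<in> degree_le (e + int k)" for k
    using Suc.prems(1) by (induction k) (auto simp: mult.assoc dest: degree_le_lam simp: algebra_simps)
  from degree_le_lam_cancel[OF this[of k], of "d + int k"] Suc show ?case
    by (auto simp: mult.assoc algebra_simps)
qed simp

lemma degree_le_act:
  assumes "\<And>q. q < dim_col M \<Longrightarrow> f q \<in> degree_le d"
  shows "act M f p \<in> degree_le d"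
proof -
  have sum_closed: "sum g Q \<in> degree_le d" if "finite Q" "\<And>q. q \<in> Q \<Longrightarrow> g q \<in> degree_le d" for g and Q :: "nat set"
    using that by (induction Q rule: finite_induct) (auto intro: degree_le_add)
  then show ?thesis unfolding act_def using assms by (intro sum_closed degree_le_ratc) auto
qed

section \<open>Action of elementary and Fiedler matrices on the block rows\<close>

text \<open>
  Blocks are numbered from the bottom and from 0, so that block \<open>j\<close> is block row \<open>m - j\<close> in the
  usual numbering. Then the elementary matrix with index \<open>i\<close> or \<open>-i\<close>, where \<open>0 < i < m\<close>, acts on the
  blocks \<open>i\<close> and \<open>i - 1\<close>, index 0 acts on block 0 and index \<open>-m\<close> on block \<open>m - 1\<close>. The tail consists
  of the last \<open>r\<close> entries.
\<close>
definition blk :: "nat \<Rightarrow> nat \<Rightarrow> (nat \<Rightarrow> 'a) \<Rightarrow> nat \<Rightarrow> nat \<Rightarrow> 'a" where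
  "blk m n f j k = f ((m - Suc j) * n + k)"

definition tail :: "nat \<Rightarrow> nat \<Rightarrow> (nat \<Rightarrow> 'a) \<Rightarrow> nat \<Rightarrow> 'a" where
  "tail m n f k = f (m * n + k)"

lemma blk_step:
  assumes "j' < j" "j < m"
  shows "(m - Suc j) * n + n \<le> (m - Suc j') * (n::nat)"
proof -
  have "Suc (m - Suc j) \<le> m - Suc j'" using assms by linarith
  from mult_le_mono1[OF this, of n] show ?thesis by simp
qed

lemma blk_pred:
  assumes "0 < i" "i < m"
  shows "(m - Suc (i - 1)) * n = (m - Suc i) * n + (n::nat)"
proof -
  have "m - Suc (i - 1) = Suc (m - Suc i)" using assms by linarith
  then show ?thesis by (simp only: mult_Suc add.commute)
qed

lemma blk_pos_less:
  assumes "j < m" "k < n"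
  shows "(m - Suc j) * n + k < m * (n::nat)"
proof -
  have "Suc (m - Suc j) \<le> m" using assms by linarith
  from mult_le_mono1[OF this, of n] show ?thesis using assms by simp
qed

lemma pos_cases:
  assumes "p < m * n + r"
  obtains j k where "j < m" "k < n" "p = (m - Suc j) * n + k"
  | k where "k < r" "p = m * n + k"
proof (cases "p < m * n")
  case True
  hence n: "n > 0" by (cases n) auto
  have "p div n < m" using True n by (simp add: less_mult_imp_div_less)
  hence "m - Suc (p div n) < m" "m - Suc (m - Suc (p div n)) = p div n" by auto
  with n show ?thesis by (intro that(1)[of "m - Suc (p div n)" "p mod n"]) auto
next
  case False
  with assms show ?thesis by (intro that(2)[of "p - m * n"]) auto
qed

lemma diag_block_mat2: "diag_block_mat [M, N] =
    four_block_mat M (0\<^sub>m (dim_row M) (dim_col N)) (0\<^sub>m (dim_row N) (dim_col M)) N"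
  by (simp only: diag_block_mat.simps(2)[of M] diag_block_mat_singleton Let_def)

lemma diag_block_mat3: "diag_block_mat [K, M, N] = diag_block_mat [K, diag_block_mat [M, N]]"
  by (simp only: diag_block_mat.simps(2)[of K] diag_block_mat_singleton)

lemma diag_block_mat2_carrier [simp]:
  "M \<in> carrier_mat a a \<Longrightarrow> N \<in> carrier_mat b b \<Longrightarrow> diag_block_mat [M, N] \<in> carrier_mat (a + b) (a + b)"
  unfolding diag_block_mat2 by auto

lemma act_diag_block2:
  assumes "M \<in> carrier_mat a a" "N \<in> carrier_mat b b" "p < a + b"
  shows "act (diag_block_mat [M, N]) f p = (if p < a then act M f p else act N (\<lambda>q. f (a + q)) (p - a))"
  unfolding diag_block_mat2 using assms
  by (subst act_four_block[where a=a and b=a and c=b and d=b]) auto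

lemma act_diag_block3:
  assumes "M \<in> carrier_mat c c" "p < a + (c + b)"
  shows "act (diag_block_mat [1\<^sub>m a, M, 1\<^sub>m b]) f p =
    (if a \<le> p \<and> p < a + c then act M (\<lambda>q. f (a + q)) (p - a) else f p)"
proof -
  have "diag_block_mat [M, 1\<^sub>m b] \<in> carrier_mat (c + b) (c + b)" using assms by (intro diag_block_mat2_carrier) auto
  from act_diag_block2[OF one_carrier_mat this assms(2)] assms show ?thesis
    unfolding diag_block_mat3 by (auto simp: act_diag_block2[where a=c and b=b] simp del: diag_block_mat.simps)
qed

lemma size_split:
  assumes "0 < i" "i < m"
  shows "(m - i - 1) * n + (n + n + (i - 1) * n) = m * (n::nat)"
proof -
  obtain s where s: "i = Suc s" using assms(1) by (cases i) auto
  obtain t where t: "m = i + 1 + t" using assms(2) by (metis Suc_eq_plus1 add_Suc less_natE)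
  show ?thesis by (simp add: s t algebra_simps)
qed

lemma index_cases:
  assumes "i \<in> {- int m..int m - 1}"
  obtains "i = 0" | "i = - int m" "i \<noteq> 0"
  | j where "i = int j" "0 < j" "j < m" | j where "i = - int j" "0 < j" "j < m"
proof -
  have "i = 0 \<or> i = - int m \<and> i \<noteq> 0 \<or> (\<exists>j. i = int j \<and> 0 < j \<and> j < m) \<or> (\<exists>j. i = - int j \<and> 0 < j \<and> j < m)"
    using assms by (cases i rule: int_cases2) auto
  with that show ?thesis by blast
qed

lemma elem_mat_carrier:
  assumes "X \<in> carrier_mat n n" "m \<ge> 1" "i \<in> {- int m..int m - 1}"
  shows "elem_mat m n i X \<in> carrier_mat (m * n) (m * n)"
proof -
  have e: "(m - 1) * n + n = m * n" using assms(2) by (cases m) auto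
  from assms(3) show ?thesis
  proof (cases rule: index_cases)
    case 1 with diag_block_mat2_carrier[OF one_carrier_mat assms(1), of "(m - 1) * n"] e show ?thesis
      by (simp add: elem_mat_def del: diag_block_mat.simps)
  next
    case 2 with diag_block_mat2_carrier[OF assms(1) one_carrier_mat, of "(m - 1) * n"] e show ?thesis
      by (simp add: elem_mat_def add.commute del: diag_block_mat.simps)
  next
    case (3 j)
    have "diag_block_mat [1\<^sub>m ((m - j - 1) * n), diag_block_mat [four_block_mat X (1\<^sub>m n) (1\<^sub>m n) (0\<^sub>m n n), 1\<^sub>m ((j - 1) * n)]]
      \<in> carrier_mat (m * n) (m * n)"
      using assms(1) unfolding size_split[OF 3(2,3), of n, symmetric]
      by (intro diag_block_mat2_carrier four_block_carrier_mat) auto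
    with 3 show ?thesis by (simp add: elem_mat_def diag_block_mat3 del: diag_block_mat.simps)
  next
    case (4 j)
    have "diag_block_mat [1\<^sub>m ((m - j - 1) * n), diag_block_mat [four_block_mat (0\<^sub>m n n) (1\<^sub>m n) (1\<^sub>m n) X, 1\<^sub>m ((j - 1) * n)]]
      \<in> carrier_mat (m * n) (m * n)"
      using assms(1) unfolding size_split[OF 4(2,3), of n, symmetric]
      by (intro diag_block_mat2_carrier four_block_carrier_mat) auto
    with 4 show ?thesis by (simp add: elem_mat_def diag_block_mat3 del: diag_block_mat.simps)
  qed
qed

lemma ext_elem_mat_carrier:
  assumes "X \<in> carrier_mat n n" "m \<ge> 1" "i \<in> {- int m..int m - 1}"
  shows "ext_elem_mat m n r i X \<in> carrier_mat (m * n + r) (m * n + r)"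
  unfolding ext_elem_mat_def by (rule diag_block_mat2_carrier[OF elem_mat_carrier[OF assms]]) auto

lemma act_ext_elem:
  assumes "X \<in> carrier_mat n n" "m \<ge> 1" "i \<in> {- int m..int m - 1}" "p < m * n + r"
  shows "act (ext_elem_mat m n r i X) f p = (if p < m * n then act (elem_mat m n i X) f p else f p)"
  unfolding ext_elem_mat_def
  by (subst act_diag_block2[OF elem_mat_carrier[OF assms(1-3)], of _ r]) (use assms in auto)

text \<open>
  The middle diagonal block occupies the blocks \<open>i\<close> and \<open>i - 1\<close>.
\<close>
lemma blk_act_middle:
  assumes i: "0 < i" "i < m" and F: "F \<in> carrier_mat (n + n) (n + n)" and jk: "j < m" "k < n"
  shows "blk m n (act (diag_block_mat [1\<^sub>m ((m - i - 1) * n), F, 1\<^sub>m ((i - 1) * n)]) f) j k =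
    (if j = i then act F (\<lambda>q. f ((m - Suc i) * n + q)) k
     else if j = i - 1 then act F (\<lambda>q. f ((m - Suc i) * n + q)) (n + k) else blk m n f j k)"
proof -
  define a where "a = (m - Suc i) * n"
  have a: "(m - i - 1) * n = a" by (simp add: a_def)
  have "(m - Suc j) * n + k < a + (n + n + (i - 1) * n)"
    using size_split[OF i, of n] blk_pos_less[OF jk] a by simp
  note pos = act_diag_block3[OF F this]
  have i1: "(m - Suc (i - 1)) * n = a + n" unfolding a_def by (rule blk_pred[OF i])
  consider "j > i" | "j = i" | "j = i - 1" "j < i" | "j < i - 1" using i(1) by linarith
  then show ?thesis
  proof cases
    case 1
    hence "(m - Suc j) * n + k < a" using blk_step[of i j m n] jk a_def by auto
    with 1 show ?thesis unfolding blk_def a pos by auto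
  next
    case 2
    with jk show ?thesis unfolding blk_def a pos by (simp add: a_def)
  next
    case 3
    with jk show ?thesis unfolding 3(1) blk_def a i1 pos[unfolded 3(1) i1] by (simp add: a_def)
  next
    case 4
    hence "a + n + n \<le> (m - Suc j) * n" using blk_step[of j "i - 1" m n] i i1 by auto
    with 4 show ?thesis unfolding blk_def a pos by auto
  qed
qed

lemma blk_fun: "blk m n f j = (\<lambda>k. f ((m - Suc j) * n + k))"
  by (simp add: blk_def fun_eq_iff)

lemma blk_act_ext_elem:
  assumes "X \<in> carrier_mat n n" "i \<in> {- int m..int m - 1}" "j < m" "k < n"
  shows "blk m n (act (ext_elem_mat m n r i X) f) j k = blk m n (act (elem_mat m n i X) f) j k"
  using assms blk_pos_less[OF assms(3,4)] by (simp add: blk_def act_ext_elem)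

lemma act_ext_elem_pos:
  assumes i: "0 < i" "i < m" and X: "X \<in> carrier_mat n n" and jk: "j < m" "k < n"
  shows "blk m n (act (ext_elem_mat m n r (int i) X) f) j k =
    (if j = i then act X (blk m n f i) k + blk m n f (i - 1) k
     else if j = i - 1 then blk m n f i k else blk m n f j k)"
proof -
  let ?F = "four_block_mat X (1\<^sub>m n) (1\<^sub>m n) (0\<^sub>m n n)"
  have F: "?F \<in> carrier_mat (n + n) (n + n)" using X by auto
  have "elem_mat m n (int i) X = diag_block_mat [1\<^sub>m ((m - i - 1) * n), ?F, 1\<^sub>m ((i - 1) * n)]"
    using i by (simp add: elem_mat_def del: diag_block_mat.simps)
  moreover have "blk m n (act (ext_elem_mat m n r (int i) X) f) j k = blk m n (act (elem_mat m n (int i) X) f) j k"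
    using X i jk by (intro blk_act_ext_elem) auto
  moreover have "act ?F (\<lambda>q. f ((m - Suc i) * n + q)) k = act X (blk m n f i) k + blk m n f (i - 1) k"
    "act ?F (\<lambda>q. f ((m - Suc i) * n + q)) (n + k) = blk m n f i k"
    using X jk unfolding blk_fun blk_pred[OF i]
    by (simp_all add: act_four_block[where a=n and b=n and c=n and d=n] add.assoc)
  ultimately show ?thesis by (simp only: blk_act_middle[OF i F jk])
qed

lemma act_ext_elem_neg:
  assumes i: "0 < i" "i < m" and X: "X \<in> carrier_mat n n" and jk: "j < m" "k < n"
  shows "blk m n (act (ext_elem_mat m n r (- int i) X) f) j k =
    (if j = i then blk m n f (i - 1) k
     else if j = i - 1 then blk m n f i k + act X (blk m n f (i - 1)) k else blk m n f j k)"
proof -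
  let ?F = "four_block_mat (0\<^sub>m n n) (1\<^sub>m n) (1\<^sub>m n) X"
  have F: "?F \<in> carrier_mat (n + n) (n + n)" using X by auto
  have "elem_mat m n (- int i) X = diag_block_mat [1\<^sub>m ((m - i - 1) * n), ?F, 1\<^sub>m ((i - 1) * n)]"
    using i by (simp add: elem_mat_def del: diag_block_mat.simps)
  moreover have "blk m n (act (ext_elem_mat m n r (- int i) X) f) j k = blk m n (act (elem_mat m n (- int i) X) f) j k"
    using X i jk by (intro blk_act_ext_elem) auto
  moreover have "act ?F (\<lambda>q. f ((m - Suc i) * n + q)) k = blk m n f (i - 1) k"
    "act ?F (\<lambda>q. f ((m - Suc i) * n + q)) (n + k) = blk m n f i k + act X (blk m n f (i - 1)) k"
    using X jk unfolding blk_fun blk_pred[OF i]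
    by (simp_all add: act_four_block[where a=n and b=n and c=n and d=n] add.assoc)
  ultimately show ?thesis by (simp only: blk_act_middle[OF i F jk])
qed

lemma act_ext_elem_zero:
  assumes "m \<ge> 1" "X \<in> carrier_mat n n" "j < m" "k < n"
  shows "blk m n (act (ext_elem_mat m n r 0 X) f) j k =
    (if j = 0 then act X (blk m n f 0) k else blk m n f j k)"
proof -
  have e: "(m - 1) * n + n = m * n" using assms by (cases m) auto
  have "(m - Suc j) * n + k < (m - 1) * n" if "j \<noteq> 0" using blk_step[of 0 j m n] that assms by auto
  with assms e blk_pos_less[OF assms(3,4)] show ?thesis unfolding blk_def
    by (auto simp: act_ext_elem elem_mat_def act_diag_block2[where a="(m - 1) * n" and b=n] simp del: diag_block_mat.simps)
qed

lemma act_ext_elem_top: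
  assumes "m \<ge> 1" "X \<in> carrier_mat n n" "j < m" "k < n"
  shows "blk m n (act (ext_elem_mat m n r (- int m) X) f) j k =
    (if j = m - 1 then act X (blk m n f (m - 1)) k else blk m n f j k)"
proof -
  have e: "n + (m - 1) * n = m * n" using assms by (cases m) auto
  have "\<not> (m - Suc j) * n + k < n" if "j \<noteq> m - 1"
  proof -
    have "j < m - 1" "m - 1 < m" using that assms by auto
    from blk_step[OF this, of n] show ?thesis by linarith
  qed
  with assms e blk_pos_less[OF assms(3,4)] show ?thesis unfolding blk_def
    by (auto simp: act_ext_elem elem_mat_def act_diag_block2[where a=n and b="(m - 1) * n"] simp del: diag_block_mat.simps)
qed

lemma act_ext_elem_tail:
  assumes "X \<in> carrier_mat n n" "m \<ge> 1" "i \<in> {- int m..int m - 1}" "k < r"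
  shows "tail m n (act (ext_elem_mat m n r i X) f) k = tail m n f k"
  using assms by (simp add: tail_def act_ext_elem)

lemma act_kron_ecol:
  assumes "C \<in> carrier_mat n r" "j < m" "k < n"
  shows "act (ecol m m \<otimes>\<^sub>k C) g ((m - Suc j) * n + k) = (if j = 0 then act C g k else 0)"
proof -
  have "ratc ((ecol m m \<otimes>\<^sub>k C) $$ ((m - Suc j) * n + k, q)) = (if j = 0 then ratc (C $$ (k, q)) else 0)" if "q < r" for q
    using assms that blk_pos_less[OF assms(2,3)] unfolding kronecker_def by (auto simp: ecol_def)
  then show ?thesis unfolding act_def using assms by (auto simp: kronecker_def ecol_def intro!: sum.cong)
qed

lemma act_kron_ecol_transpose:
  assumes "B \<in> carrier_mat r n" "k < r" "m \<ge> 1"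
  shows "act (transpose_mat (ecol m m) \<otimes>\<^sub>k B) f k = act B (blk m n f 0) k"
proof -
  have e: "m * n = (m - 1) * n + n" using assms by (cases m) auto
  have *: "(transpose_mat (ecol m m) \<otimes>\<^sub>k B) $$ (k, q) = (if Suc (q div n) = m then B $$ (k, q mod n) else 0)"
    if "q < m * n" for q
  proof -
    have "q div n < m" using that by (simp add: less_mult_imp_div_less)
    then show ?thesis
      using assms that unfolding kronecker_def by (auto simp: ecol_def)
  qed
  have "act (transpose_mat (ecol m m) \<otimes>\<^sub>k B) f k = (\<Sum>q<m * n. ratc (if Suc (q div n) = m then B $$ (k, q mod n) else 0) * f q)"
  proof -
    have "dim_col (transpose_mat (ecol m m) \<otimes>\<^sub>k B) = m * n"
      using assms by (simp add: kronecker_def ecol_def)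
    then show ?thesis unfolding act_def by (intro sum.cong) (simp_all add: *)
  qed
  also have "\<dots> = (\<Sum>q<(m - 1) * n. ratc (if Suc (q div n) = m then B $$ (k, q mod n) else 0) * f q) +
     (\<Sum>q<n. ratc (if Suc (((m - 1) * n + q) div n) = m then B $$ (k, ((m - 1) * n + q) mod n) else 0) * f ((m - 1) * n + q))"
    unfolding e by (rule sum_lessThan_add)
  also have "(\<Sum>q<(m - 1) * n. ratc (if Suc (q div n) = m then B $$ (k, q mod n) else 0) * f q) = 0"
  proof (intro sum.neutral ballI)
    fix q assume "q \<in> {..<(m - 1) * n}"
    hence "q div n < m - 1" by (simp add: less_mult_imp_div_less)
    thus "ratc (if Suc (q div n) = m then B $$ (k, q mod n) else 0) * f q = 0" by auto
  qed
  also have "(\<Sum>q<n. ratc (if Suc (((m - 1) * n + q) div n) = m then B $$ (k, ((m - 1) * n + q) mod n) else 0) * f ((m - 1) * n + q))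
     = act B (blk m n f 0) k"
    unfolding act_def using assms by (auto simp: blk_def intro!: sum.cong)
  finally show ?thesis by simp
qed

locale system_data =
  fixes m n r :: nat and As :: "nat \<Rightarrow> complex mat" and A B C E :: "complex mat"
  assumes m: "m \<ge> 1"
    and As: "\<And>i. i \<le> m \<Longrightarrow> As i \<in> carrier_mat n n"
    and ABCE: "A \<in> carrier_mat r r" "B \<in> carrier_mat r n" "C \<in> carrier_mat n r" "E \<in> carrier_mat r r"
begin

abbreviation "FM \<equiv> fiedler_sys m n r As A B C E"

lemma fiedler_sys_pos:
  assumes "0 < i" "i < m"
  shows "FM (int i) = ext_elem_mat m n r (int i) (- As i)"
  using assms by (simp add: fiedler_sys_def ext_elem_mat_def fiedler_poly_def)

lemma fiedler_poly_carrier: "i \<in> {- int m..int m - 1} \<Longrightarrow> fiedler_poly m n As i \<in> carrier_mat (m * n) (m * n)"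
  unfolding fiedler_poly_def using As m by (auto intro!: elem_mat_carrier)

lemma fiedler_sys_zero_carrier: "FM 0 \<in> carrier_mat (m * n + r) (m * n + r)"
  using fiedler_poly_carrier[of 0] ABCE m by (auto simp: fiedler_sys_def kronecker_def ecol_def)

lemma act_fiedler_zero:
  assumes "j < m" "k < n"
  shows "blk m n (act (FM 0) f) j k =
    (if j = 0 then - act (As 0) (blk m n f 0) k - act C (tail m n f) k else blk m n f j k)"
proof -
  let ?p = "(m - Suc j) * n + k"
  have p: "?p < m * n" by (rule blk_pos_less[OF assms])
  have c: "- (ecol m m \<otimes>\<^sub>k C) \<in> carrier_mat (m * n) r"
      "- (transpose_mat (ecol m m) \<otimes>\<^sub>k B) \<in> carrier_mat r (m * n)"
    using ABCE by (auto simp: kronecker_def ecol_def)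
  have "act (FM 0) f ?p = act (fiedler_poly m n As 0) f ?p + act (- (ecol m m \<otimes>\<^sub>k C)) (tail m n f) ?p"
    using p ABCE c fiedler_poly_carrier[of 0] m unfolding fiedler_sys_def tail_def
    by (simp add: act_four_block[where a="m * n" and b="m * n" and c=r and d=r])
  also have "act (fiedler_poly m n As 0) f ?p = act (ext_elem_mat m n r 0 (- As 0)) f ?p"
    using As m p by (subst act_ext_elem) (auto simp: fiedler_poly_def)
  also have "\<dots> = (if j = 0 then - act (As 0) (blk m n f 0) k else blk m n f j k)"
    using act_ext_elem_zero[of m "- As 0" n j k r f] As[of 0] m assms by (auto simp: blk_def)
  also have "act (- (ecol m m \<otimes>\<^sub>k C)) (tail m n f) ?p = - act (ecol m m \<otimes>\<^sub>k C) (tail m n f) ?p"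
    using p ABCE by (subst act_uminus) (auto simp: kronecker_def ecol_def)
  finally show ?thesis using assms act_kron_ecol[OF ABCE(3) assms] by (auto simp: blk_def)
qed

lemma act_fiedler_zero_tail:
  assumes "k < r"
  shows "tail m n (act (FM 0) f) k = - act B (blk m n f 0) k - act A (tail m n f) k"
proof -
  have c: "- (ecol m m \<otimes>\<^sub>k C) \<in> carrier_mat (m * n) r"
      "- (transpose_mat (ecol m m) \<otimes>\<^sub>k B) \<in> carrier_mat r (m * n)"
    using ABCE by (auto simp: kronecker_def ecol_def)
  have "act (- (transpose_mat (ecol m m) \<otimes>\<^sub>k B)) f k = - act (transpose_mat (ecol m m) \<otimes>\<^sub>k B) f k"
    using assms ABCE by (subst act_uminus) (auto simp: kronecker_def ecol_def)
  moreover have "act (FM 0) f (m * n + k) = act (- (transpose_mat (ecol m m) \<otimes>\<^sub>k B)) f k + act (- A) (tail m n f) k"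
    using ABCE assms c fiedler_poly_carrier[of 0] m unfolding fiedler_sys_def tail_def
    by (simp add: act_four_block[where a="m * n" and b="m * n" and c=r and d=r])
  ultimately show ?thesis using assms act_kron_ecol_transpose[OF ABCE(2) assms m] ABCE by (simp add: tail_def)
qed

lemma fiedler_sys_top_carrier: "FM (- int m) \<in> carrier_mat (m * n + r) (m * n + r)"
  using fiedler_poly_carrier[of "- int m"] ABCE m by (auto simp: fiedler_sys_def Let_def)

lemma act_fiedler_top:
  assumes "j < m" "k < n"
  shows "blk m n (act (FM (- int m)) f) j k =
    (if j = m - 1 then act (As m) (blk m n f (m - 1)) k else blk m n f j k)"
proof -
  let ?p = "(m - Suc j) * n + k"
  have p: "?p < m * n" by (rule blk_pos_less[OF assms])
  have "act (FM (- int m)) f ?p = act (ext_elem_mat m n r (- int m) (As m)) f ?p"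
    using p m As[of m] ABCE fiedler_poly_carrier[of "- int m"]
    by (simp add: fiedler_sys_def act_ext_elem act_diag_block2[where a="m * n" and b=r] fiedler_poly_def
       del: diag_block_mat.simps)
  with act_ext_elem_top[OF m As[of m] assms, of r f] show ?thesis by (simp add: blk_def)
qed

lemma act_fiedler_top_tail:
  assumes "k < r"
  shows "tail m n (act (FM (- int m)) f) k = - act E (tail m n f) k"
  using m ABCE fiedler_poly_carrier[of "- int m"] assms unfolding tail_def
  by (simp add: fiedler_sys_def act_diag_block2[where a="m * n" and b=r] del: diag_block_mat.simps)

end

section \<open>Block rows of products of elementary matrices and the successor infix property\<close>

text \<open>
  Block \<open>c\<close> of \<open>M z\<close>, for an elementary matrix \<open>M\<close> with index \<open>c + 1\<close>, is block \<open>c + 1\<close> of \<open>z\<close>; for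
  every other nonnegative index except \<open>c\<close> it is block \<open>c\<close> of \<open>z\<close>. Reading a product from the left to the
  right, the block that has to be looked up in \<open>z\<close> thus moves from \<open>c\<close> to \<open>c + 1\<close> at each factor with
  index \<open>c + 1\<close>. If the start is \<open>-1\<close>, before any block is chosen, the chase ends at the largest \<open>p\<close>
  such that \<open>0, \<dots>, p\<close> is a subtuple, because it searches greedily for this subtuple.
\<close>
fun chase :: "int \<Rightarrow> int list \<Rightarrow> int" where
  "chase c [] = c"
| "chase c (x # xs) = chase (if x = c + 1 then c + 1 else c) xs"

text \<open>
  The chase breaks off at a factor whose index is the current one, because the corresponding block
  row contains the assigned matrix.
\<close>
fun undisturbed :: "int \<Rightarrow> int list \<Rightarrow> bool" where
  "undisturbed c [] \<longleftrightarrow> True"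
| "undisturbed c (x # xs) \<longleftrightarrow> x \<noteq> c \<and> undisturbed (if x = c + 1 then c + 1 else c) xs"

lemma chase_append: "chase c (xs @ ys) = chase (chase c xs) ys"
  by (induction xs arbitrary: c) auto

lemma chase_notin: "c + 1 \<notin> set xs \<Longrightarrow> chase c xs = c"
  by (induction xs) auto

lemma chase_ge: "c \<le> chase c xs"
proof (induction xs arbitrary: c)
  case (Cons x xs)
  from Cons[of "c + 1"] Cons[of c] show ?case by simp
qed simp

lemma chase_in: "chase c xs = c \<or> chase c xs \<in> set xs"
proof (induction xs arbitrary: c)
  case (Cons x xs)
  from Cons[of "c + 1"] Cons[of c] show ?case by auto
qed simp

text \<open>
  A greedy search for a subtuple finds the longest possible one.
\<close>
lemma subseq_upto_iff: "subseq [c + 1..p] xs \<longleftrightarrow> p \<le> chase c xs"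
proof (induction xs arbitrary: c)
  case (Cons x xs)
  show ?case
  proof (cases "p \<le> c")
    case True
    with chase_ge[of c "x # xs"] show ?thesis by auto
  next
    case False
    hence "[c + 1..p] = (c + 1) # [(c + 1) + 1..p]" by (simp add: upto.simps)
    with Cons[of "c + 1"] Cons[of c] show ?thesis by (auto simp: subseq_Cons2_iff)
  qed
next
  case Nil
  show ?case
  proof (cases "p \<le> c")
    case False
    hence "[c + 1..p] = (c + 1) # [(c + 1) + 1..p]" by (simp add: upto.simps)
    with False show ?thesis by simp
  qed auto
qed

lemma c0_eq_chase:
  assumes "0 \<in> set xs"
  shows "int (c0 xs) = chase (-1) xs"
proof -
  have "subseq [0..0] xs" using assms by (simp add: subseq_singleton_left)
  with subseq_upto_iff[of "-1" 0 xs] have "chase (-1) xs \<ge> 0" by simp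
  moreover have "{p. subseq [0..int p] xs} = {p. int p \<le> chase (-1) xs}"
    using subseq_upto_iff[of "-1" _ xs] by simp
  moreover have "{p. int p \<le> chase (-1) xs} = {..nat (chase (-1) xs)}"
    using \<open>chase (-1) xs \<ge> 0\<close> by auto
  moreover have "Max {..k} = k" for k :: nat by (rule Max_eqI) auto
  ultimately show ?thesis unfolding c0_def by simp
qed

text \<open>
  The last step of the chase took some occurrence of \<open>c\<close>; a later \<open>c + 1\<close> would have
  prolonged it.
\<close>
lemma chase_split:
  assumes "chase d xs = c" "c \<noteq> d"
  shows "\<exists>ys zs. xs = ys @ c # zs \<and> c + 1 \<notin> set zs"
  using assms
proof (induction xs arbitrary: d)
  case (Cons x xs)
  show ?case
  proof (cases "x = d + 1")
    case True
    show ?thesis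
    proof (cases "c = d + 1")
      case c: True
      have "c + 1 \<notin> set xs"
      proof
        assume "c + 1 \<in> set xs"
        with subseq_upto_iff[of c "c + 1" xs] have "c + 1 \<le> chase c xs" by (simp add: subseq_singleton_left)
        with Cons.prems True c show False by simp
      qed
      with True c show ?thesis by (intro exI[of _ "[]"] exI[of _ xs]) simp
    next
      case False
      with Cons.IH[of "d + 1"] Cons.prems True obtain ys zs where "xs = ys @ c # zs" "c + 1 \<notin> set zs" by auto
      then show ?thesis by (intro exI[of _ "x # ys"] exI[of _ zs]) simp
    qed
  next
    case False
    with Cons.IH[of d] Cons.prems obtain ys zs where "xs = ys @ c # zs" "c + 1 \<notin> set zs" by auto
    then show ?thesis by (intro exI[of _ "x # ys"] exI[of _ zs]) simp
  qed
qed auto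

lemma SIP_appendD2: "SIP (xs @ ys) \<Longrightarrow> SIP ys"
  unfolding SIP_def
proof (intro allI impI)
  fix a b assume *: "\<forall>a b. a < b \<and> b < length (xs @ ys) \<and> (xs @ ys) ! a = (xs @ ys) ! b \<longrightarrow>
     (\<exists>c>a. c < b \<and> (xs @ ys) ! c = (xs @ ys) ! a + 1)" and ab: "a < b \<and> b < length ys \<and> ys ! a = ys ! b"
  from *[rule_format, of "length xs + a" "length xs + b"] ab
  obtain c where c: "c > length xs + a" "c < length xs + b" "(xs @ ys) ! c = ys ! a + 1"
    by auto
  then show "\<exists>c>a. c < b \<and> ys ! c = ys ! a + 1"
    by (intro exI[of _ "c - length xs"]) (auto simp: nth_append)
qed

lemma SIP_distinct: "distinct xs \<Longrightarrow> SIP xs"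
  unfolding SIP_def by (metis less_imp_neq nth_eq_iff_index_eq order_less_trans)

text \<open>
  If the current index \<open>c\<close> came again, the successor infix property would demand an entry \<open>c + 1\<close>
  between this entry and the last \<open>c\<close> in \<open>xs\<close>, and at that entry the chase would have moved on.
\<close>
lemma SIP_undisturbed:
  assumes "SIP (xs @ ys)" "0 \<in> set xs"
  shows "undisturbed (chase (-1) xs) ys"
  using assms
proof (induction ys arbitrary: xs)
  case (Cons y ys)
  define c where "c = chase (-1) xs"
  have "c \<noteq> -1" using c0_eq_chase[OF Cons.prems(2)] unfolding c_def by linarith
  then obtain us vs where xs: "xs = us @ c # vs" and vs: "c + 1 \<notin> set vs"
    using chase_split[of "-1" xs c] c_def by auto
  have "y \<noteq> c"
  proof
    assume "y = c"
    hence "SIP (us @ (c # vs @ c # ys))" using Cons.prems(1) xs by simp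
    from SIP_appendD2[OF this, unfolded SIP_def, rule_format, of 0 "Suc (length vs)"]
    obtain p where "0 < p" "p < Suc (length vs)" "(c # vs @ c # ys) ! p = c + 1" by (auto simp: nth_append)
    hence "c + 1 \<in> set vs" by (cases p) (auto simp: nth_append dest: nth_mem)
    with vs show False ..
  qed
  moreover have "undisturbed (chase (-1) (xs @ [y])) ys" using Cons.prems by (intro Cons.IH) auto
  ultimately show ?case by (simp add: chase_append c_def)
qed auto

abbreviation acts :: "complex mat list \<Rightarrow> (nat \<Rightarrow> complex poly fract) \<Rightarrow> nat \<Rightarrow> complex poly fract" where
  "acts \<equiv> foldr act"

lemma mat_prod_carrier: "set Ms \<subseteq> carrier_mat N N \<Longrightarrow> mat_prod N Ms \<in> carrier_mat N N"
  unfolding mat_prod_def by (induction Ms) auto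

lemma mat_prod_append:
  assumes "set Ms \<subseteq> carrier_mat N N" "set Ns \<subseteq> carrier_mat N N"
  shows "mat_prod N (Ms @ Ns) = mat_prod N Ms * mat_prod N Ns"
  using assms
proof (induction Ms)
  case Nil
  then show ?case using mat_prod_carrier[of Ns N] by (simp add: mat_prod_def)
next
  case (Cons M Ms)
  have "mat_prod N ((M # Ms) @ Ns) = M * mat_prod N (Ms @ Ns)" by (simp add: mat_prod_def)
  also have "\<dots> = M * mat_prod N Ms * mat_prod N Ns"
    using Cons mat_prod_carrier[of Ms N] mat_prod_carrier[of Ns N] by (simp add: assoc_mult_mat[of M N N])
  finally show ?case by (simp add: mat_prod_def)
qed

lemma act_mat_prod:
  assumes "set Ms \<subseteq> carrier_mat N N" "p < N"
  shows "act (mat_prod N Ms) f p = acts Ms f p"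
  using assms
proof (induction Ms arbitrary: p)
  case (Cons M Ms)
  have "act (mat_prod N (M # Ms)) f p = act M (act (mat_prod N Ms) f) p"
    using act_mult[of M N N "mat_prod N Ms" N p f] Cons.prems mat_prod_carrier[of Ms N] by (simp add: mat_prod_def)
  also have "\<dots> = act M (acts Ms f) p"
    using Cons by (intro act_cong) auto
  finally show ?case by simp
qed (simp add: mat_prod_def)

lemma chase_acts:
  assumes "length Xs = length t" "set Xs \<subseteq> carrier_mat n n" "set t \<subseteq> {0..int m - 1}"
    and "undisturbed (int c) t" "c < m" "k < n"
  shows "blk m n (acts (map2 (ext_elem_mat m n r) t Xs) f) c k = blk m n f (nat (chase (int c) t)) k"
  using assms
proof (induction t arbitrary: c Xs)
  case (Cons x t)
  obtain X Ys where Xs: "Xs = X # Ys" using Cons.prems(1) by (cases Xs) auto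
  define g where "g = acts (map2 (ext_elem_mat m n r) t Ys) f"
  have eq: "acts (map2 (ext_elem_mat m n r) (x # t) Xs) f = act (ext_elem_mat m n r x X) g"
    by (simp add: Xs g_def)
  have X: "X \<in> carrier_mat n n" using Cons.prems Xs by auto
  obtain i where i: "x = int i" "i < m" using Cons.prems(3) nonneg_int_cases[of x] by auto
  have IH: "blk m n g c' k = blk m n f (nat (chase (int c') t)) k" if "undisturbed (int c') t" "c' < m" for c'
    unfolding g_def using Cons.prems Xs that by (intro Cons.IH) auto
  show ?case
  proof (cases "i = Suc c")
    case True
    have "blk m n (act (ext_elem_mat m n r x X) g) c k = blk m n g (Suc c) k"
      using act_ext_elem_pos[of i m X n c k r g] True i X Cons.prems by auto
    moreover have x: "x = int c + 1" "int c + 1 = int (Suc c)" using True i by simp_all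
    moreover have "undisturbed (int (Suc c)) t" using Cons.prems(4) x by simp
    moreover have "chase (int c) (x # t) = chase (int (Suc c)) t" using x by (simp add: add.commute)
    ultimately show ?thesis using IH[of "Suc c"] True i unfolding eq by simp
  next
    case False
    have ic: "i \<noteq> c" using Cons.prems(4) i by auto
    have "blk m n (act (ext_elem_mat m n r x X) g) c k = blk m n g c k"
    proof (cases "i = 0")
      case True
      with act_ext_elem_zero[of m X n c k r g] ic i X Cons.prems show ?thesis by auto
    next
      case i0: False
      with act_ext_elem_pos[of i m X n c k r g] ic False i X Cons.prems show ?thesis by auto
    qed
    moreover have "x \<noteq> int c + 1" using False i by auto
    ultimately show ?thesis using IH[of c] Cons.prems by (simp add: eq)
  qed
qed auto

section \<open>The recurrences behind a Fiedler pencil\<close>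

text \<open>
  Where \<open>K\<close> marks the consecutions, this is the number of inversions below \<open>i\<close>.
\<close>
definition num_false :: "(nat \<Rightarrow> bool) \<Rightarrow> nat \<Rightarrow> nat" where
  "num_false K i = card {t. t < i \<and> \<not> K t}"

lemma num_false_0 [simp]: "num_false K 0 = 0"
  by (simp add: num_false_def)

lemma num_false_Suc [simp]: "num_false K (Suc i) = (if K i then num_false K i else Suc (num_false K i))"
proof -
  have "{t. t < Suc i \<and> \<not> K t} = (if K i then {} else {i}) \<union> {t. t < i \<and> \<not> K t}"
    by (auto simp: less_Suc_eq)
  then show ?thesis unfolding num_false_def by auto
qed

lemma num_false_le: "num_false K i \<le> i"
  by (induction i) auto

lemma num_false_mono: "i \<le> j \<Longrightarrow> num_false K i \<le> num_false K j"
  by (induction j) (auto simp: le_Suc_eq)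

context system_data
begin

text \<open>
  The equation \<open>\<lambda> M\<^sub>-\<^sub>m w = M\<^sub>\<alpha> w\<close>, in which \<open>w\<close> has the blocks \<open>w i\<close> and the tail \<open>v\<close>, written
  in terms of what the single factors of \<open>M\<^sub>\<alpha>\<close> read: factor \<open>i\<close> reads \<open>a i\<close> in block \<open>i\<close> and \<open>b i\<close> in block
  \<open>i - 1\<close>, and writes \<open>b i - A\<^sub>i (a i)\<close> and \<open>a i\<close> there. If \<open>K i\<close> holds (a consecution), factor \<open>i + 1\<close>
  acts before factor \<open>i\<close>: it reads block \<open>i\<close> of \<open>w\<close> itself and hands \<open>a (i + 1)\<close> over to factor \<open>i\<close>,
  whose output must be \<open>\<lambda>\<close> times block \<open>i\<close>. Otherwise factor \<open>i\<close> reads block \<open>i\<close> of \<open>w\<close> and hands its output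
  over as \<open>b (i + 1)\<close>, and the block that must be \<open>\<lambda>\<close> times block \<open>i\<close> is \<open>a (i + 1)\<close>. Below block 0
  there is no block, and \<open>-C v\<close> takes the place of \<open>b 0\<close>.
\<close>
definition flow where
  "flow K w a b v \<longleftrightarrow>
    (\<forall>k<n. b 0 k = - act C v k \<and> w (m - 1) k = a (m - 1) k \<and>
       lam * act (As m) (a (m - 1)) k = b (m - 1) k - act (As (m - 1)) (a (m - 1)) k) \<and>
    (\<forall>i<m - 1. \<forall>k<n.
       if K i then a (Suc i) k = a i k \<and> w i k = b (Suc i) k \<and> lam * b (Suc i) k = b i k - act (As i) (a i) k
       else a (Suc i) k = lam * a i k \<and> w i k = a i k \<and> b (Suc i) k = b i k - act (As i) (a i) k) \<and>
    (\<forall>k<r. lam * act E v k = act B (a 0) k + act A v k)"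

text \<open>
  The two block rows of the equation which says that the system matrix annihilates \<open>u\<close> over \<open>v\<close>.
\<close>
definition system_kernel where
  "system_kernel u v \<longleftrightarrow>
    (\<forall>k<n. (\<Sum>i\<le>m. lam ^ i * act (As i) u k) + act C v k = 0) \<and>
    (\<forall>k<r. lam * act E v k = act B u k + act A v k)"

lemma flow_a:
  assumes "flow K w a b v" "i \<le> m - 1" "k < n"
  shows "a i k = lam ^ num_false K i * a 0 k"
  using assms(2)
proof (induction i)
  case (Suc i)
  with assms(1,3) show ?case unfolding flow_def by (auto split: if_splits)
qed simp

lemma flow_act_a:
  assumes "flow K w a b v" "i \<le> m - 1" "l \<le> m"
  shows "act (As l) (a i) k = lam ^ num_false K i * act (As l) (a 0) k"
proof -
  have "dim_col (As l) = n" using As[OF assms(3)] by auto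
  with assms flow_a show ?thesis unfolding act_scale[symmetric] by (intro act_cong) metis
qed

text \<open>
  Every step subtracts the next summand of \<open>P(\<lambda>) (a 0)\<close>, and every consecution divides by \<open>\<lambda>\<close>.
\<close>
lemma flow_b:
  assumes f: "flow K w a b v" and "i \<le> m - 1" "k < n"
  shows "lam ^ (i - num_false K i) * b i k = - act C v k - (\<Sum>j<i. lam ^ j * act (As j) (a 0) k)"
  using assms(2)
proof (induction i)
  case 0
  with f assms(3) show ?case unfolding flow_def by auto
next
  case (Suc i)
  have le: "num_false K i \<le> i" by (rule num_false_le)
  have i: "i < m - 1" using Suc.prems by simp
  have e: "lam ^ (i - num_false K i) * (b i k - act (As i) (a i) k) =
     - act C v k - (\<Sum>j<i. lam ^ j * act (As j) (a 0) k) - lam ^ i * act (As i) (a 0) k"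
    using Suc le flow_act_a[OF f, of i i] by (simp add: right_diff_distrib flip: power_add mult.assoc)
  show ?case
  proof (cases "K i")
    case True
    hence "lam * b (Suc i) k = b i k - act (As i) (a i) k"
      using f i assms(3) unfolding flow_def by auto
    with e have "lam ^ (i - num_false K i) * (lam * b (Suc i) k) =
      - act C v k - (\<Sum>j<Suc i. lam ^ j * act (As j) (a 0) k)" by simp
    moreover have "Suc i - num_false K i = Suc (i - num_false K i)" using le by simp
    ultimately show ?thesis using True by (simp add: algebra_simps)
  next
    case False
    hence "b (Suc i) k = b i k - act (As i) (a i) k"
      using f i assms(3) unfolding flow_def by auto
    with e False show ?thesis by simp
  qed
qed

lemma lam_power_cancel: "lam ^ k * x = lam ^ k * y \<longleftrightarrow> x = y"
  by simp

lemma sum_top: "(\<Sum>i\<le>m. lam ^ i * act (As i) u k) =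
   (\<Sum>i<m - 1. lam ^ i * act (As i) u k) + lam ^ (m - 1) * act (As (m - 1)) u k + lam ^ m * act (As m) u k"
proof -
  obtain m' where "m = Suc m'" using m by (cases m) auto
  then show ?thesis by (simp add: lessThan_Suc_atMost[symmetric])
qed

text \<open>
  After multiplication by the power of \<open>\<lambda>\<close> that belongs to the consecutions, the equation at
  the top completes the partial sum to the first block row of the system.
\<close>
lemma top_equation:
  assumes "\<And>i. i \<le> m \<Longrightarrow> act (As i) a' k = lam ^ s * act (As i) u k" "s \<le> m - 1"
    and "lam ^ (m - 1 - s) * b' = - act C v k - (\<Sum>j<m - 1. lam ^ j * act (As j) u k)"
  shows "lam * act (As m) a' k = b' - act (As (m - 1)) a' k \<longleftrightarrow>
    (\<Sum>i\<le>m. lam ^ i * act (As i) u k) + act C v k = 0"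
proof -
  have p: "lam ^ (m - 1 - s) * lam ^ s = lam ^ (m - 1)" "lam * lam ^ (m - 1) = lam ^ m"
    using assms(2) m by (auto simp flip: power_add power_Suc)
  have "lam * act (As m) a' k = b' - act (As (m - 1)) a' k \<longleftrightarrow>
    lam ^ (m - 1 - s) * (lam * act (As m) a' k) = lam ^ (m - 1 - s) * (b' - act (As (m - 1)) a' k)"
    by (simp only: lam_power_cancel)
  also have "lam ^ (m - 1 - s) * (lam * act (As m) a' k) = lam ^ m * act (As m) u k"
    unfolding p[symmetric] by (simp add: assms(1) ac_simps)
  also have "lam ^ (m - 1 - s) * (b' - act (As (m - 1)) a' k) =
     - act C v k - (\<Sum>j<m - 1. lam ^ j * act (As j) u k) - lam ^ (m - 1) * act (As (m - 1)) u k"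
    unfolding p(1)[symmetric] by (simp only: right_diff_distrib assms(3) assms(1)[OF diff_le_self] mult.assoc)
  finally show ?thesis unfolding sum_top by (auto simp: algebra_simps eq_neg_iff_add_eq_0)
qed

lemma flow_system_kernel:
  assumes f: "flow K w a b v"
  shows "system_kernel (a 0) v"
proof -
  have "(\<Sum>i\<le>m. lam ^ i * act (As i) (a 0) k) + act C v k = 0" if "k < n" for k
  proof -
    have "lam * act (As m) (a (m - 1)) k = b (m - 1) k - act (As (m - 1)) (a (m - 1)) k"
      using f that by (simp add: flow_def)
    with top_equation[OF flow_act_a[OF f order_refl] num_false_le flow_b[OF f order_refl that]]
    show ?thesis by simp
  qed
  with f show ?thesis unfolding system_kernel_def flow_def by auto
qed

text \<open>
  The recurrences can be solved upwards from block 0, dividing by \<open>\<lambda>\<close> at the consecutions.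
\<close>
lemma flow_exists:
  assumes S: "system_kernel u v"
  obtains w a b where "flow K w a b v" "a 0 = u"
proof -
  define a where "a i k = lam ^ num_false K i * u k" for i k
  \<comment> \<open>the division by \<open>\<lambda>\<close> at a consecution\<close>
  define b where "b = rec_nat (\<lambda>k. - act C v k) (\<lambda>i bi k. (if K i then inverse lam else 1) * (bi k - act (As i) (a i) k))"
  define w where "w i k = (if i < m - 1 \<and> K i then b (Suc i) k else a i k)" for i k
  have b0: "b 0 k = - act C v k" for k by (simp add: b_def)
  have bS: "b (Suc i) k = (if K i then inverse lam else 1) * (b i k - act (As i) (a i) k)" for i k
    by (simp add: b_def)
  have aS: "a (Suc i) k = (if K i then a i k else lam * a i k)" for i k by (simp add: a_def)
  have act_a: "act (As l) (a i) k = lam ^ num_false K i * act (As l) u k" for l i k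
    unfolding a_def act_scale[symmetric] by simp
  have b: "lam ^ (i - num_false K i) * b i k = - act C v k - (\<Sum>j<i. lam ^ j * act (As j) u k)" for i k
  proof (induction i)
    case 0
    show ?case by (simp add: b0)
  next
    case (Suc i)
    have le: "num_false K i \<le> i" by (rule num_false_le)
    have "lam ^ (Suc i - num_false K (Suc i)) * b (Suc i) k = lam ^ (i - num_false K i) * (b i k - act (As i) (a i) k)"
      using le by (auto simp: bS Suc_diff_le)
    also have "\<dots> = - act C v k - (\<Sum>j<i. lam ^ j * act (As j) u k) - lam ^ i * act (As i) u k"
      using Suc le by (simp add: act_a right_diff_distrib flip: power_add mult.assoc)
    finally show ?case by simp
  qed
  have top: "lam * act (As m) (a (m - 1)) k = b (m - 1) k - act (As (m - 1)) (a (m - 1)) k" if "k < n" for k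
    using top_equation[OF act_a num_false_le b] that S by (simp add: system_kernel_def)
  have a0: "a 0 = u" by (simp add: a_def fun_eq_iff)
  have "flow K w a b v"
    unfolding flow_def using S top by (auto simp: b0 w_def aS bS a0 system_kernel_def simp flip: mult.assoc)
  with a0 show ?thesis by (intro that)
qed

text \<open>
  As \<open>E\<close> is invertible, the second block row expresses \<open>\<lambda> v\<close> by \<open>u\<close> and \<open>v\<close> with constant coefficients.
  A degree bound for \<open>v\<close> that exceeds \<open>d\<close> is therefore never attained, and decreases to \<open>d\<close>.
\<close>
lemma tail_degree_le:
  assumes S: "system_kernel u v" and "invertible_mat E"
    and "\<And>k. k < n \<Longrightarrow> u k \<in> degree_le d" and "\<And>k. k < r \<Longrightarrow> v k \<in> degree_le (d + int e)"
  shows "\<And>k. k < r \<Longrightarrow> v k \<in> degree_le d"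
  using assms(4)
proof (induction e)
  case (Suc e)
  obtain E' where E': "E' \<in> carrier_mat r r" "E' * E = 1\<^sub>m r"
    using assms(2) ABCE unfolding invertible_mat_def inverts_mat_def
    by (metis carrier_matD(1) carrier_matD(2) carrier_matI index_mult_mat(2,3) index_one_mat(2,3))
  have "v k \<in> degree_le (d + int e)" if k: "k < r" for k
  proof -
    have "lam * v k = act E' (\<lambda>q. lam * act E v q) k"
      using act_mult[OF E'(1) ABCE(4) k, of v] E'(2) k by (simp add: act_scale)
    also have "\<dots> = act E' (\<lambda>q. act B u q + act A v q) k"
      using S E' by (intro act_cong) (auto simp: system_kernel_def)
    also have "\<dots> \<in> degree_le (d + int (Suc e))"
      using degree_le_mono[OF assms(3), of _ "d + int (Suc e)"] Suc.prems(2) ABCE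
      by (intro degree_le_act degree_le_add) auto
    finally show ?thesis using degree_le_lam_cancel[of "v k" "d + int (Suc e)" "d + int e"] Suc.prems(2)[OF k] by (simp add: ac_simps)
  qed
  with Suc show ?case by blast
qed simp

text \<open>
  The division by \<open>\<lambda>\<close> in the upward recurrence could leave the polynomials. Read downwards from the
  top, the same equations contain multiplications only, hence all \<open>b i\<close> are polynomials. After this, the
  upward recurrence bounds their degrees: a consecution does not change the bound, and an inversion
  increases it by one.
\<close>
lemma flow_degree_le:
  assumes f: "flow K w a b v"
    and u: "\<And>k. k < n \<Longrightarrow> a 0 k \<in> degree_le d" and v: "\<And>k. k < r \<Longrightarrow> v k \<in> degree_le d"
    and "i < m" "k < n"
  shows "w i k \<in> degree_le (d + int (num_false K (m - 1)))"
proof -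
  let ?s = "num_false K"
  have lam_pow: "lam ^ l * x \<in> degree_le (e + int l)" if "x \<in> degree_le e" for x l e
    using that by (induction l) (auto simp: mult.assoc algebra_simps dest: degree_le_lam)
  have a: "a i k \<in> degree_le (d + int (?s i))" if "i \<le> m - 1" "k < n" for i k
    using flow_a[OF f that] lam_pow[OF u[OF that(2)]] by simp
  have Aa: "act (As l) (a i) k \<in> degree_le (d + int (?s i))" if "i \<le> m - 1" "l \<le> m" for l i k
    using a As[OF that(2)] that by (intro degree_le_act) auto
  \<comment> \<open>the set of all polynomials\<close>
  define D where "D = (\<Union>d. degree_le d)"
  have D: "x \<in> degree_le e \<Longrightarrow> x \<in> D" for x e unfolding D_def by auto
  have D_add: "x \<in> D \<Longrightarrow> y \<in> D \<Longrightarrow> x + y \<in> D" for x y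
    unfolding D_def by clarsimp (metis degree_le_add degree_le_mono linorder_le_cases)
  have D_lam: "x \<in> D \<Longrightarrow> lam * x \<in> D" for x
    unfolding D_def using degree_le_lam by blast
  \<comment> \<open>downwards from the top: no division occurs\<close>
  have bD: "b (m - 1 - j) k \<in> D" if "k < n" "j \<le> m - 1" for j k
    using that(2)
  proof (induction j)
    case 0
    have "b (m - 1) k = lam * act (As m) (a (m - 1)) k + act (As (m - 1)) (a (m - 1)) k"
      using f that(1) unfolding flow_def by (auto simp: algebra_simps)
    moreover have "\<dots> \<in> D" by (intro D_add D_lam D[OF Aa]) auto
    ultimately show ?case by simp
  next
    case (Suc j)
    define i where "i = m - 1 - Suc j"
    have i: "i < m - 1" "m - 1 - j = Suc i" using Suc.prems i_def by auto
    have "b i k = (if K i then lam * b (Suc i) k else b (Suc i) k) + act (As i) (a i) k"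
      using f i(1) that(1) unfolding flow_def by (auto simp: algebra_simps split: if_splits)
    moreover have "b (Suc i) k \<in> D" using Suc i by simp
    moreover have "act (As i) (a i) k \<in> D" using i(1) by (intro D[OF Aa]) auto
    ultimately show ?case unfolding i_def[symmetric] by (auto intro: D_add D_lam)
  qed
  \<comment> \<open>upwards from the bottom: the degree bounds\<close>
  have b: "b i k \<in> degree_le (d + int (?s i))" if "i \<le> m - 1" "k < n" for i k
    using that(1)
  proof (induction i)
    case 0
    have "b 0 k = - act C v k" using f that unfolding flow_def by auto
    with v ABCE show ?case by (auto intro!: degree_le_uminus degree_le_act)
  next
    case (Suc i)
    have i: "i < m - 1" using Suc.prems by simp
    have diff: "b i k - act (As i) (a i) k \<in> degree_le (d + int (?s i))"
      using Suc Aa[of i i] by (intro degree_le_diff) auto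
    show ?case
    proof (cases "K i")
      case True
      have "b (Suc i) k \<in> D" using bD[OF that(2), of "m - 1 - Suc i"] Suc.prems by simp
      then obtain e where e: "b (Suc i) k \<in> degree_le e" by (auto simp: D_def)
      have lam_b: "lam * b (Suc i) k \<in> degree_le (d + int (?s i) + 1)"
        using f i that(2) True diff unfolding flow_def by (auto intro: degree_le_mono)
      from degree_le_lam_cancel[OF e lam_b] True show ?thesis by simp
    next
      case False
      hence "b (Suc i) k = b i k - act (As i) (a i) k" using f i that(2) unfolding flow_def by auto
      with diff False show ?thesis by (auto intro: degree_le_mono)
    qed
  qed
  show ?thesis
  proof (cases "i < m - 1")
    case True
    hence "w i k = (if K i then b (Suc i) k else a i k)"
      using f assms(5) unfolding flow_def by auto
    moreover have "?s i \<le> ?s (m - 1)" "?s (Suc i) \<le> ?s (m - 1)"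
      using True num_false_mono[of i "m - 1" K] num_false_mono[of "Suc i" "m - 1" K] by linarith+
    ultimately show ?thesis using True a[of i k] b[of "Suc i" k] assms(5)
      by (smt (verit) Suc_leI degree_le_mono less_imp_le of_nat_mono)
  next
    case False
    with assms(4) have "i = m - 1" by simp
    with f assms(5) a[of i k] show ?thesis unfolding flow_def by auto
  qed
qed

end

section \<open>Null vectors of a Fiedler pencil\<close>

context system_data
begin

text \<open>
  Block \<open>j\<close> is touched only by the factors \<open>j\<close> and \<open>j + 1\<close>.
\<close>
lemma blk_run_unchanged:
  assumes "set t \<subseteq> {0..int m - 1}" "int j \<notin> set t" "int (Suc j) \<notin> set t" "j < m" "k < n"
  shows "blk m n (acts (map FM t) f) j k = blk m n f j k"
  using assms(1-3)
proof (induction t)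
  case (Cons x t)
  obtain i where i: "x = int i" "i < m" using Cons.prems(1) nonneg_int_cases[of x] by auto
  define g where "g = acts (map FM t) f"
  have ij: "i \<noteq> j" "i \<noteq> Suc j" using Cons.prems i by auto
  have "blk m n (act (FM x) g) j k = blk m n g j k"
  proof (cases "i = 0")
    case True
    with act_fiedler_zero[OF assms(4,5), of g] ij i show ?thesis by auto
  next
    case False
    then show ?thesis using act_ext_elem_pos[of i m "- As i" n j k r g] assms(4,5) As[of i] ij i
      by (auto simp: fiedler_sys_pos)
  qed
  with Cons show ?case by (simp add: g_def)
qed simp

lemma tail_run_unchanged:
  assumes "set t \<subseteq> {1..int m - 1}" "k < r"
  shows "tail m n (acts (map FM t) f) k = tail m n f k"
  using assms(1)
proof (induction t)
  case (Cons x t)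
  obtain i where i: "x = int i" "i < m" "i > 0" using Cons.prems(1) nonneg_int_cases[of x] by auto
  have "tail m n (act (FM x) (acts (map FM t) f)) k = tail m n (acts (map FM t) f) k"
    using act_ext_elem_tail[of "- As i" n m "int i" k r] As[of i] i m assms(2) by (auto simp: fiedler_sys_pos)
  with Cons show ?case by simp
qed simp

lemma fiedler_as_ext:
  assumes "set t \<subseteq> {1..int m - 1}"
  obtains Xs where "length Xs = length t" "set Xs \<subseteq> carrier_mat n n" "map FM t = map2 (ext_elem_mat m n r) t Xs"
proof -
  define Xs where "Xs = map (\<lambda>i. - As (nat i)) t"
  have "FM x = ext_elem_mat m n r x (- As (nat x))" if "x \<in> set t" for x
    using assms that fiedler_sys_pos[of "nat x"] by (auto dest!: subsetD)
  then have "map FM t = map2 (ext_elem_mat m n r) t Xs"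
    unfolding Xs_def by (auto simp: zip_map2 zip_same_conv_map)
  moreover have "set Xs \<subseteq> carrier_mat n n" using assms As unfolding Xs_def by force
  moreover have "length Xs = length t" by (simp add: Xs_def)
  ultimately show ?thesis using that by blast
qed

end

definition after :: "'a \<Rightarrow> 'a list \<Rightarrow> 'a list" where
  "after x xs = tl (dropWhile (\<lambda>y. y \<noteq> x) xs)"

lemma after_append: "x \<notin> set ys \<Longrightarrow> after x (ys @ x # zs) = zs"
  unfolding after_def by (subst dropWhile_append2) auto

lemma has_consecution_at_split:
  assumes "distinct \<alpha>"
  shows "has_consecution_at \<alpha> t \<longleftrightarrow> (\<exists>us vs ws. \<alpha> = us @ t # vs @ (t + 1) # ws)"
proof
  assume "has_consecution_at \<alpha> t"
  then obtain a b where ab: "a < b" "b < length \<alpha>" "\<alpha> ! a = t" "\<alpha> ! b = t + 1"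
    unfolding has_consecution_at_def by auto
  have "\<alpha> = take a \<alpha> @ t # drop (Suc a) \<alpha>" using ab id_take_nth_drop[of a \<alpha>] by simp
  moreover have "t + 1 \<in> set (drop (Suc a) \<alpha>)"
    using ab by (auto simp: in_set_conv_nth intro!: exI[of _ "b - Suc a"])
  then obtain vs ws where "drop (Suc a) \<alpha> = vs @ (t + 1) # ws" by (auto dest: split_list)
  ultimately show "\<exists>us vs ws. \<alpha> = us @ t # vs @ (t + 1) # ws" by metis
next
  assume "\<exists>us vs ws. \<alpha> = us @ t # vs @ (t + 1) # ws"
  then obtain us vs ws where "\<alpha> = us @ t # vs @ (t + 1) # ws" by auto
  then show "has_consecution_at \<alpha> t" unfolding has_consecution_at_def
    by (intro exI[of _ "length us"] exI[of _ "length us + Suc (length vs)"]) (auto simp: nth_append)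
qed

lemma no_consecution_at_split:
  assumes "distinct \<alpha>" "t \<in> set \<alpha>" "t + 1 \<in> set \<alpha>" "\<not> has_consecution_at \<alpha> t"
  obtains us vs ws where "\<alpha> = us @ (t + 1) # vs @ t # ws"
proof -
  obtain us ws where a: "\<alpha> = us @ t # ws" using assms(2) by (auto dest: split_list)
  have "t + 1 \<notin> set ws"
    using assms(4) a unfolding has_consecution_at_split[OF assms(1)] by (metis split_list)
  with assms(3) a have "t + 1 \<in> set us" by auto
  then obtain xs ys where "us = xs @ (t + 1) # ys" by (auto dest: split_list)
  with a that show ?thesis by simp
qed

text \<open>
  The pencil \<open>\<lambda> M\<^sub>-\<^sub>m - M\<^sub>\<alpha>\<close> of a permutation \<open>\<alpha>\<close> of all nonnegative indices.
\<close>
locale fiedler_pencil = system_data +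
  fixes \<alpha> :: "int list"
  assumes distinct: "distinct \<alpha>" and set_\<alpha>: "set \<alpha> = {0..int m - 1}"
begin

definition consecution :: "nat \<Rightarrow> bool" where
  "consecution i \<longleftrightarrow> has_consecution_at \<alpha> (int i)"

lemma inversions_eq: "inversions m \<alpha> = num_false consecution (m - 1)"
proof -
  have "{t \<in> {0..int m - 2}. \<not> has_consecution_at \<alpha> t} = int ` {t. t < m - 1 \<and> \<not> consecution t}"
  proof (intro equalityI subsetI)
    fix t assume "t \<in> {t \<in> {0..int m - 2}. \<not> has_consecution_at \<alpha> t}"
    then show "t \<in> int ` {t. t < m - 1 \<and> \<not> consecution t}"
      by (intro image_eqI[of _ _ "nat t"]) (auto simp: consecution_def)
  qed (auto simp: consecution_def)
  then show ?thesis unfolding inversions_def num_false_def by (simp add: card_image)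
qed

lemma mem_\<alpha>: "int i \<in> set \<alpha> \<longleftrightarrow> i < m"
  using set_\<alpha> by auto

lemma zero_split:
  obtains us ws where "\<alpha> = us @ 0 # ws" "after 0 \<alpha> = ws" "0 \<notin> set us"
  "set us \<subseteq> {1..int m - 1}" "set ws \<subseteq> {1..int m - 1}"
proof -
  have "0 \<in> set \<alpha>" using mem_\<alpha>[of 0] m by simp
  then obtain us ws where a: "\<alpha> = us @ 0 # ws" using split_list by metis
  have n: "0 \<notin> set us" "0 \<notin> set ws" using distinct unfolding a by auto
  have "x \<in> {1..int m - 1}" if "x \<in> set us \<union> set ws" for x
  proof -
    have "x \<in> set \<alpha>" "x \<noteq> 0" using that n unfolding a by auto
    then show ?thesis unfolding set_\<alpha> by simp
  qed
  with n(1) a after_append[OF n(1), of ws] show ?thesis by (intro that[of us ws]) auto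
qed

text \<open>
  The vector \<open>f\<close> is followed through the factors of \<open>M\<^sub>\<alpha>\<close>, which act from the right to the left. The
  state that factor \<open>i\<close> finds is \<open>before f i\<close>, and it reads \<open>upper f i\<close> and \<open>lower f i\<close>; the lower input
  of factor 0 comes from the tail.
\<close>
definition before :: "(nat \<Rightarrow> complex poly fract) \<Rightarrow> nat \<Rightarrow> nat \<Rightarrow> complex poly fract" where
  "before f i = acts (map FM (after (int i) \<alpha>)) f"

definition upper where
  "upper f i = blk m n (before f i) i"

definition lower where
  "lower f i = (if i = 0 then (\<lambda>k. - act C (tail m n f) k) else blk m n (before f i) (i - 1))"

lemma factor_output:
  assumes "i < m" "k < n"
  shows "blk m n (act (FM (int i)) (before f i)) i k = lower f i k - act (As i) (upper f i) k"
    and "0 < i \<Longrightarrow> blk m n (act (FM (int i)) (before f i)) (i - 1) k = upper f i k"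
proof -
  show "blk m n (act (FM (int i)) (before f i)) i k = lower f i k - act (As i) (upper f i) k"
  proof (cases "i = 0")
    case True
    obtain us ws where a: "\<alpha> = us @ 0 # ws" "after 0 \<alpha> = ws" "0 \<notin> set us"
      "set us \<subseteq> {1..int m - 1}" "set ws \<subseteq> {1..int m - 1}" by (rule zero_split)
    have "tail m n (before f 0) q = tail m n f q" if "q < r" for q
      using tail_run_unchanged[OF a(5) that] by (simp add: before_def a(2))
    hence "act C (tail m n (before f 0)) k = act C (tail m n f) k"
      using ABCE by (intro act_cong) auto
    with True show ?thesis using act_fiedler_zero[of 0 k] assms by (simp add: lower_def upper_def)
  next
    case False
    with act_ext_elem_pos[of i m "- As i" n i k r "before f i"] assms As[of i] show ?thesis
      by (auto simp: fiedler_sys_pos lower_def upper_def)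
  qed
  show "blk m n (act (FM (int i)) (before f i)) (i - 1) k = upper f i k" if "0 < i"
    using that act_ext_elem_pos[of i m "- As i" n "i - 1" k r "before f i"] assms As[of i]
    by (auto simp: fiedler_sys_pos upper_def)
qed

text \<open>
  Factor \<open>i + 1\<close> acts first. It finds block \<open>i\<close> of \<open>f\<close> in its original state and leaves its upper
  input there, which factor \<open>i\<close> then reads. Nothing touches block \<open>i\<close> after that.
\<close>
lemma trajectory_consecution:
  assumes "consecution i" "i < m - 1" "k < n"
  shows "upper f i k = upper f (Suc i) k" "lower f (Suc i) k = blk m n f i k"
    "blk m n (acts (map FM \<alpha>) f) i k = lower f i k - act (As i) (upper f i) k"
proof -
  obtain us vs ws where a: "\<alpha> = us @ int i # vs @ (int i + 1) # ws"
    using assms(1) unfolding consecution_def has_consecution_at_split[OF distinct] by auto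
  have e: "int i + 1 = int (Suc i)" by simp
  note a = a[unfolded e]
  have after1: "after (int (Suc i)) \<alpha> = ws"
    using after_append[of "int (Suc i)" "us @ int i # vs" ws] a distinct by simp
  have after0: "after (int i) \<alpha> = vs @ int (Suc i) # ws"
    using after_append[of "int i" us] a distinct by simp
  have im: "i < m" "Suc i < m" using assms(2) by auto
  have sub: "set us \<subseteq> {0..int m - 1}" "set vs \<subseteq> {0..int m - 1}" "set ws \<subseteq> {0..int m - 1}"
    using a unfolding set_\<alpha>[symmetric] by auto
  have ni: "int i \<notin> set us" "int i \<notin> set vs" "int i \<notin> set ws"
    "int (Suc i) \<notin> set us" "int (Suc i) \<notin> set vs" "int (Suc i) \<notin> set ws"
    using a distinct by auto
  have "upper f i k = blk m n (acts (map FM vs) (act (FM (int (Suc i))) (before f (Suc i)))) i k"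
    unfolding upper_def before_def after0 after1 by simp
  also have "\<dots> = upper f (Suc i) k"
    using blk_run_unchanged[OF sub(2) ni(2,5) im(1) assms(3)] factor_output(2)[OF im(2) assms(3)] by simp
  finally show "upper f i k = upper f (Suc i) k" .
  show "lower f (Suc i) k = blk m n f i k"
    unfolding lower_def before_def after1 using blk_run_unchanged[OF sub(3) ni(3,6) im(1) assms(3)] by simp
  have "acts (map FM \<alpha>) f = acts (map FM us) (act (FM (int i)) (before f i))"
    unfolding before_def after0 by (subst a) simp
  then show "blk m n (acts (map FM \<alpha>) f) i k = lower f i k - act (As i) (upper f i) k"
    using blk_run_unchanged[OF sub(1) ni(1,4) im(1) assms(3)] factor_output(1)[OF im(1) assms(3)] by simp
qed

text \<open>
  Factor \<open>i\<close> acts first. It finds block \<open>i\<close> of \<open>f\<close> in its original state and leaves its output there;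
  factor \<open>i + 1\<close> reads this as its lower input and replaces it by its upper input.
\<close>
lemma trajectory_inversion:
  assumes "\<not> consecution i" "i < m - 1" "k < n"
  shows "upper f i k = blk m n f i k" "lower f (Suc i) k = lower f i k - act (As i) (upper f i) k"
    "blk m n (acts (map FM \<alpha>) f) i k = upper f (Suc i) k"
proof -
  have e: "int i + 1 = int (Suc i)" by simp
  have im: "i < m" "Suc i < m" using assms(2) by auto
  obtain us vs ws where a: "\<alpha> = us @ int (Suc i) # vs @ int i # ws"
    using no_consecution_at_split[OF distinct, of "int i"] assms(1) im mem_\<alpha> unfolding consecution_def e by metis
  have after1: "after (int i) \<alpha> = ws"
    using after_append[of "int i" "us @ int (Suc i) # vs" ws] a distinct by simp
  have after0: "after (int (Suc i)) \<alpha> = vs @ int i # ws"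
    using after_append[of "int (Suc i)" us] a distinct by simp
  have sub: "set us \<subseteq> {0..int m - 1}" "set vs \<subseteq> {0..int m - 1}" "set ws \<subseteq> {0..int m - 1}"
    using a unfolding set_\<alpha>[symmetric] by auto
  have ni: "int i \<notin> set us" "int i \<notin> set vs" "int i \<notin> set ws"
    "int (Suc i) \<notin> set us" "int (Suc i) \<notin> set vs" "int (Suc i) \<notin> set ws"
    using a distinct by auto
  show "upper f i k = blk m n f i k"
    using blk_run_unchanged[OF sub(3) ni(3,6) im(1) assms(3)] by (simp add: upper_def before_def after1)
  have "lower f (Suc i) k = blk m n (acts (map FM vs) (act (FM (int i)) (before f i))) i k"
    unfolding lower_def before_def after0 after1 by simp
  also have "\<dots> = lower f i k - act (As i) (upper f i) k"
    using blk_run_unchanged[OF sub(2) ni(2,5) im(1) assms(3)] factor_output(1)[OF im(1) assms(3)] by simp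
  finally show "lower f (Suc i) k = lower f i k - act (As i) (upper f i) k" .
  have "acts (map FM \<alpha>) f = acts (map FM us) (act (FM (int (Suc i))) (before f (Suc i)))"
    unfolding before_def after0 by (subst a) simp
  then show "blk m n (acts (map FM \<alpha>) f) i k = upper f (Suc i) k"
    using blk_run_unchanged[OF sub(1) ni(1,4) im(1) assms(3)] factor_output(2)[OF im(2) assms(3)] by simp
qed

lemma trajectory_top:
  assumes "k < n"
  shows "upper f (m - 1) k = blk m n f (m - 1) k"
    "blk m n (acts (map FM \<alpha>) f) (m - 1) k = lower f (m - 1) k - act (As (m - 1)) (upper f (m - 1)) k"
proof -
  have im: "m - 1 < m" using m by simp
  then obtain us ws where a: "\<alpha> = us @ int (m - 1) # ws" using mem_\<alpha> by (metis split_list)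
  have after: "after (int (m - 1)) \<alpha> = ws" using after_append[of "int (m - 1)" us] a distinct by simp
  have sub: "set us \<subseteq> {0..int m - 1}" "set ws \<subseteq> {0..int m - 1}"
    using a unfolding set_\<alpha>[symmetric] by auto
  have ni: "int (m - 1) \<notin> set us" "int (m - 1) \<notin> set ws" using a distinct by auto
  have ni': "int (Suc (m - 1)) \<notin> set us" "int (Suc (m - 1)) \<notin> set ws" using sub by auto
  show "upper f (m - 1) k = blk m n f (m - 1) k"
    unfolding upper_def before_def after by (rule blk_run_unchanged[OF sub(2) ni(2) ni'(2) im assms])
  have "acts (map FM \<alpha>) f = acts (map FM us) (act (FM (int (m - 1))) (before f (m - 1)))"
    unfolding before_def after by (subst a) simp
  then show "blk m n (acts (map FM \<alpha>) f) (m - 1) k = lower f (m - 1) k - act (As (m - 1)) (upper f (m - 1)) k"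
    using blk_run_unchanged[OF sub(1) ni(1) ni'(1) im assms] factor_output(1)[OF im assms] by simp
qed

lemma trajectory_tail:
  assumes "k < r"
  shows "tail m n (acts (map FM \<alpha>) f) k = - act B (upper f 0) k - act A (tail m n f) k"
proof -
  obtain us ws where a: "\<alpha> = us @ 0 # ws" "after 0 \<alpha> = ws" "0 \<notin> set us"
    "set us \<subseteq> {1..int m - 1}" "set ws \<subseteq> {1..int m - 1}" by (rule zero_split)
  have "acts (map FM \<alpha>) f = acts (map FM us) (act (FM 0) (before f 0))"
    unfolding before_def using a(2) by (subst a(1)) simp
  hence "tail m n (acts (map FM \<alpha>) f) k = - act B (upper f 0) k - act A (tail m n (before f 0)) k"
    using tail_run_unchanged[OF a(4) assms] act_fiedler_zero_tail[OF assms] by (simp add: upper_def)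
  also have "act A (tail m n (before f 0)) k = act A (tail m n f) k"
    using ABCE a(2) tail_run_unchanged[OF a(5)] by (intro act_cong) (auto simp: before_def)
  finally show ?thesis .
qed

text \<open>
  The input of factor 0 is chased through the factors to the right of it; in the chase through all
  of \<open>\<alpha>\<close>, the factors to the left of it only pass by.
\<close>
lemma upper_zero:
  assumes "k < n"
  shows "upper f 0 k = blk m n f (c0 \<alpha>) k"
proof -
  obtain us ws where a: "\<alpha> = us @ 0 # ws" "after 0 \<alpha> = ws" "0 \<notin> set us"
    "set us \<subseteq> {1..int m - 1}" "set ws \<subseteq> {1..int m - 1}" by (rule zero_split)
  have "SIP ((us @ [0]) @ ws)" using distinct a(1) by (intro SIP_distinct) simp
  from SIP_undisturbed[OF this] a(3) have u: "undisturbed (int 0) ws"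
    by (simp add: chase_append chase_notin)
  have c: "chase (-1) \<alpha> = chase (int 0) ws" unfolding a(1) using a(3) by (simp add: chase_append chase_notin)
  have "0 \<in> set \<alpha>" using a(1) by simp
  from c0_eq_chase[OF this] c have c0: "c0 \<alpha> = nat (chase (int 0) ws)" by simp
  obtain Xs where "length Xs = length ws" "set Xs \<subseteq> carrier_mat n n" "map FM ws = map2 (ext_elem_mat m n r) ws Xs"
    using fiedler_as_ext[OF a(5)] by blast
  moreover have "set ws \<subseteq> {0..int m - 1}" using a(5) by auto
  ultimately show ?thesis using chase_acts[of Xs ws n m 0 k r f] u m assms
    unfolding upper_def before_def c0 by (simp add: a(2))
qed

definition kernel_equation where
  "kernel_equation f \<longleftrightarrow> (\<forall>p<m * n + r. lam * act (FM (- int m)) f p = acts (map FM \<alpha>) f p)"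

lemma kernel_equation_blocks:
  "kernel_equation f \<longleftrightarrow>
    (\<forall>i<m. \<forall>k<n. lam * blk m n (act (FM (- int m)) f) i k = blk m n (acts (map FM \<alpha>) f) i k) \<and>
    (\<forall>k<r. lam * tail m n (act (FM (- int m)) f) k = tail m n (acts (map FM \<alpha>) f) k)"
proof (intro iffI conjI allI impI)
  fix i k assume "kernel_equation f" "i < m" "k < n"
  with blk_pos_less[of i m k n] show "lam * blk m n (act (FM (- int m)) f) i k = blk m n (acts (map FM \<alpha>) f) i k"
    unfolding kernel_equation_def blk_def by simp
next
  fix k assume "kernel_equation f" "k < r"
  then show "lam * tail m n (act (FM (- int m)) f) k = tail m n (acts (map FM \<alpha>) f) k"
    unfolding kernel_equation_def tail_def by simp
next
  assume *: "(\<forall>i<m. \<forall>k<n. lam * blk m n (act (FM (- int m)) f) i k = blk m n (acts (map FM \<alpha>) f) i k) \<and>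
    (\<forall>k<r. lam * tail m n (act (FM (- int m)) f) k = tail m n (acts (map FM \<alpha>) f) k)"
  show "kernel_equation f" unfolding kernel_equation_def
  proof (intro allI impI)
    fix p assume "p < m * n + r"
    then show "lam * act (FM (- int m)) f p = acts (map FM \<alpha>) f p"
      by (cases rule: pos_cases) (use * in \<open>auto simp: blk_def tail_def\<close>)
  qed
qed

lemma kernel_equation_iff:
  "kernel_equation f \<longleftrightarrow>
    (\<forall>i<m - 1. \<forall>k<n. lam * blk m n f i k = blk m n (acts (map FM \<alpha>) f) i k) \<and>
    (\<forall>k<n. lam * act (As m) (blk m n f (m - 1)) k = lower f (m - 1) k - act (As (m - 1)) (upper f (m - 1)) k) \<and>
    (\<forall>k<r. lam * act E (tail m n f) k = act B (upper f 0) k + act A (tail m n f) k)"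
proof -
  have all: "(\<forall>i<m. P i) \<longleftrightarrow> (\<forall>i<m - 1. P i) \<and> P (m - 1)" for P
  proof -
    obtain m' where "m = Suc m'" using m by (cases m) auto
    then show ?thesis by (auto simp: less_Suc_eq)
  qed
  have neg: "lam * (- x) = - y - z \<longleftrightarrow> lam * x = y + z" for x y z
  proof -
    have "lam * (- x) = - (lam * x)" "- y - z = - (y + z)" by simp_all
    then show ?thesis by (simp only: neg_equal_iff_equal)
  qed
  show ?thesis
    unfolding kernel_equation_blocks all
    using m by (auto simp: act_fiedler_top act_fiedler_top_tail trajectory_tail trajectory_top neg simp del: mult_minus_right One_nat_def)
qed

lemma kernel_flow:
  assumes "kernel_equation f"
  shows "flow consecution (blk m n f) (upper f) (lower f) (tail m n f)"
proof -
  have "act (As m) (blk m n f (m - 1)) k = act (As m) (upper f (m - 1)) k" for k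
    using As[of m] trajectory_top(1) by (intro act_cong) auto
  with assms show ?thesis
    unfolding flow_def kernel_equation_iff
    by (auto simp: trajectory_top trajectory_consecution trajectory_inversion lower_def[of f 0] simp del: One_nat_def)
qed

text \<open>
  Build \<open>f\<close> from the blocks \<open>w i\<close> and the tail \<open>v\<close>. The inputs that the factors read from \<open>f\<close> satisfy the
  same recurrences as \<open>a\<close> and \<open>b\<close>. These determine \<open>a\<close> from the top downwards and then \<open>b\<close> from the bottom
  upwards, so the two trajectories agree.
\<close>
lemma flow_kernel:
  assumes f: "flow consecution w a b v"
  obtains f where "kernel_equation f" "\<And>i k. i < m \<Longrightarrow> k < n \<Longrightarrow> blk m n f i k = w i k"
    "\<And>k. tail m n f k = v k" "\<And>k. k < n \<Longrightarrow> upper f 0 k = a 0 k"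
proof -
  define f where "f p = (if p < m * n then w (m - Suc (p div n)) (p mod n) else v (p - m * n))" for p
  have w: "blk m n f i k = w i k" if "i < m" "k < n" for i k
    using that blk_pos_less[OF that] by (simp add: f_def blk_def)
  have v: "tail m n f = v" by (auto simp: f_def tail_def)
  have up: "upper f (m - 1 - j) k = a (m - 1 - j) k" if "k < n" "j \<le> m - 1" for j k
    using that(2)
  proof (induction j)
    case 0
    then show ?case using trajectory_top(1)[OF that(1)] w[of "m - 1" k] that(1) m f by (simp add: flow_def)
  next
    case (Suc j)
    define i where "i = m - 1 - Suc j"
    have i: "i < m - 1" "m - 1 - j = Suc i" using Suc.prems i_def by auto
    have IH: "upper f (Suc i) k = a (Suc i) k" using Suc i by simp
    show ?case unfolding i_def[symmetric]
      using f i(1) that(1) IH trajectory_consecution(1)[of i k f] trajectory_inversion(1)[of i k f] w[of i k]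
      unfolding flow_def by (cases "consecution i") auto
  qed
  have up: "upper f i k = a i k" if "i \<le> m - 1" "k < n" for i k
  proof -
    have "m - 1 - (m - 1 - i) = i" using that by simp
    with up[of k "m - 1 - i"] that show ?thesis by simp
  qed
  have act_up: "act (As l) (upper f i) k = act (As l) (a i) k" if "i \<le> m - 1" "l \<le> m" for l i k
    using up that As[OF that(2)] by (intro act_cong) auto
  have low: "lower f i k = b i k" if "i \<le> m - 1" "k < n" for i k
    using that(1)
  proof (induction i)
    case 0
    with f that(2) show ?case by (auto simp: flow_def lower_def v)
  next
    case (Suc i)
    hence i: "i < m - 1" by simp
    show ?case using f i that(2) Suc trajectory_consecution(2)[of i k f] trajectory_inversion(2)[of i k f] w[of i k] act_up[of i i k]
      unfolding flow_def by (cases "consecution i") auto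
  qed
  have "act B (upper f 0) k = act B (a 0) k" for k
    using ABCE up by (intro act_cong) auto
  moreover have "act (As m) (blk m n f (m - 1)) k = act (As m) (a (m - 1)) k" for k
    using As[of m] w[of "m - 1"] f m by (intro act_cong) (auto simp: flow_def)
  moreover have "lam * blk m n f i k = blk m n (acts (map FM \<alpha>) f) i k" if "i < m - 1" "k < n" for i k
    using f that w[of i k] trajectory_consecution(3)[of i k f] trajectory_inversion(3)[of i k f] up[of "Suc i" k] low[of i k] act_up[of i i k]
    unfolding flow_def by (cases "consecution i") auto
  ultimately have "kernel_equation f"
    unfolding kernel_equation_iff using f low act_up by (auto simp: flow_def v)
  with w v up[OF le0] that show ?thesis by metis
qed

end

section \<open>Minimal bases under degree-shifting isomorphisms\<close>

lemma kernel_basis_image: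
  fixes F :: "'a::field mat" and F' :: "'a mat"
  assumes F: "F \<in> carrier_mat a' a" and F': "F' \<in> carrier_mat b' b"
    and bij: "bij_betw \<phi> (mat_kernel F) (mat_kernel F')"
    and add: "\<And>x y. x \<in> mat_kernel F \<Longrightarrow> y \<in> mat_kernel F \<Longrightarrow> \<phi> (x + y) = \<phi> x + \<phi> y"
    and smult: "\<And>c x. x \<in> mat_kernel F \<Longrightarrow> \<phi> (c \<cdot>\<^sub>v x) = c \<cdot>\<^sub>v \<phi> x"
    and basis: "vectorspace.basis class_ring ((module_vec TYPE('a) a)\<lparr>carrier := mat_kernel F\<rparr>) S"
    and fin: "finite S"
  shows "vectorspace.basis class_ring ((module_vec TYPE('a) b)\<lparr>carrier := mat_kernel F'\<rparr>) (\<phi> ` S)"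
proof -
  interpret k1: kernel a' a F by unfold_locales (rule F)
  interpret k2: kernel b' b F' by unfold_locales (rule F')
  have vs1: "vectorspace class_ring (module_vec TYPE('a) a\<lparr>carrier := mat_kernel F\<rparr>)" by (rule k1.Ker.vectorspace_axioms)
  have vs2: "vectorspace class_ring (module_vec TYPE('a) b\<lparr>carrier := mat_kernel F'\<rparr>)" by (rule k2.Ker.vectorspace_axioms)
  interpret l: linear_map class_ring "module_vec TYPE('a) a\<lparr>carrier := mat_kernel F\<rparr>" "module_vec TYPE('a) b\<lparr>carrier := mat_kernel F'\<rparr>" \<phi>
  proof (intro linear_map.intro vs1 vs2 mod_hom.intro vectorspace.axioms(1)[OF vs1] vectorspace.axioms(1)[OF vs2] mod_hom_axioms.intro)
    show "\<phi> \<in> LinearCombinations.module_hom class_ring (module_vec TYPE('a) a\<lparr>carrier := mat_kernel F\<rparr>) (module_vec TYPE('a) b\<lparr>carrier := mat_kernel F'\<rparr>)"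
      using add smult bij unfolding LinearCombinations.module_hom_def by (auto simp: module_vec_def bij_betw_def)
  qed
  show ?thesis
  proof (rule l.linear_inj_image_is_basis)
    show "vectorspace.fin_dim class_ring (module_vec TYPE('a) a\<lparr>carrier := mat_kernel F\<rparr>)"
      using basis fin unfolding vectorspace.fin_dim_def[OF vs1] vectorspace.basis_def[OF vs1] by blast
  qed (use bij basis in \<open>auto simp: bij_betw_def\<close>)
qed

lemma kernel_basis_card:
  fixes F :: "'a::field mat"
  assumes F: "F \<in> carrier_mat a' a"
    and "vectorspace.basis class_ring ((module_vec TYPE('a) a)\<lparr>carrier := mat_kernel F\<rparr>) S" "finite S"
    and "vectorspace.basis class_ring ((module_vec TYPE('a) a)\<lparr>carrier := mat_kernel F\<rparr>) S'" "finite S'"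
  shows "card S = card S'"
proof -
  interpret k1: kernel a' a F by unfold_locales (rule F)
  show ?thesis using k1.Ker.dim_basis[OF assms(3,2)] k1.Ker.dim_basis[OF assms(5,4)] by simp
qed

lemma kernel_basis_nonzero:
  fixes F :: "'a::field mat"
  assumes F: "F \<in> carrier_mat a' a"
    and "vectorspace.basis class_ring ((module_vec TYPE('a) a)\<lparr>carrier := mat_kernel F\<rparr>) S"
  shows "0\<^sub>v a \<notin> S" "S \<subseteq> mat_kernel F"
proof -
  interpret k1: kernel a' a F by unfold_locales (rule F)
  show "0\<^sub>v a \<notin> S" "S \<subseteq> mat_kernel F"
    using assms(2) k1.Ker.vs_zero_lin_dep[of S] unfolding k1.Ker.basis_def by auto
qed

lemma map_vec_to_fract_inj: "map_vec to_fract x = map_vec to_fract y \<longleftrightarrow> x = (y :: 'a::idom vec)"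
  by (auto simp: vec_eq_iff)

lemma vec_degree_le_iff:
  assumes "z \<in> carrier_vec N" "z \<noteq> 0\<^sub>v N" "d \<ge> 0"
  shows "int (vec_degree z) \<le> d \<longleftrightarrow> (\<forall>i<N. to_fract (z $ i) \<in> degree_le d)"
proof -
  have "N \<noteq> 0" using assms(1,2) by auto
  hence "set\<^sub>v z \<noteq> {}" "finite (set\<^sub>v z)"
    using assms(1) by (auto simp: vec_set_def lessThan_empty_iff)
  hence "int (vec_degree z) \<le> d \<longleftrightarrow> (\<forall>p\<in>set\<^sub>v z. int (degree p) \<le> d)"
    using assms(3) unfolding vec_degree_def by (cases d) auto
  also have "\<dots> \<longleftrightarrow> (\<forall>i<N. to_fract (z $ i) \<in> degree_le d)"
    using assms by (auto simp: vec_set_def to_fract_degree_le)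
  finally show ?thesis .
qed

text \<open>
  Apply the equivalence at the degree of \<open>x\<close> and at the degree of \<open>z\<close> minus \<open>k\<close>. The latter number is
  not negative, since otherwise \<open>x\<close> would vanish.
\<close>
lemma vec_degree_shift:
  assumes z: "z \<in> carrier_vec N" "z \<noteq> 0\<^sub>v N" and x: "x \<in> carrier_vec M" "x \<noteq> 0\<^sub>v M"
    and iff: "\<And>d. (\<forall>i<N. to_fract (z $ i) \<in> degree_le (d + int k)) \<longleftrightarrow> (\<forall>i<M. to_fract (x $ i) \<in> degree_le d)"
  shows "vec_degree z = vec_degree x + k"
proof (rule antisym)
  have "\<forall>i<M. to_fract (x $ i) \<in> degree_le (int (vec_degree x))"
    using vec_degree_le_iff[OF x, of "int (vec_degree x)"] by simp
  with iff have "\<forall>i<N. to_fract (z $ i) \<in> degree_le (int (vec_degree x) + int k)" by blast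
  with vec_degree_le_iff[OF z, of "int (vec_degree x) + int k"] show "vec_degree z \<le> vec_degree x + k" by simp
  \<comment> \<open>the bound \<open>vec_degree z - k\<close> might be negative at this point\<close>
  have "\<forall>i<N. to_fract (z $ i) \<in> degree_le ((int (vec_degree z) - int k) + int k)"
    using vec_degree_le_iff[OF z, of "int (vec_degree z)"] by simp
  hence x_le: "\<forall>i<M. to_fract (x $ i) \<in> degree_le (int (vec_degree z) - int k)"
    using iff by blast
  obtain i where "i < M" "x $ i \<noteq> 0" using x by (auto simp: vec_eq_iff)
  with x_le have "int (vec_degree z) - int k \<ge> 0" by (force simp: to_fract_degree_le)
  with x_le vec_degree_le_iff[OF x, of "int (vec_degree z) - int k"] show "vec_degree x + k \<le> vec_degree z" by simp
qed

text \<open>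
  All bases of a null space have the same number \<open>p\<close> of vectors. If an isomorphism lowers the degree of
  every polynomial vector by \<open>k\<close>, it lowers the degree sum of every polynomial basis by \<open>p k\<close>, and minimality
  is preserved. The assumption on the degrees also makes polynomial vectors correspond to polynomial
  vectors: a vector is polynomial if and only if its entries satisfy some degree bound.
\<close>
lemma minimal_basis_transfer:
  fixes F F' :: "complex poly fract mat" and k :: nat
    and \<Phi> :: "complex poly vec \<Rightarrow> complex poly vec" and \<phi> :: "complex poly fract vec \<Rightarrow> complex poly fract vec"
  assumes F: "F \<in> carrier_mat a' a" and F': "F' \<in> carrier_mat b' b"
    and bij: "bij_betw \<phi> (mat_kernel F) (mat_kernel F')"
    and add: "\<And>x y. x \<in> mat_kernel F \<Longrightarrow> y \<in> mat_kernel F \<Longrightarrow> \<phi> (x + y) = \<phi> x + \<phi> y"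
    and smult: "\<And>c x. x \<in> mat_kernel F \<Longrightarrow> \<phi> (c \<cdot>\<^sub>v x) = c \<cdot>\<^sub>v \<phi> x"
    and \<Phi>: "\<And>z. z \<in> carrier_vec a \<Longrightarrow> \<Phi> z \<in> carrier_vec b"
      "\<And>z. z \<in> carrier_vec a \<Longrightarrow> \<phi> (map_vec to_fract z) = map_vec to_fract (\<Phi> z)"
    and degree: "\<And>z d. z \<in> mat_kernel F \<Longrightarrow>
      (\<forall>i<a. z $ i \<in> degree_le (d + int k)) \<longleftrightarrow> (\<forall>i<b. \<phi> z $ i \<in> degree_le d)"
    and vs: "minimal_basis a (mat_kernel F) vs"
  shows "minimal_basis b (mat_kernel F') (map \<Phi> vs)"
    and "\<And>v. v \<in> set vs \<Longrightarrow> vec_degree v = vec_degree (\<Phi> v) + k"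
proof -
  let ?B = "\<lambda>S. vectorspace.basis class_ring ((module_vec TYPE(complex poly fract) a)\<lparr>carrier := mat_kernel F\<rparr>) S"
  let ?B' = "\<lambda>S. vectorspace.basis class_ring ((module_vec TYPE(complex poly fract) b)\<lparr>carrier := mat_kernel F'\<rparr>) S"
  have shift: "vec_degree v = vec_degree (\<Phi> v) + k"
    if "v \<in> carrier_vec a" "map_vec to_fract v \<in> mat_kernel F" "v \<noteq> 0\<^sub>v a" "\<Phi> v \<noteq> 0\<^sub>v b" for v
    using degree[OF that(2)] that \<Phi>(2)[OF that(1)] carrier_vecD[OF \<Phi>(1)[OF that(1)]] by (intro vec_degree_shift[OF that(1,3) \<Phi>(1)[OF that(1)] that(4)]) auto
  have zero: "map_vec to_fract (0\<^sub>v N) = (0\<^sub>v N :: complex poly fract vec)" for N by auto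
  have basis: "distinct (map \<Phi> ws) \<and> polynomial_basis b (mat_kernel F') (map \<Phi> ws) \<and>
      (\<forall>w\<in>set ws. vec_degree w = vec_degree (\<Phi> w) + k)"
    if ws: "polynomial_basis a (mat_kernel F) ws" for ws
  proof -
    have d: "distinct ws" "set ws \<subseteq> carrier_vec a" and B: "?B (map_vec to_fract ` set ws)"
      using ws unfolding polynomial_basis_def by auto
    have sub: "map_vec to_fract ` set ws \<subseteq> mat_kernel F" using kernel_basis_nonzero[OF F B] by auto
    have im: "map_vec to_fract ` set (map \<Phi> ws) = \<phi> ` map_vec to_fract ` set ws"
      using d(2) \<Phi>(2) by (force simp: image_iff)
    have B': "?B' (map_vec to_fract ` set (map \<Phi> ws))"
      unfolding im by (rule kernel_basis_image[OF F F' bij add smult B]) auto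
    have "inj_on \<Phi> (set ws)"
    proof (rule inj_onI)
      fix x y assume xy: "x \<in> set ws" "y \<in> set ws" "\<Phi> x = \<Phi> y"
      have "x \<in> carrier_vec a" "y \<in> carrier_vec a" using xy d(2) by auto
      with xy have "\<phi> (map_vec to_fract x) = \<phi> (map_vec to_fract y)" by (simp add: \<Phi>(2))
      moreover have "map_vec to_fract x \<in> mat_kernel F" "map_vec to_fract y \<in> mat_kernel F"
        using sub xy by blast+
      ultimately have "map_vec to_fract x = map_vec to_fract y"
        using bij_betw_imp_inj_on[OF bij] by (simp add: inj_on_eq_iff)
      thus "x = y" by (simp add: map_vec_to_fract_inj)
    qed
    hence "distinct (map \<Phi> ws)" using d(1) by (simp add: distinct_map)
    moreover have "set (map \<Phi> ws) \<subseteq> carrier_vec b" using d(2) \<Phi>(1) by auto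
    moreover have "vec_degree w = vec_degree (\<Phi> w) + k" if "w \<in> set ws" for w
    proof (rule shift)
      show "w \<noteq> 0\<^sub>v a" using kernel_basis_nonzero(1)[OF F B] that zero by (metis image_eqI)
      show "\<Phi> w \<noteq> 0\<^sub>v b" using kernel_basis_nonzero(1)[OF F' B'] that zero by (metis image_eqI list.set_map)
    qed (use that d sub in auto)
    ultimately show ?thesis using B' unfolding polynomial_basis_def by auto
  qed
  have vs': "polynomial_basis a (mat_kernel F) vs" using vs unfolding minimal_basis_def by simp
  show deg: "vec_degree v = vec_degree (\<Phi> v) + k" if "v \<in> set vs" for v using basis[OF vs'] that by blast
  have sum_shift: "sum_list (map vec_degree ws) = sum_list (map vec_degree (map \<Phi> ws)) + length ws * k"
    if "\<forall>w\<in>set ws. vec_degree w = vec_degree (\<Phi> w) + k" for ws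
    using that by (induction ws) auto
  show "minimal_basis b (mat_kernel F') (map \<Phi> vs)"
    unfolding minimal_basis_def
  proof (intro conjI allI impI)
    show "polynomial_basis b (mat_kernel F') (map \<Phi> vs)" using basis[OF vs'] by simp
    fix ws assume ws: "polynomial_basis b (mat_kernel F') ws"
    have d: "distinct ws" "set ws \<subseteq> carrier_vec b" and B: "?B' (map_vec to_fract ` set ws)"
      using ws unfolding polynomial_basis_def by auto
    have sub: "map_vec to_fract ` set ws \<subseteq> mat_kernel F'" using kernel_basis_nonzero[OF F' B] by auto
    have "\<exists>z. z \<in> carrier_vec a \<and> map_vec to_fract z \<in> mat_kernel F \<and> \<Phi> z = w" if "w \<in> set ws" for w
    proof -
      have "map_vec to_fract w \<in> \<phi> ` mat_kernel F"
        using sub that bij_betw_imp_surj_on[OF bij] by blast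
      then obtain y where y: "y \<in> mat_kernel F" "\<phi> y = map_vec to_fract w" by (metis imageE)
      have w: "w \<in> carrier_vec b" using d that by auto
      have ya: "y \<in> carrier_vec a" using mat_kernelD(1)[OF F y(1)] .
      \<comment> \<open>any common bound for the degrees of the entries; 0 is inserted for the case that there are none\<close>
      define d where "d = int (Max (insert 0 (degree ` set\<^sub>v w)))"
      have "\<phi> y $ i \<in> degree_le d" if "i < b" for i
        using that w unfolding y(2) d_def
        by (auto simp: to_fract_degree_le vec_set_def intro!: disjI2 Max_ge)
      with degree[OF y(1), of d] have yd: "\<forall>i<a. y $ i \<in> degree_le (d + int k)" by blast
      have "\<exists>p. y $ i = to_fract p" if "i < a" for i
        using yd that unfolding degree_le_def by blast
      then obtain p where p: "\<And>i. i < a \<Longrightarrow> y $ i = to_fract (p i)" by metis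
      have "y = map_vec to_fract (vec a p)" using ya p by auto
      moreover from this y \<Phi>(2)[of "vec a p"] have "\<Phi> (vec a p) = w"
        by (simp add: map_vec_to_fract_inj)
      ultimately show ?thesis using y(1) by (intro exI[of _ "vec a p"]) auto
    qed
    then obtain g where g: "\<And>w. w \<in> set ws \<Longrightarrow> g w \<in> carrier_vec a \<and> map_vec to_fract (g w) \<in> mat_kernel F \<and> \<Phi> (g w) = w"
      by metis
    have map: "map \<Phi> (map g ws) = ws" using g by (simp add: map_idI)
    have bij': "bij_betw (the_inv_into (mat_kernel F) \<phi>) (mat_kernel F') (mat_kernel F)"
      by (rule bij_betw_the_inv_into[OF bij])
    have inv: "the_inv_into (mat_kernel F) \<phi> (\<phi> x) = x" if "x \<in> mat_kernel F" for x
      using bij that by (simp add: bij_betw_def the_inv_into_f_f)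
    have inv': "\<exists>x\<in>mat_kernel F. y = \<phi> x" if "y \<in> mat_kernel F'" for y
      using bij that by (auto simp: bij_betw_def)
    have kadd: "x + y \<in> mat_kernel F" if "x \<in> mat_kernel F" "y \<in> mat_kernel F" for x y
      using that F mult_add_distrib_mat_vec[OF F, of x y] by (auto simp: mat_kernel[OF F])
    have "?B (the_inv_into (mat_kernel F) \<phi> ` map_vec to_fract ` set ws)"
    proof (rule kernel_basis_image[OF F' F bij' _ _ B])
      fix x y assume "x \<in> mat_kernel F'" "y \<in> mat_kernel F'"
      then obtain x' y' where "x' \<in> mat_kernel F" "x = \<phi> x'" "y' \<in> mat_kernel F" "y = \<phi> y'" using inv' by blast
      then show "the_inv_into (mat_kernel F) \<phi> (x + y) = the_inv_into (mat_kernel F) \<phi> x + the_inv_into (mat_kernel F) \<phi> y"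
        using inv kadd by (simp flip: add)
    next
      fix c x assume "x \<in> mat_kernel F'"
      then obtain x' where "x' \<in> mat_kernel F" "x = \<phi> x'" using inv' by blast
      then show "the_inv_into (mat_kernel F) \<phi> (c \<cdot>\<^sub>v x) = c \<cdot>\<^sub>v the_inv_into (mat_kernel F) \<phi> x"
        using inv mat_kernel_smult[OF F] by (simp flip: smult)
    qed simp
    moreover have "the_inv_into (mat_kernel F) \<phi> ` map_vec to_fract ` set ws = map_vec to_fract ` set (map g ws)"
    proof -
      have "the_inv_into (mat_kernel F) \<phi> (map_vec to_fract w) = map_vec to_fract (g w)" if "w \<in> set ws" for w
        using inv[of "map_vec to_fract (g w)"] g[OF that] \<Phi>(2)[of "g w"] by simp
      then show ?thesis by (simp add: image_image)
    qed
    ultimately have gB: "?B (map_vec to_fract ` set (map g ws))" by simp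
    have "inj_on g (set ws)" using g by (metis inj_onI)
    hence gws: "polynomial_basis a (mat_kernel F) (map g ws)"
      using gB d(1) g unfolding polynomial_basis_def by (auto simp: distinct_map)
    have card: "card (map_vec to_fract ` set us) = length us"
      if "distinct us" for us :: "complex poly vec list"
      using that by (subst card_image) (auto simp: inj_on_def map_vec_to_fract_inj distinct_card)
    have len: "length (map g ws) = length vs"
      using kernel_basis_card[OF F, of "map_vec to_fract ` set (map g ws)" "map_vec to_fract ` set vs"] gws vs' card[of "map g ws"] card[of vs]
      unfolding polynomial_basis_def by simp
    have "sum_list (map vec_degree vs) \<le> sum_list (map vec_degree (map g ws))"
      using vs gws unfolding minimal_basis_def by blast
    moreover have "sum_list (map vec_degree vs) = sum_list (map vec_degree (map \<Phi> vs)) + length vs * k"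
      using basis[OF vs'] by (intro sum_shift) blast
    moreover have "sum_list (map vec_degree (map g ws)) = sum_list (map vec_degree (map \<Phi> (map g ws))) + length (map g ws) * k"
      using basis[OF gws] by (intro sum_shift) blast
    ultimately show "sum_list (map vec_degree (map \<Phi> vs)) \<le> sum_list (map vec_degree ws)"
      unfolding len map by linarith
  qed
qed

section \<open>Inverses of the factors, and the null space of the system matrix\<close>

interpretation to_fract: comm_ring_hom "to_fract :: complex poly \<Rightarrow> complex poly fract"
  by unfold_locales auto

definition inverse_pair :: "nat \<Rightarrow> complex mat \<Rightarrow> complex mat \<Rightarrow> bool" where
  "inverse_pair N M J \<longleftrightarrow> M \<in> carrier_mat N N \<and> J \<in> carrier_mat N N \<and> M * J = 1\<^sub>m N \<and> J * M = 1\<^sub>m N"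

lemma inverse_pairI:
  assumes "M \<in> carrier_mat N N" "J \<in> carrier_mat N N" "M * J = 1\<^sub>m N"
  shows "inverse_pair N M J"
  using mat_mult_left_right_inverse[OF assms] assms unfolding inverse_pair_def by simp

lemma inverse_pair_sym: "inverse_pair N M J \<Longrightarrow> inverse_pair N J M"
  by (auto simp: inverse_pair_def)

lemma inverse_pair_mult:
  assumes "inverse_pair N M J" "inverse_pair N M' J'"
  shows "inverse_pair N (M * M') (J' * J)"
proof (rule inverse_pairI)
  have c: "M \<in> carrier_mat N N" "J \<in> carrier_mat N N" "M' \<in> carrier_mat N N" "J' \<in> carrier_mat N N"
    using assms by (auto simp: inverse_pair_def)
  then show "M * M' \<in> carrier_mat N N" "J' * J \<in> carrier_mat N N" by auto
  have "(M * M') * (J' * J) = M * ((M' * J') * J)"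
    using c by (simp add: assoc_mult_mat[of _ N N _ N _ N])
  also have "\<dots> = 1\<^sub>m N" using assms c by (simp add: inverse_pair_def)
  finally show "(M * M') * (J' * J) = 1\<^sub>m N" .
qed

lemma inverse_pair_prod:
  assumes "\<And>M. M \<in> set Ms \<Longrightarrow> \<exists>J. inverse_pair N M J"
  shows "\<exists>J. inverse_pair N (mat_prod N Ms) J"
  using assms
proof (induction Ms)
  case Nil
  have "inverse_pair N (1\<^sub>m N) (1\<^sub>m N)" by (auto simp: inverse_pair_def)
  then show ?case by (auto simp: mat_prod_def)
next
  case (Cons M Ms)
  then obtain J J' where "inverse_pair N M J" "inverse_pair N (mat_prod N Ms) J'" by fastforce
  from inverse_pair_mult[OF this] show ?case by (auto simp: mat_prod_def)
qed

lemma inverse_pair_by_blocks: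
  assumes "M \<in> carrier_mat (m * n + r) (m * n + r)" "J \<in> carrier_mat (m * n + r) (m * n + r)"
    and "\<And>f j k. j < m \<Longrightarrow> k < n \<Longrightarrow> blk m n (act M (act J f)) j k = blk m n f j k"
    and "\<And>f k. k < r \<Longrightarrow> tail m n (act M (act J f)) k = tail m n f k"
  shows "inverse_pair (m * n + r) M J"
proof (rule inverse_pairI[OF assms(1,2)], rule mat_eq_by_act)
  fix f p assume p: "p < m * n + r"
  have "act M (act J f) p = f p"
    using p by (cases rule: pos_cases) (use assms(3)[of _ _ f] assms(4)[of _ f] in \<open>auto simp: blk_def tail_def\<close>)
  with act_mult[OF assms(1,2) p] p show "act (M * J) f p = act (1\<^sub>m (m * n + r)) f p" by simp
qed (use assms in auto)

lemma invertible_matE: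
  assumes "invertible_mat X" "X \<in> carrier_mat n n"
  obtains X' where "inverse_pair n X X'"
proof -
  obtain X' where X': "X * X' = 1\<^sub>m n" "X' * X = 1\<^sub>m (dim_row X')"
    using assms unfolding invertible_mat_def inverts_mat_def by auto
  have "X' \<in> carrier_mat n n"
    using arg_cong[OF X'(1), of dim_col] arg_cong[OF X'(2), of dim_col] assms(2) by (intro carrier_matI) auto
  from inverse_pairI[OF assms(2) this X'(1)] show ?thesis by (rule that)
qed

text \<open>
  For \<open>0 < \<bar>i\<bar> < m\<close>, the inverse belongs to the index \<open>-i\<close> and the matrix \<open>-X\<close>. Only for the
  indices 0 and \<open>-m\<close> does \<open>X\<close> stand alone on the diagonal, and has to be invertible.
\<close>
lemma ext_elem_inverse:
  assumes m: "m \<ge> 1" and i: "i \<in> {- int m..int m - 1}" and X: "X \<in> carrier_mat n n"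
    and nonsing: "i \<in> {0, - int m} \<Longrightarrow> invertible_mat X"
  shows "\<exists>J. inverse_pair (m * n + r) (ext_elem_mat m n r i X) J"
proof -
  consider "i \<in> {0, - int m}" | j where "i = int j" "0 < j" "j < m" | j where "i = - int j" "0 < j" "j < m"
    using i by (cases rule: index_cases) auto
  then show ?thesis
  proof cases
    case 1
    obtain X' where X': "inverse_pair n X X'" using nonsing[OF 1] X by (rule invertible_matE)
    hence c: "X' \<in> carrier_mat n n" by (simp add: inverse_pair_def)
    have XX': "act X (\<lambda>k. act X' g k) k = g k" if "k < n" for g k
      using act_mult[OF X c that, of g] X' that by (simp add: inverse_pair_def)
    have "inverse_pair (m * n + r) (ext_elem_mat m n r i X) (ext_elem_mat m n r i X')"
    proof (rule inverse_pair_by_blocks)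
      fix f j k assume jk: "j < m" "k < n"
      let ?g = "act (ext_elem_mat m n r i X') f"
      have z: "act X (blk m n ?g l) k = blk m n f l k" if "l < m" "\<And>k. k < n \<Longrightarrow> blk m n ?g l k = act X' (blk m n f l) k" for l
      proof -
        have "act X (blk m n ?g l) k = act X (\<lambda>k. act X' (blk m n f l) k) k"
          using that X by (intro act_cong) auto
        with XX' jk show ?thesis by simp
      qed
      show "blk m n (act (ext_elem_mat m n r i X) ?g) j k = blk m n f j k"
      proof (cases "i = 0")
        case True
        with m jk X c z[of 0] show ?thesis by (auto simp: act_ext_elem_zero)
      next
        case False
        with 1 have "i = - int m" by simp
        with m jk X c z[of "m - 1"] show ?thesis by (auto simp: act_ext_elem_top simp del: One_nat_def)
      qed
    qed (use X c m i in \<open>auto simp: act_ext_elem_tail intro!: ext_elem_mat_carrier\<close>)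
    then show ?thesis by blast
  next
    case 2
    have "inverse_pair (m * n + r) (ext_elem_mat m n r i X) (ext_elem_mat m n r (- i) (- X))"
    proof (rule inverse_pair_by_blocks)
      fix f l k assume lk: "l < m" "k < n"
      let ?g = "act (ext_elem_mat m n r (- i) (- X)) f"
      have mX: "- X \<in> carrier_mat n n" using X by simp
      note neg = act_ext_elem_neg[OF 2(2,3) mX]
      have "act X (blk m n ?g j) k = act X (blk m n f (j - 1)) k"
        using X neg[of j _ r f] 2 by (intro act_cong) auto
      then show "blk m n (act (ext_elem_mat m n r i X) ?g) l k = blk m n f l k"
        using act_ext_elem_pos[OF 2(2,3) X lk, of r ?g] neg[of "j - 1" k r f] neg[of j k r f] neg[OF lk, of r f] lk 2(2,3) X
        by (auto simp: 2(1))
    qed (use X m i 2 in \<open>auto simp: act_ext_elem_tail intro!: ext_elem_mat_carrier\<close>)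
    then show ?thesis by blast
  next
    case 3
    have "inverse_pair (m * n + r) (ext_elem_mat m n r i X) (ext_elem_mat m n r (- i) (- X))"
    proof (rule inverse_pair_by_blocks)
      fix f l k assume lk: "l < m" "k < n"
      let ?g = "act (ext_elem_mat m n r (- i) (- X)) f"
      have mX: "- X \<in> carrier_mat n n" using X by simp
      note pos = act_ext_elem_pos[OF 3(2,3) mX]
      have "act X (blk m n ?g (j - 1)) k = act X (blk m n f j) k"
        using X pos[of "j - 1" _ r f] 3 by (intro act_cong) auto
      then show "blk m n (act (ext_elem_mat m n r i X) ?g) l k = blk m n f l k"
        using act_ext_elem_neg[OF 3(2,3) X lk, of r ?g] pos[of j k r f] pos[of "j - 1" k r f] pos[OF lk, of r f] lk 3(2,3) X
        by (auto simp: 3(1))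
    qed (use X m i 3 in \<open>auto simp: act_ext_elem_tail intro!: ext_elem_mat_carrier\<close>)
    then show ?thesis by blast
  qed
qed

lemma elem_factor_inverse:
  assumes "m \<ge> 1" "nonsingular_assignment m n t X" "set t \<subseteq> {- int m..int m - 1}"
    and "M \<in> set (map2 (ext_elem_mat m n r) t X)"
  shows "\<exists>J. inverse_pair (m * n + r) M J"
proof -
  obtain j where j: "j < length t" "j < length X" "M = ext_elem_mat m n r (t ! j) (X ! j)"
    using assms(4) by (auto simp: set_zip)
  have "t ! j \<in> {- int m..int m - 1}" "X ! j \<in> set X" using j assms(3) by (auto dest!: nth_mem)
  with assms(2,3) j show ?thesis unfolding nonsingular_assignment_def matrix_assignment_def j(3)
    by (intro ext_elem_inverse[OF assms(1)]) auto
qed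

lemma nonsingular_assignment_append:
  "nonsingular_assignment m n s X \<Longrightarrow> nonsingular_assignment m n t Y \<Longrightarrow> nonsingular_assignment m n (s @ t) (X @ Y)"
  unfolding nonsingular_assignment_def matrix_assignment_def by (auto simp: nth_append)

lemma elem_prod_inverse:
  assumes "m \<ge> 1" "nonsingular_assignment m n t X" "set t \<subseteq> {- int m..int m - 1}"
  shows "\<exists>J. inverse_pair (m * n + r) (elem_prod m n r t X) J"
  unfolding elem_prod_def by (rule inverse_pair_prod) (rule elem_factor_inverse[OF assms])

lemma act_elem_prod:
  assumes "m \<ge> 1" "nonsingular_assignment m n t X" "set t \<subseteq> {- int m..int m - 1}" "p < m * n + r"
  shows "act (elem_prod m n r t X) f p = acts (map2 (ext_elem_mat m n r) t X) f p"
proof -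
  have "M \<in> carrier_mat (m * n + r) (m * n + r)" if "M \<in> set (map2 (ext_elem_mat m n r) t X)" for M
    using elem_factor_inverse[OF assms(1-3) that] by (auto simp: inverse_pair_def)
  then show ?thesis unfolding elem_prod_def using assms(4) by (intro act_mat_prod) auto
qed

lemma mat_inv_inverse_pair:
  assumes "inverse_pair N M J"
  shows "mat_inv M = J"
proof -
  have M: "M \<in> carrier_mat N N" and J: "J \<in> carrier_mat N N" and MJ: "M * J = 1\<^sub>m N" "J * M = 1\<^sub>m N"
    using assms by (auto simp: inverse_pair_def)
  have "M \<in> Units (ring_mat TYPE(complex) N ())" using M J MJ by (auto simp: Units_def ring_mat_def)
  then obtain J' where J': "mat_inverse M = Some J'" using mat_inverse(1)[OF M, where b = "()"] by blast
  from mat_inverse(2)[OF M this] have "J' \<in> carrier_mat N N" "M * J' = 1\<^sub>m N" by auto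
  hence "J' = (J * M) * J'" using MJ by simp
  also have "\<dots> = J * (M * J')" using J M \<open>J' \<in> _\<close> by (rule assoc_mult_mat)
  also have "\<dots> = J" using J \<open>M * J' = _\<close> by simp
  finally show ?thesis using J' by simp
qed

context system_data
begin

lemma fiedler_inverse_pair:
  assumes "0 < i" "i < m"
  shows "inverse_pair (m * n + r) (FM (int i)) (FM (- int i))"
proof -
  obtain J where J: "inverse_pair (m * n + r) (FM (int i)) J"
    using ext_elem_inverse[of m "int i" "- As i" n r] assms As[of i] m by (auto simp: fiedler_sys_pos)
  moreover have "FM (- int i) = mat_inv (FM (int i))"
    using assms by (simp add: fiedler_sys_def del: diag_block_mat.simps)
  ultimately show ?thesis by (simp add: mat_inv_inverse_pair)
qed

lemma FM_carrier:
  assumes "i \<in> {- int m..int m - 1}"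
  shows "FM i \<in> carrier_mat (m * n + r) (m * n + r)"
  using assms fiedler_sys_zero_carrier fiedler_sys_top_carrier fiedler_inverse_pair
  by (cases rule: index_cases) (auto simp: inverse_pair_def)

abbreviation FP :: "int list \<Rightarrow> complex mat" where
  "FP \<equiv> fiedler_prod m n r As A B C E"

lemma FP_carrier: "set t \<subseteq> {- int m..int m - 1} \<Longrightarrow> FP t \<in> carrier_mat (m * n + r) (m * n + r)"
  unfolding fiedler_prod_def using FM_carrier by (intro mat_prod_carrier) auto

lemma act_FP:
  assumes "set t \<subseteq> {- int m..int m - 1}" "p < m * n + r"
  shows "act (FP t) f p = acts (map FM t) f p"
proof -
  have "FM i \<in> carrier_mat (m * n + r) (m * n + r)" if "i \<in> set t" for i
    using FM_carrier[OF subsetD[OF assms(1) that]] .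
  then have "set (map FM t) \<subseteq> carrier_mat (m * n + r) (m * n + r)" unfolding set_map by blast
  then show ?thesis unfolding fiedler_prod_def using assms(2) by (rule act_mat_prod)
qed

lemma FP_append:
  assumes "set s \<subseteq> {- int m..int m - 1}" "set t \<subseteq> {- int m..int m - 1}"
  shows "FP (s @ t) = FP s * FP t"
  unfolding fiedler_prod_def map_append using assms FM_carrier by (intro mat_prod_append) auto

text \<open>
  Fiedler matrices with opposite indices are inverse to each other, unless the index is 0 or \<open>m\<close> in
  absolute value.
\<close>
lemma FP_inverse_pair:
  assumes "set t \<subseteq> {- int m + 1..-1}"
  shows "inverse_pair (m * n + r) (FP t) (FP (map uminus (rev t)))"
  using assms
proof (induction t)
  case Nil
  then show ?case by (auto simp: fiedler_prod_def mat_prod_def inverse_pair_def)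
next
  case (Cons x t)
  have x: "0 < nat (- x)" "nat (- x) < m" "x = - int (nat (- x))" using Cons.prems by auto
  have "inverse_pair (m * n + r) (FM x) (FM (- x))"
    using inverse_pair_sym[OF fiedler_inverse_pair[OF x(1,2)]] x(3) by simp
  from inverse_pair_mult[OF this Cons.IH] Cons.prems
  have "inverse_pair (m * n + r) (FM x * FP t) (FP (map uminus (rev t)) * FM (- x))" by simp
  moreover have "FM x * FP t = FP (x # t)" by (simp add: fiedler_prod_def mat_prod_def)
  moreover have "FP (map uminus (rev t)) * FM (- x) = FP (map uminus (rev (x # t)))"
  proof -
    have "FM (- x) = FP [- x]" using FM_carrier[of "- x"] Cons.prems by (auto simp: fiedler_prod_def mat_prod_def)
    moreover have "FP (map uminus (rev t)) * FP [- x] = FP (map uminus (rev t) @ [- x])"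
      using Cons.prems by (intro FP_append[symmetric]) auto
    ultimately show ?thesis by simp
  qed
  ultimately show ?case by simp
qed

lemma rat_poly_mat_entry:
  assumes "i < n" "j < n"
  shows "rat_mat (poly_mat n m As) $$ (i, j) = (\<Sum>k\<le>m. lam ^ k * ratc (As k $$ (i, j)))"
proof -
  have "to_fract (monom c k) = lam ^ k * ratc c" for c k
  proof -
    have "to_fract (monom c k) = to_fract ([:0, 1:] ^ k * [:c:])" by (simp add: monom_altdef)
    also have "\<dots> = lam ^ k * ratc c"
      by (simp only: to_fract_mult to_fract.hom_power lam_def ratc_def)
    finally show ?thesis .
  qed
  with assms show ?thesis by (simp add: rat_mat_def poly_mat_def)
qed

lemma system_matrix_kernel:
  assumes x: "x \<in> carrier_vec (n + r)"
  shows "x \<in> mat_kernel (rat_mat (system_matrix (poly_mat n m As) A B C E)) \<longleftrightarrow>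
    system_kernel (($) x) (\<lambda>k. x $ (n + k))"
proof -
  let ?S = "rat_mat (system_matrix (poly_mat n m As) A B C E)"
  have S: "?S \<in> carrier_mat (n + r) (n + r)"
    using ABCE by (auto simp: rat_mat_def system_matrix_def const_mat_def poly_mat_def)
  have entry: "(?S *\<^sub>v x) $ p = (\<Sum>q<n. ?S $$ (p, q) * x $ q) + (\<Sum>q<r. ?S $$ (p, n + q) * x $ (n + q))"
    if "p < n + r" for p
  proof -
    have "(?S *\<^sub>v x) $ p = (\<Sum>q<n + r. ?S $$ (p, q) * x $ q)"
      using that S x by (simp add: scalar_prod_def atLeast0LessThan)
    then show ?thesis by (simp only: sum_lessThan_add)
  qed
  have up: "(?S *\<^sub>v x) $ k = (\<Sum>i\<le>m. lam ^ i * act (As i) (($) x) k) + act C (\<lambda>k. x $ (n + k)) k" if k: "k < n" for k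
  proof -
    have "?S $$ (k, q) = (\<Sum>i\<le>m. lam ^ i * ratc (As i $$ (k, q)))" if "q < n" for q
    proof -
      have "?S $$ (k, q) = rat_mat (poly_mat n m As) $$ (k, q)"
        using k that ABCE by (simp add: rat_mat_def system_matrix_def poly_mat_def const_mat_def)
      with rat_poly_mat_entry[OF k that] show ?thesis by simp
    qed
    hence "(\<Sum>q<n. ?S $$ (k, q) * x $ q) = (\<Sum>q<n. \<Sum>i\<le>m. lam ^ i * (ratc (As i $$ (k, q)) * x $ q))"
      by (intro sum.cong) (simp_all add: sum_distrib_right mult.assoc)
    also have "\<dots> = (\<Sum>i\<le>m. \<Sum>q<n. lam ^ i * (ratc (As i $$ (k, q)) * x $ q))" by (rule sum.swap)
    also have "\<dots> = (\<Sum>i\<le>m. lam ^ i * act (As i) (($) x) k)"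
    proof (intro sum.cong refl)
      fix i assume "i \<in> {..m}"
      then have "dim_col (As i) = n" using As[of i] by auto
      then show "(\<Sum>q<n. lam ^ i * (ratc (As i $$ (k, q)) * x $ q)) = lam ^ i * act (As i) (($) x) k"
        by (simp add: act_def sum_distrib_left)
    qed
    finally have "(\<Sum>q<n. ?S $$ (k, q) * x $ q) = (\<Sum>i\<le>m. lam ^ i * act (As i) (($) x) k)" .
    moreover have "(\<Sum>q<r. ?S $$ (k, n + q) * x $ (n + q)) = act C (\<lambda>k. x $ (n + k)) k"
      unfolding act_def using k ABCE
      by (intro sum.cong) (auto simp: rat_mat_def system_matrix_def poly_mat_def const_mat_def ratc_def)
    ultimately show ?thesis using entry[of k] k by simp
  qed
  have low: "(?S *\<^sub>v x) $ (n + k) = act B (($) x) k + act A (\<lambda>k. x $ (n + k)) k - lam * act E (\<lambda>k. x $ (n + k)) k"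
    if k: "k < r" for k
  proof -
    have "(\<Sum>q<n. ?S $$ (n + k, q) * x $ q) = act B (($) x) k"
      unfolding act_def using k ABCE
      by (intro sum.cong) (auto simp: rat_mat_def system_matrix_def poly_mat_def const_mat_def ratc_def)
    moreover have "(\<Sum>q<r. ?S $$ (n + k, n + q) * x $ (n + q)) =
      (\<Sum>q<r. ratc (A $$ (k, q)) * x $ (n + q) - lam * (ratc (E $$ (k, q)) * x $ (n + q)))"
    proof (intro sum.cong refl)
      fix q assume "q \<in> {..<r}"
      hence q: "q < r" by simp
      have "?S $$ (n + k, n + q) = to_fract ([:A $$ (k, q):] - [:0, 1:] * [:E $$ (k, q):])"
        using k q ABCE by (simp add: rat_mat_def system_matrix_def poly_mat_def const_mat_def)
      also have "\<dots> = ratc (A $$ (k, q)) - lam * ratc (E $$ (k, q))"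
        by (simp only: to_fract_diff to_fract_mult lam_def ratc_def)
      finally show "?S $$ (n + k, n + q) * x $ (n + q) =
          ratc (A $$ (k, q)) * x $ (n + q) - lam * (ratc (E $$ (k, q)) * x $ (n + q))"
        by (simp add: left_diff_distrib)
    qed
    ultimately show ?thesis using entry[of "n + k"] k ABCE
      by (simp add: act_def sum_subtractf sum_distrib_left)
  qed
  have "x \<in> mat_kernel ?S \<longleftrightarrow> (\<forall>p<n + r. (?S *\<^sub>v x) $ p = 0)"
  proof -
    have "dim_vec (?S *\<^sub>v x) = n + r" using S by simp
    then have "?S *\<^sub>v x = 0\<^sub>v (n + r) \<longleftrightarrow> (\<forall>p<n + r. (?S *\<^sub>v x) $ p = 0)"
      unfolding vec_eq_iff by simp
    with x show ?thesis unfolding mat_kernel[OF S] by simp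
  qed
  also have "\<dots> \<longleftrightarrow> (\<forall>k<n. (?S *\<^sub>v x) $ k = 0) \<and> (\<forall>k<r. (?S *\<^sub>v x) $ (n + k) = 0)"
  proof (intro iffI conjI allI impI)
    fix p assume *: "(\<forall>k<n. (?S *\<^sub>v x) $ k = 0) \<and> (\<forall>k<r. (?S *\<^sub>v x) $ (n + k) = 0)" and p: "p < n + r"
    show "(?S *\<^sub>v x) $ p = 0"
    proof (cases "p < n")
      case False
      then obtain q where "p = n + q" by (metis le_iff_add not_le)
      with * p show ?thesis by simp
    qed (use * in simp)
  qed simp_all
  also have "\<dots> \<longleftrightarrow> system_kernel (($) x) (\<lambda>k. x $ (n + k))"
  proof -
    have "(?S *\<^sub>v x) $ (n + k) = 0 \<longleftrightarrow>
        lam * act E (\<lambda>k. x $ (n + k)) k = act B (($) x) k + act A (\<lambda>k. x $ (n + k)) k" if "k < r" for k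
      by (simp only: low[OF that] right_minus_eq eq_commute[of "act B (($) x) k + _"])
    then show ?thesis unfolding system_kernel_def
      by (intro arg_cong2[where f = "(\<and>)"] all_cong1 imp_cong refl) (simp_all only: up)
  qed
  finally show ?thesis .
qed

lemma system_kernel_cong:
  assumes "\<And>k. k < n \<Longrightarrow> u k = u' k" "\<And>k. k < r \<Longrightarrow> v k = v' k"
  shows "system_kernel u v \<longleftrightarrow> system_kernel u' v'"
proof -
  have "act (As i) u k = act (As i) u' k" if "i \<le> m" for i k
    using assms As[OF that] by (intro act_cong) auto
  moreover have "act A v k = act A v' k" "act B u k = act B u' k" "act C v k = act C v' k" "act E v k = act E v' k" for k
    using assms ABCE by (auto intro!: act_cong)
  ultimately show ?thesis unfolding system_kernel_def by simp
qed

end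

section \<open>Recovery of right minimal bases\<close>

text \<open>
  Block \<open>c\<close> on top of the tail: the vector that is expected to solve the system.
\<close>
definition recover :: "nat \<Rightarrow> nat \<Rightarrow> nat \<Rightarrow> nat \<Rightarrow> 'a vec \<Rightarrow> 'a vec" where
  "recover m n r c z = vec (n + r) (\<lambda>p. if p < n then blk m n (($) z) c p else tail m n (($) z) (p - n))"

lemma recover_carrier [simp]: "recover m n r c z \<in> carrier_vec (n + r)"
  by (simp add: recover_def)

lemma recover_index:
  "k < n \<Longrightarrow> recover m n r c z $ k = blk m n (($) z) c k"
  "k < r \<Longrightarrow> recover m n r c z $ (n + k) = tail m n (($) z) k"
  by (auto simp: recover_def)

lemma recover_add:
  assumes "c < m" "x \<in> carrier_vec (m * n + r)" "y \<in> carrier_vec (m * n + r)"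
  shows "recover m n r c (x + y) = recover m n r c x + recover m n r c y"
  using assms blk_pos_less[of c m _ n] by (intro eq_vecI) (auto simp: recover_def blk_def tail_def trans_less_add1)

lemma recover_smult:
  assumes "c < m" "x \<in> carrier_vec (m * n + r)"
  shows "recover m n r c (a \<cdot>\<^sub>v x) = a \<cdot>\<^sub>v recover m n r c x"
  using assms blk_pos_less[of c m _ n] by (intro eq_vecI) (auto simp: recover_def blk_def tail_def trans_less_add1)

lemma recover_map_vec:
  assumes "c < m" "x \<in> carrier_vec (m * n + r)"
  shows "recover m n r c (map_vec f x) = map_vec f (recover m n r c x)"
  using assms blk_pos_less[of c m _ n] by (intro eq_vecI) (auto simp: recover_def blk_def tail_def trans_less_add1)

lemma tail_acts_ext:
  assumes "length Xs = length t" "set Xs \<subseteq> carrier_mat n n" "set t \<subseteq> {- int m..int m - 1}" "m \<ge> 1" "k < r"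
  shows "tail m n (acts (map2 (ext_elem_mat m n r) t Xs) f) k = tail m n f k"
  using assms(1-3)
proof (induction t arbitrary: Xs)
  case (Cons x t)
  then obtain X Ys where "Xs = X # Ys" by (cases Xs) auto
  with Cons assms(4,5) show ?case by (simp add: act_ext_elem_tail)
qed simp

text \<open>
  The index \<open>-i\<close> acts on the blocks \<open>i\<close> and \<open>i - 1\<close>, or only on \<open>i - 1\<close> if \<open>i = m\<close>; all of these lie above
  block \<open>c\<close> here.
\<close>
lemma blk_acts_high:
  assumes "length Xs = length t" "set Xs \<subseteq> carrier_mat n n" "set t \<subseteq> {- int m..- int c - 2}" "c < m" "k < n"
  shows "blk m n (acts (map2 (ext_elem_mat m n r) t Xs) f) c k = blk m n f c k"
  using assms(1-3)
proof (induction t arbitrary: Xs)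
  case (Cons x t)
  obtain X Ys where Xs: "Xs = X # Ys" using Cons.prems(1) by (cases Xs) auto
  have X: "X \<in> carrier_mat n n" using Cons.prems Xs by auto
  define g where "g = acts (map2 (ext_elem_mat m n r) t Ys) f"
  have x: "- int m \<le> x" "x \<le> - int c - 2" using Cons.prems by auto
  have "blk m n (act (ext_elem_mat m n r x X) g) c k = blk m n g c k"
  proof (cases "x = - int m")
    case True
    with x have "c \<noteq> m - 1" by linarith
    with True act_ext_elem_top[OF _ X assms(4,5), of r g] assms(4) show ?thesis by simp
  next
    case False
    define i where "i = nat (- x)"
    have i: "0 < i" "i < m" "x = - int i" "c < i - 1" using x False unfolding i_def by linarith+
    have "c \<noteq> i" "c \<noteq> i - 1" using i by auto
    with act_ext_elem_neg[OF i(1,2) X assms(4,5), of r g] i(3) show ?thesis by simp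
  qed
  with Cons Xs show ?case by (simp add: g_def)
qed simp

lemma (in fiedler_pencil) kernel_equation_cong:
  assumes "\<And>p. p < m * n + r \<Longrightarrow> f p = g p" "kernel_equation f"
  shows "kernel_equation g"
proof -
  have \<alpha>: "set \<alpha> \<subseteq> {- int m..int m - 1}" using set_\<alpha> by auto
  have "act (FM (- int m)) f p = act (FM (- int m)) g p" for p
    using assms fiedler_sys_top_carrier by (intro act_cong) auto
  moreover have "acts (map FM \<alpha>) f p = acts (map FM \<alpha>) g p" if "p < m * n + r" for p
    using FP_carrier[OF \<alpha>] assms(1) unfolding act_FP[OF \<alpha> that, symmetric] by (intro act_cong) auto
  ultimately show ?thesis using assms(2) unfolding kernel_equation_def by simp
qed

lemma vec_eq_zero_iff: "dim_vec v = k \<Longrightarrow> v = 0\<^sub>v k \<longleftrightarrow> (\<forall>p<k. v $ p = 0)"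
  by (auto simp: vec_eq_iff)

text \<open>
  The tuple \<open>\<tau>\<close> is given by its parts on both sides of \<open>-m\<close>, because \<open>\<alpha>\<close> depends on them.
\<close>
locale gfpr = system_data +
  fixes h :: nat and \<sigma> \<tau>l \<tau>r \<sigma>1 \<sigma>2 \<tau>1 \<tau>2 :: "int list" and X\<^sub>1 X\<^sub>2 Y\<^sub>1 Y\<^sub>2 :: "complex mat list"
  assumes invE: "invertible_mat E"
    and indices: "gfpr_indices m h \<sigma> (\<tau>l @ [- int m] @ \<tau>r) \<sigma>1 \<sigma>2 \<tau>1 \<tau>2"
    and X1: "nonsingular_assignment m n \<sigma>1 X\<^sub>1" and X2: "nonsingular_assignment m n \<sigma>2 X\<^sub>2"
    and Y1: "nonsingular_assignment m n \<tau>1 Y\<^sub>1" and Y2: "nonsingular_assignment m n \<tau>2 Y\<^sub>2"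
begin

abbreviation "\<tau> \<equiv> \<tau>l @ [- int m] @ \<tau>r"
abbreviation "\<alpha> \<equiv> map uminus (rev \<tau>l) @ \<sigma> @ map uminus (rev \<tau>r)"
abbreviation "N \<equiv> m * n + r"
abbreviation "M1 \<equiv> elem_prod m n r (\<tau>1 @ \<sigma>1) (Y\<^sub>1 @ X\<^sub>1)"
abbreviation "M2 \<equiv> elem_prod m n r (\<sigma>2 @ \<tau>2) (X\<^sub>2 @ Y\<^sub>2)"
abbreviation "L \<equiv> const_mat M1 * pencil (FP \<tau>) (FP \<sigma>) * const_mat M2"
abbreviation "S \<equiv> system_matrix (poly_mat n m As) A B C E"

lemma h: "h < m"
  using indices m unfolding gfpr_indices_def by auto

lemma \<sigma>: "distinct \<sigma>" "set \<sigma> = {0..int h}"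
  using indices unfolding gfpr_indices_def is_permutation_of_def by auto

lemma \<tau>_lr: "distinct (\<tau>l @ \<tau>r)" "set (\<tau>l @ \<tau>r) = {- int m + 1..- int h - 1}"
proof -
  have d: "distinct \<tau>" "set \<tau> = {- int m..- int h - 1}"
    using indices unfolding gfpr_indices_def is_permutation_of_def by auto
  then show "distinct (\<tau>l @ \<tau>r)" by auto
  have "set (\<tau>l @ \<tau>r) = set \<tau> - {- int m}" using d(1) by auto
  also have "\<dots> = {- int m + 1..- int h - 1}" unfolding d(2) by auto
  finally show "set (\<tau>l @ \<tau>r) = {- int m + 1..- int h - 1}" .
qed

lemma ranges:
  "set \<tau>l \<subseteq> {- int m + 1..- int h - 1}" "set \<tau>r \<subseteq> {- int m + 1..- int h - 1}"
  "set \<sigma>1 \<subseteq> {0..int h - 1}" "set \<sigma>2 \<subseteq> {0..int h - 1}"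
  "set \<tau>1 \<subseteq> {- int m..- int h - 2}" "set \<tau>2 \<subseteq> {- int m..- int h - 2}"
  using \<tau>_lr(2) indices unfolding gfpr_indices_def by auto

sublocale fiedler_pencil m n r As A B C E \<alpha>
proof unfold_locales
  have im: "set (map uminus (rev t)) = uminus ` set t" for t :: "int list" by simp
  have pos: "x \<in> uminus ` T \<longleftrightarrow> - x \<in> T" for x :: int and T by force
  have "set (map uminus (rev \<tau>l)) \<inter> set \<sigma> = {}" "set (map uminus (rev \<tau>r)) \<inter> set \<sigma> = {}"
    using ranges(1,2) unfolding im \<sigma>(2) by force+
  moreover have "set (map uminus (rev \<tau>l)) \<inter> set (map uminus (rev \<tau>r)) = {}"
    using \<tau>_lr(1) unfolding im by auto
  moreover have "distinct (map uminus (rev \<tau>l))" "distinct (map uminus (rev \<tau>r))"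
    using \<tau>_lr(1) by (auto simp: distinct_map)
  ultimately show "distinct \<alpha>" using \<sigma>(1) by auto
  show "set \<alpha> = {0..int m - 1}"
  proof (rule Set.set_eqI)
    fix x
    have "x \<in> set \<alpha> \<longleftrightarrow> - x \<in> set (\<tau>l @ \<tau>r) \<or> x \<in> set \<sigma>" by (auto simp: pos)
    then show "x \<in> set \<alpha> \<longleftrightarrow> x \<in> {0..int m - 1}"
      unfolding \<tau>_lr(2) \<sigma>(2) using h by (simp only: atLeastAtMost_iff) linarith
  qed
qed

lemma range_subsets:
  "set \<tau>l \<subseteq> {- int m..int m - 1}" "set \<tau>r \<subseteq> {- int m..int m - 1}" "set \<sigma> \<subseteq> {- int m..int m - 1}"
  "set (map uminus (rev \<tau>l)) \<subseteq> {- int m..int m - 1}" "set (map uminus (rev \<tau>r)) \<subseteq> {- int m..int m - 1}"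
  using ranges(1,2) \<sigma>(2) h by force+

lemma elem_ranges: "set (\<tau>1 @ \<sigma>1) \<subseteq> {- int m..int m - 1}" "set (\<sigma>2 @ \<tau>2) \<subseteq> {- int m..int m - 1}"
  using ranges h by force+

lemma M1_inverse: "\<exists>J. inverse_pair N M1 J"
  by (rule elem_prod_inverse[OF m nonsingular_assignment_append[OF Y1 X1] elem_ranges(1)])

lemma M2_inverse: "\<exists>J. inverse_pair N M2 J"
  by (rule elem_prod_inverse[OF m nonsingular_assignment_append[OF X2 Y2] elem_ranges(2)])

text \<open>
  This invertible constant matrix carries the null vectors of the GFPR to those of the Fiedler pencil
  of \<open>\<alpha>\<close>.
\<close>
definition W :: "complex mat" where "W = FP \<tau>r * M2"

lemma W_inverse: "\<exists>J. inverse_pair N W J"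
proof -
  have "inverse_pair N (FP \<tau>r) (FP (map uminus (rev \<tau>r)))"
    using ranges(2) by (intro FP_inverse_pair) auto
  with M2_inverse inverse_pair_mult show ?thesis unfolding W_def by blast
qed

lemma carriers:
  "M1 \<in> carrier_mat N N" "M2 \<in> carrier_mat N N" "W \<in> carrier_mat N N" "FP \<tau> \<in> carrier_mat N N" "FP \<sigma> \<in> carrier_mat N N"
  "FP \<alpha> \<in> carrier_mat N N"
proof -
  show "M1 \<in> carrier_mat N N" "M2 \<in> carrier_mat N N" "W \<in> carrier_mat N N"
    using M1_inverse M2_inverse W_inverse by (auto simp: inverse_pair_def)
  show "FP \<tau> \<in> carrier_mat N N" "FP \<sigma> \<in> carrier_mat N N" "FP \<alpha> \<in> carrier_mat N N"
    by (rule FP_carrier, use range_subsets m in auto)+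
qed

lemma pencil_carrier: "pencil (FP \<tau>) (FP \<sigma>) \<in> carrier_mat N N"
  using carriers unfolding pencil_def const_mat_def by auto

lemma L_carrier: "rat_mat L \<in> carrier_mat N N"
  using carriers pencil_carrier unfolding rat_mat_def const_mat_def by auto

lemma S_carrier: "rat_mat S \<in> carrier_mat (n + r) (n + r)"
  using ABCE by (auto simp: rat_mat_def system_matrix_def const_mat_def poly_mat_def)

lemma pencil_mult_vec:
  assumes "y \<in> carrier_vec N" "p < N"
  shows "(rat_mat (pencil (FP \<tau>) (FP \<sigma>)) *\<^sub>v y) $ p = lam * act (FP \<tau>) (($) y) p - act (FP \<sigma>) (($) y) p"
proof -
  have "(rat_mat (pencil (FP \<tau>) (FP \<sigma>)) *\<^sub>v y) $ p = (\<Sum>q<N. rat_mat (pencil (FP \<tau>) (FP \<sigma>)) $$ (p, q) * y $ q)"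
    using assms pencil_carrier by (auto simp: rat_mat_def scalar_prod_def atLeast0LessThan)
  also have "\<dots> = (\<Sum>q<N. lam * (ratc (FP \<tau> $$ (p, q)) * y $ q) - ratc (FP \<sigma> $$ (p, q)) * y $ q)"
  proof (intro sum.cong refl)
    fix q assume "q \<in> {..<N}"
    hence q: "q < N" by simp
    have "rat_mat (pencil (FP \<tau>) (FP \<sigma>)) $$ (p, q) = to_fract ([:0, 1:] * [:FP \<tau> $$ (p, q):] - [:FP \<sigma> $$ (p, q):])"
      using q assms(2) carriers by (simp add: rat_mat_def pencil_def const_mat_def)
    also have "\<dots> = lam * ratc (FP \<tau> $$ (p, q)) - ratc (FP \<sigma> $$ (p, q))"
      by (simp only: to_fract_diff to_fract_mult lam_def ratc_def)
    finally show "rat_mat (pencil (FP \<tau>) (FP \<sigma>)) $$ (p, q) * y $ q =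
        lam * (ratc (FP \<tau> $$ (p, q)) * y $ q) - ratc (FP \<sigma> $$ (p, q)) * y $ q"
      by (simp add: left_diff_distrib mult.assoc)
  qed
  also have "\<dots> = lam * act (FP \<tau>) (($) y) p - act (FP \<sigma>) (($) y) p"
    unfolding act_def using carriers by (simp add: sum_subtractf sum_distrib_left)
  finally show ?thesis .
qed

lemma equation_mult_left:
  assumes "J \<in> carrier_mat N N" "M \<in> carrier_mat N N" "M' \<in> carrier_mat N N"
    and "\<forall>p<N. lam * act M q p = act M' q p"
  shows "\<forall>p<N. lam * act (J * M) q p = act (J * M') q p"
proof (intro allI impI)
  fix p assume p: "p < N"
  have "lam * act (J * M) q p = act J (\<lambda>p. lam * act M q p) p"
    using act_mult[OF assms(1,2) p] by (simp add: act_scale)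
  also have "\<dots> = act J (act M' q) p" using assms by (intro act_cong) auto
  also have "\<dots> = act (J * M') q p" using act_mult[OF assms(1,3) p] by simp
  finally show "lam * act (J * M) q p = act (J * M') q p" .
qed

text \<open>
  Multiply from the left by the inverse of the product over \<open>\<tau>l\<close>, whose factors have the negated indices in
  reverse order. What is left of the product over \<open>\<tau>\<close> is \<open>M\<^sub>-\<^sub>m\<close> times the product over \<open>\<tau>r\<close>, and in the
  product over \<open>\<sigma>\<close> the product over \<open>\<alpha>\<close> is completed by inserting the product over \<open>\<tau>r\<close> and its inverse.
\<close>
lemma pencil_equation_iff:
  "(\<forall>p<N. lam * act (FP \<tau>) q p = act (FP \<sigma>) q p) \<longleftrightarrow> kernel_equation (act (FP \<tau>r) q)"
proof -
  let ?Nl = "FP (map uminus (rev \<tau>l))" and ?Nr = "FP (map uminus (rev \<tau>r))" and ?T = "FM (- int m)"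
  have il: "inverse_pair N (FP \<tau>l) ?Nl" and ir: "inverse_pair N (FP \<tau>r) ?Nr"
    using ranges(1,2) by (auto intro!: FP_inverse_pair)
  note c = carriers fiedler_sys_top_carrier
  have cl: "FP \<tau>l \<in> carrier_mat N N" "?Nl \<in> carrier_mat N N" "FP \<tau>r \<in> carrier_mat N N" "?Nr \<in> carrier_mat N N"
    using il ir by (auto simp: inverse_pair_def)
  have T: "FP [- int m] = ?T" using c by (simp add: fiedler_prod_def mat_prod_def)
  have \<tau>: "FP \<tau> = FP \<tau>l * (?T * FP \<tau>r)"
    using range_subsets T m by (subst FP_append, simp, simp, subst FP_append) auto
  have \<alpha>: "FP \<alpha> = ?Nl * (FP \<sigma> * ?Nr)"
    using range_subsets(3-5) by (subst FP_append, simp, simp, subst FP_append) auto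
  have l\<tau>: "?Nl * FP \<tau> = ?T * FP \<tau>r"
  proof -
    have "?Nl * FP \<tau> = (?Nl * FP \<tau>l) * (?T * FP \<tau>r)" unfolding \<tau> using cl c by (simp add: assoc_mult_mat[of _ N N _ N _ N])
    also have "\<dots> = ?T * FP \<tau>r" using il cl c by (simp add: inverse_pair_def)
    finally show ?thesis .
  qed
  have l\<sigma>: "?Nl * FP \<sigma> = FP \<alpha> * FP \<tau>r"
  proof -
    have "FP \<alpha> * FP \<tau>r = ?Nl * (FP \<sigma> * (?Nr * FP \<tau>r))" unfolding \<alpha> using cl c by (simp add: assoc_mult_mat[of _ N N _ N _ N])
    also have "\<dots> = ?Nl * FP \<sigma>" using ir cl c by (simp add: inverse_pair_def)
    finally show ?thesis by simp
  qed
  have \<sigma>': "FP \<tau>l * (FP \<alpha> * FP \<tau>r) = FP \<sigma>"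
  proof -
    have "FP \<tau>l * (FP \<alpha> * FP \<tau>r) = (FP \<tau>l * ?Nl) * FP \<sigma>"
      unfolding l\<sigma>[symmetric] using cl c by (simp add: assoc_mult_mat[of _ N N _ N _ N])
    also have "\<dots> = FP \<sigma>" using il c by (simp add: inverse_pair_def)
    finally show ?thesis .
  qed
  have "(\<forall>p<N. lam * act (FP \<tau>) q p = act (FP \<sigma>) q p) \<longleftrightarrow>
    (\<forall>p<N. lam * act (?T * FP \<tau>r) q p = act (FP \<alpha> * FP \<tau>r) q p)"
  proof
    assume "\<forall>p<N. lam * act (FP \<tau>) q p = act (FP \<sigma>) q p"
    from equation_mult_left[OF cl(2) c(4,5) this]
    show "\<forall>p<N. lam * act (?T * FP \<tau>r) q p = act (FP \<alpha> * FP \<tau>r) q p" unfolding l\<tau> l\<sigma> .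
  next
    assume *: "\<forall>p<N. lam * act (?T * FP \<tau>r) q p = act (FP \<alpha> * FP \<tau>r) q p"
    have "?T * FP \<tau>r \<in> carrier_mat N N" "FP \<alpha> * FP \<tau>r \<in> carrier_mat N N" using cl c by auto
    from equation_mult_left[OF cl(1) this *] show "\<forall>p<N. lam * act (FP \<tau>) q p = act (FP \<sigma>) q p"
      unfolding \<tau>[symmetric] \<sigma>' .
  qed
  also have "\<dots> \<longleftrightarrow> kernel_equation (act (FP \<tau>r) q)"
  proof -
    have "acts (map FM \<alpha>) f p = act (FP \<alpha>) f p" if "p < N" for f p
      using set_\<alpha> that by (intro act_FP[symmetric]) auto
    then show ?thesis unfolding kernel_equation_def using act_mult[OF c(7) cl(3)] act_mult[OF c(6) cl(3)] by simp
  qed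
  finally show ?thesis .
qed

lemma kernel_iff:
  assumes z: "z \<in> carrier_vec N"
  shows "z \<in> mat_kernel (rat_mat L) \<longleftrightarrow> kernel_equation (act W (($) z))"
proof -
  obtain J where J: "inverse_pair N M1 J" using M1_inverse by blast
  let ?T = "rat_mat (pencil (FP \<tau>) (FP \<sigma>))"
  have rc: "rat_const M \<in> carrier_mat N N" if "M \<in> carrier_mat N N" for M using that by (simp add: rat_const_eq)
  have cT: "?T \<in> carrier_mat N N" using pencil_carrier by (simp add: rat_mat_def)
  have cJ: "J \<in> carrier_mat N N" using J by (simp add: inverse_pair_def)
  have cc: "const_mat M1 \<in> carrier_mat N N" "const_mat M2 \<in> carrier_mat N N"
    using carriers by (auto simp: const_mat_def)
  have L: "rat_mat L = rat_const M1 * (?T * rat_const M2)"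
  proof -
    have "rat_mat L = rat_const M1 * ?T * rat_const M2"
      unfolding rat_mat_def using cc pencil_carrier by (simp add: to_fract.mat_hom_mult[of _ N N _ N])
    then show ?thesis using rc[OF carriers(1)] rc[OF carriers(2)] cT by (simp add: assoc_mult_mat[of _ N N _ N _ N])
  qed
  have "rat_const J * rat_const M1 = rat_const (J * M1)"
    unfolding rat_const_eq using cJ carriers(1) by (simp add: ratc.mat_hom_mult[of _ N N _ N])
  also have "\<dots> = 1\<^sub>m N" using J by (simp add: rat_const_eq inverse_pair_def ratc.mat_hom_one)
  finally have left: "mat_kernel (rat_mat L) = mat_kernel (?T * rat_const M2)"
    unfolding L using rc[OF carriers(1)] rc[OF carriers(2)] rc[OF cJ] cT by (intro mat_kernel_mult_eq[of _ N N]) auto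
  have 1: "z \<in> mat_kernel (?T * rat_const M2) \<longleftrightarrow> (\<forall>p<N. (?T *\<^sub>v (rat_const M2 *\<^sub>v z)) $ p = 0)"
  proof -
    have c: "?T * rat_const M2 \<in> carrier_mat N N" using cT rc[OF carriers(2)] by simp
    have assoc: "(?T * rat_const M2) *\<^sub>v z = ?T *\<^sub>v (rat_const M2 *\<^sub>v z)"
      by (rule assoc_mult_mat_vec[OF cT rc[OF carriers(2)] z])
    have dim: "dim_vec (?T *\<^sub>v (rat_const M2 *\<^sub>v z)) = N" using cT by simp
    show ?thesis unfolding mat_kernel[OF c]
      by (simp only: mem_Collect_eq z assoc vec_eq_zero_iff[OF dim] simp_thms)
  qed
  have 2: "(\<forall>p<N. (?T *\<^sub>v (rat_const M2 *\<^sub>v z)) $ p = 0) \<longleftrightarrow>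
      (\<forall>p<N. lam * act (FP \<tau>) (act M2 (($) z)) p = act (FP \<sigma>) (act M2 (($) z)) p)"
  proof -
    have y: "rat_const M2 *\<^sub>v z \<in> carrier_vec N" using rc[OF carriers(2)] z by auto
    have "act M (($) (rat_const M2 *\<^sub>v z)) p = act M (act M2 (($) z)) p" if "M \<in> carrier_mat N N" for M p
      using that carriers(2) z by (intro act_cong rat_const_mult_vec) auto
    note eqs = this[OF carriers(4)] this[OF carriers(5)]
    show ?thesis
      by (intro all_cong1 imp_cong refl) (simp only: pencil_mult_vec[OF y] eqs right_minus_eq)
  qed
  have 3: "kernel_equation (act (FP \<tau>r) (act M2 (($) z))) \<longleftrightarrow> kernel_equation (act W (($) z))"
  proof -
    have "act W (($) z) p = act (FP \<tau>r) (act M2 (($) z)) p" if "p < N" for p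
      unfolding W_def using FP_carrier[OF range_subsets(2)] carriers(2) that by (rule act_mult)
    note W = this
    show ?thesis
    proof
      assume "kernel_equation (act (FP \<tau>r) (act M2 (($) z)))"
      then show "kernel_equation (act W (($) z))" by (rule kernel_equation_cong[rotated]) (simp only: W)
    next
      assume "kernel_equation (act W (($) z))"
      then show "kernel_equation (act (FP \<tau>r) (act M2 (($) z)))" by (rule kernel_equation_cong[rotated]) (simp only: W)
    qed
  qed
  show ?thesis unfolding left by (rule trans[OF 1 trans[OF 2 trans[OF pencil_equation_iff 3]]])
qed

abbreviation "c \<equiv> c0 (\<sigma> @ \<sigma>2)"

lemma zero_in_\<sigma>: "0 \<in> set \<sigma>"
  using \<sigma>(2) by simp

lemma chase_\<sigma>: "chase (-1) \<sigma> = int (c0 \<sigma>)" "chase (-1) (\<sigma> @ \<sigma>2) = int c"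
  using c0_eq_chase[of \<sigma>] c0_eq_chase[of "\<sigma> @ \<sigma>2"] zero_in_\<sigma> by auto

lemma c_le: "c0 \<sigma> \<le> h" "c \<le> h"
proof -
  have "set (\<sigma> @ \<sigma>2) \<subseteq> {..int h}" using \<sigma>(2) ranges(4) by auto
  then show "c \<le> h" using chase_in[of "-1" "\<sigma> @ \<sigma>2"] chase_\<sigma>(2) by auto
  show "c0 \<sigma> \<le> h" using chase_in[of "-1" \<sigma>] chase_\<sigma>(1) \<sigma>(2) by auto
qed

lemma c0_\<alpha>: "c0 \<alpha> = nat (chase (int (c0 \<sigma>)) (map uminus (rev \<tau>r)))" "c0 \<alpha> < m"
proof -
  have "0 \<notin> set (map uminus (rev \<tau>l))" using ranges(1) by auto
  hence ch: "chase (-1) \<alpha> = chase (int (c0 \<sigma>)) (map uminus (rev \<tau>r))"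
    using chase_\<sigma>(1) by (simp add: chase_append chase_notin)
  have a: "0 \<in> set \<alpha>" using zero_in_\<sigma> by simp
  from c0_eq_chase[OF a] ch show "c0 \<alpha> = nat (chase (int (c0 \<sigma>)) (map uminus (rev \<tau>r)))" by simp
  have "int (c0 \<alpha>) \<in> set \<alpha>" using c0_eq_chase[OF a] chase_in[of "-1" \<alpha>] by auto
  then show "c0 \<alpha> < m" unfolding set_\<alpha> by simp
qed

lemma act_W:
  assumes "p < N"
  shows "act W f p = act (FP \<tau>r) (act M2 f) p"
  unfolding W_def using FP_carrier[OF range_subsets(2)] carriers(2) assms by (rule act_mult)

lemma M2_as_acts:
  assumes "p < N"
  shows "act M2 f p = acts (map2 (ext_elem_mat m n r) \<sigma>2 X\<^sub>2) (acts (map2 (ext_elem_mat m n r) \<tau>2 Y\<^sub>2) f) p"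
proof -
  have "map2 (ext_elem_mat m n r) (\<sigma>2 @ \<tau>2) (X\<^sub>2 @ Y\<^sub>2) =
      map2 (ext_elem_mat m n r) \<sigma>2 X\<^sub>2 @ map2 (ext_elem_mat m n r) \<tau>2 Y\<^sub>2"
    using X2 by (simp add: nonsingular_assignment_def matrix_assignment_def)
  with act_elem_prod[OF m nonsingular_assignment_append[OF X2 Y2] elem_ranges(2) assms] show ?thesis by simp
qed

text \<open>
  The factors over \<open>\<sigma>2\<close> chase block \<open>c0 \<sigma>\<close> to block \<open>c\<close>, which is at most \<open>h\<close>, and those over \<open>\<tau>2\<close> act
  on higher blocks only.
\<close>
lemma blk_M2:
  assumes k: "k < n"
  shows "blk m n (act M2 f) (c0 \<sigma>) k = blk m n f c k"
proof -
  let ?t2 = "acts (map2 (ext_elem_mat m n r) \<tau>2 Y\<^sub>2) f"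
  have cm: "c0 \<sigma> < m" "c < m" using c_le h by auto
  have "blk m n (act M2 f) (c0 \<sigma>) k = blk m n (acts (map2 (ext_elem_mat m n r) \<sigma>2 X\<^sub>2) ?t2) (c0 \<sigma>) k"
    unfolding blk_def using blk_pos_less[OF cm(1) k] by (intro M2_as_acts) simp
  also have "\<dots> = blk m n ?t2 (nat (chase (int (c0 \<sigma>)) \<sigma>2)) k"
  proof (rule chase_acts)
    have "SIP (\<sigma> @ \<sigma>2)" using indices SIP_appendD2 unfolding gfpr_indices_def by blast
    from SIP_undisturbed[OF this zero_in_\<sigma>] chase_\<sigma> show "undisturbed (int (c0 \<sigma>)) \<sigma>2" by simp
    show "set \<sigma>2 \<subseteq> {0..int m - 1}" using ranges(4) h by auto
  qed (use X2 cm k in \<open>auto simp: nonsingular_assignment_def matrix_assignment_def\<close>)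
  also have "nat (chase (int (c0 \<sigma>)) \<sigma>2) = c"
    using chase_\<sigma> by (simp add: chase_append)
  also have "blk m n ?t2 c k = blk m n f c k"
  proof (rule blk_acts_high)
    show "set \<tau>2 \<subseteq> {- int m..- int c - 2}" using ranges(6) c_le by force
  qed (use Y2 cm k in \<open>auto simp: nonsingular_assignment_def matrix_assignment_def\<close>)
  finally show ?thesis .
qed

text \<open>
  The inverse of the product over \<open>\<tau>r\<close> has positive indices, which together with \<open>\<sigma>\<close> form the
  final part of \<open>\<alpha>\<close>. Chasing block \<open>c0 \<sigma>\<close> through this inverse leads to block \<open>c0 \<alpha>\<close>.
\<close>
lemma blk_through_\<tau>r:
  assumes k: "k < n"
  shows "blk m n f (c0 \<sigma>) k = blk m n (act (FP \<tau>r) f) (c0 \<alpha>) k"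
proof -
  let ?t = "map uminus (rev \<tau>r)" and ?w = "act (FP \<tau>r) f"
  have cm: "c0 \<sigma> < m" using c_le h by auto
  have inv: "inverse_pair N (FP \<tau>r) (FP ?t)"
    using ranges(2) by (intro FP_inverse_pair) auto
  have pos: "(m - Suc (c0 \<sigma>)) * n + k < N" using blk_pos_less[OF cm k] by simp
  have t: "set ?t \<subseteq> {1..int m - 1}" using ranges(2) by auto
  obtain Xs where Xs: "length Xs = length ?t" "set Xs \<subseteq> carrier_mat n n" "map FM ?t = map2 (ext_elem_mat m n r) ?t Xs"
    using fiedler_as_ext[OF t] by blast
  have t': "set ?t \<subseteq> {- int m..int m - 1}" using t by auto
  have "f p = act (FP ?t) ?w p" if "p < N" for p
    using act_mult[of "FP ?t" N N "FP \<tau>r" N p f] inv that by (simp add: inverse_pair_def)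
  hence "blk m n f (c0 \<sigma>) k = act (FP ?t) ?w ((m - Suc (c0 \<sigma>)) * n + k)" using pos by (simp add: blk_def)
  also have "\<dots> = blk m n (acts (map FM ?t) ?w) (c0 \<sigma>) k"
    unfolding act_FP[OF t' pos] by (simp add: blk_def)
  also have "\<dots> = blk m n ?w (nat (chase (int (c0 \<sigma>)) ?t)) k"
    unfolding Xs(3)
  proof (rule chase_acts[OF Xs(1,2)])
    show "set ?t \<subseteq> {0..int m - 1}" using t by auto
    have "distinct (\<sigma> @ ?t)" using distinct by simp
    from SIP_undisturbed[OF SIP_distinct[OF this] zero_in_\<sigma>] show "undisturbed (int (c0 \<sigma>)) ?t"
      unfolding chase_\<sigma>(1) .
  qed (use cm k in auto)
  finally show ?thesis unfolding c0_\<alpha>(1) .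
qed

lemma blk_W:
  assumes k: "k < n"
  shows "blk m n (act W f) (c0 \<alpha>) k = blk m n f c k"
proof -
  have "blk m n (act W f) (c0 \<alpha>) k = blk m n (act (FP \<tau>r) (act M2 f)) (c0 \<alpha>) k"
    unfolding blk_def using blk_pos_less[OF c0_\<alpha>(2) k] by (intro act_W) simp
  also have "\<dots> = blk m n f c k" using blk_through_\<tau>r[OF k, of "act M2 f"] blk_M2[OF k, of f] by simp
  finally show ?thesis .
qed

lemma tail_W:
  assumes k: "k < r"
  shows "tail m n (act W f) k = tail m n f k"
proof -
  let ?t = "map uminus (rev \<tau>r)"
  have t: "set ?t \<subseteq> {1..int m - 1}" using ranges(2) by auto
  have t': "set ?t \<subseteq> {- int m..int m - 1}" using t by auto
  have pos: "m * n + k < N" using k by simp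
  have inv: "inverse_pair N (FP \<tau>r) (FP ?t)"
    using ranges(2) by (intro FP_inverse_pair) auto
  have "act (FP ?t) (act (FP \<tau>r) (act M2 f)) (m * n + k) = act M2 f (m * n + k)"
    using act_mult[of "FP ?t" N N "FP \<tau>r" N "m * n + k" "act M2 f"] inv pos by (simp add: inverse_pair_def)
  hence "tail m n (acts (map FM ?t) (act (FP \<tau>r) (act M2 f))) k = tail m n (act M2 f) k"
    unfolding act_FP[OF t' pos] by (simp add: tail_def)
  hence "tail m n (act (FP \<tau>r) (act M2 f)) k = tail m n (act M2 f) k"
    using tail_run_unchanged[OF t k] by simp
  also have "\<dots> = tail m n f k"
  proof -
    have s: "set \<sigma>2 \<subseteq> {- int m..int m - 1}" "set \<tau>2 \<subseteq> {- int m..int m - 1}" using ranges h by force+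
    have "tail m n (act M2 f) k = tail m n (acts (map2 (ext_elem_mat m n r) \<sigma>2 X\<^sub>2) (acts (map2 (ext_elem_mat m n r) \<tau>2 Y\<^sub>2) f)) k"
      unfolding tail_def using pos by (rule M2_as_acts)
    also have "\<dots> = tail m n f k"
      using X2 Y2 s m k tail_acts_ext[of X\<^sub>2 \<sigma>2 n m k r] tail_acts_ext[of Y\<^sub>2 \<tau>2 n m k r]
      unfolding nonsingular_assignment_def matrix_assignment_def by metis
    finally show ?thesis .
  qed
  finally show ?thesis using act_W[OF pos, of f] by (simp add: tail_def)
qed

abbreviation sol where "sol z \<equiv> act W (($) z)"

text \<open>
  The recovered vector consists of the input \<open>u\<close> of factor 0 and the tail, that is, of the part of
  the trajectory which solves the system.
\<close>
lemma recover_solution: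
  assumes z: "z \<in> carrier_vec N"
  shows "k < n \<Longrightarrow> recover m n r c z $ k = upper (sol z) 0 k"
    "k < r \<Longrightarrow> recover m n r c z $ (n + k) = tail m n (sol z) k"
  using upper_zero[of k "sol z"] blk_W[of k "($) z"] tail_W[of k "($) z"] by (auto simp: recover_index)

lemma recover_kernel:
  assumes "z \<in> mat_kernel (rat_mat L)"
  shows "recover m n r c z \<in> mat_kernel (rat_mat S)"
    and "flow consecution (blk m n (sol z)) (upper (sol z)) (lower (sol z)) (tail m n (sol z))"
    and "system_kernel (upper (sol z) 0) (tail m n (sol z))"
proof -
  have z: "z \<in> carrier_vec N" by (rule mat_kernelD(1)[OF L_carrier assms])
  have "kernel_equation (sol z)" using kernel_iff[OF z] assms by simp
  from kernel_flow[OF this]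
  show fl: "flow consecution (blk m n (sol z)) (upper (sol z)) (lower (sol z)) (tail m n (sol z))" .
  from flow_system_kernel[OF this]
  show "system_kernel (upper (sol z) 0) (tail m n (sol z))" .
  moreover have "system_kernel (($) (recover m n r c z)) (\<lambda>k. recover m n r c z $ (n + k)) \<longleftrightarrow>
    system_kernel (upper (sol z) 0) (tail m n (sol z))"
    by (intro system_kernel_cong recover_solution[OF z])
  ultimately show "recover m n r c z \<in> mat_kernel (rat_mat S)"
    using system_matrix_kernel[OF recover_carrier] by simp
qed

text \<open>
  The top block of a null vector \<open>w\<close> of the Fiedler pencil is \<open>u\<close> times \<open>\<lambda>\<close> to the number of inversions, and
  the degrees of the other blocks are not larger. Multiplication by the invertible constant matrix \<open>W\<close>
  does not affect degree bounds.
\<close>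
lemma recover_degree:
  assumes ker: "z \<in> mat_kernel (rat_mat L)"
  shows "(\<forall>i<N. z $ i \<in> degree_le (d + int (inversions m \<alpha>))) \<longleftrightarrow> (\<forall>i<n + r. recover m n r c z $ i \<in> degree_le d)"
proof -
  have z: "z \<in> carrier_vec N" by (rule mat_kernelD(1)[OF L_carrier ker])
  let ?f = "sol z"
  let ?s = "num_false consecution (m - 1)"
  note fl = recover_kernel(2,3)[OF ker]
  obtain J where J: "inverse_pair N W J" using W_inverse by blast
  have Jf: "z $ p = act J ?f p" if "p < N" for p
    using act_mult[of J N N W N p "($) z"] J that by (simp add: inverse_pair_def)
  have rec: "(\<forall>i<n + r. recover m n r c z $ i \<in> degree_le d) \<longleftrightarrow>
    (\<forall>k<n. upper ?f 0 k \<in> degree_le d) \<and> (\<forall>k<r. tail m n ?f k \<in> degree_le d)"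
  proof (intro iffI conjI allI impI)
    fix i assume *: "(\<forall>k<n. upper ?f 0 k \<in> degree_le d) \<and> (\<forall>k<r. tail m n ?f k \<in> degree_le d)" and i: "i < n + r"
    show "recover m n r c z $ i \<in> degree_le d"
    proof (cases "i < n")
      case False
      then obtain k where "i = n + k" by (metis le_iff_add not_le)
      with i * recover_solution(2)[OF z, of k] show ?thesis by simp
    qed (use * recover_solution(1)[OF z] in simp)
  next
    fix k assume *: "\<forall>i<n + r. recover m n r c z $ i \<in> degree_le d" and k: "k < n"
    from *[rule_format, of k] k recover_solution(1)[OF z k] show "upper ?f 0 k \<in> degree_le d" by simp
  next
    fix k assume *: "\<forall>i<n + r. recover m n r c z $ i \<in> degree_le d" and k: "k < r"
    from *[rule_format, of "n + k"] k recover_solution(2)[OF z k] show "tail m n ?f k \<in> degree_le d" by simp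
  qed
  have zf: "(\<forall>i<N. z $ i \<in> degree_le e) \<longleftrightarrow> (\<forall>p<N. ?f p \<in> degree_le e)" for e
  proof (intro iffI allI impI)
    fix p assume "\<forall>i<N. z $ i \<in> degree_le e"
    then show "?f p \<in> degree_le e" using carriers(3) by (intro degree_le_act) auto
  next
    fix p assume "\<forall>p<N. ?f p \<in> degree_le e" "p < N"
    moreover from this have "act J ?f p \<in> degree_le e"
      using J by (intro degree_le_act[of J]) (auto simp: inverse_pair_def)
    ultimately show "z $ p \<in> degree_le e" by (simp only: Jf)
  qed
  show ?thesis unfolding zf rec inversions_eq
  proof (intro iffI conjI allI impI)
    assume f: "\<forall>p<N. ?f p \<in> degree_le (d + int ?s)"
    have u: "upper ?f 0 k \<in> degree_le d" if k: "k < n" for k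
    proof (rule degree_le_lam_power_cancel)
      show "upper ?f 0 k \<in> degree_le (d + int ?s)"
        using f blk_pos_less[OF c0_\<alpha>(2) k] unfolding upper_zero[OF k] blk_def by simp
      have "lam ^ ?s * upper ?f 0 k = blk m n ?f (m - 1) k"
        using flow_a[OF fl(1) order_refl k] trajectory_top(1)[OF k] by simp
      also have "\<dots> \<in> degree_le (d + int ?s)"
        using f m blk_pos_less[of "m - 1" m k n] k unfolding blk_def by simp
      finally show "lam ^ ?s * upper ?f 0 k \<in> degree_le (d + int ?s)" .
    qed
    have "tail m n ?f k \<in> degree_le (d + int ?s)" if "k < r" for k
      using f that unfolding tail_def by simp
    with tail_degree_le[OF fl(2) invE u] show "tail m n ?f k \<in> degree_le d" if "k < r" for k
      using that by blast
    from u show "upper ?f 0 k \<in> degree_le d" if "k < n" for k using that .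
  next
    fix p assume *: "(\<forall>k<n. upper ?f 0 k \<in> degree_le d) \<and> (\<forall>k<r. tail m n ?f k \<in> degree_le d)" and "p < N"
    from this(2) show "?f p \<in> degree_le (d + int ?s)"
    proof (cases rule: pos_cases)
      case (1 j k)
      have "blk m n ?f j k \<in> degree_le (d + int ?s)"
        using * by (intro flow_degree_le[OF fl(1)] 1) auto
      then show ?thesis by (simp add: blk_def 1(3))
    next
      case (2 k)
      have "tail m n ?f k \<in> degree_le (d + int ?s)" using * 2(1) degree_le_mono[of _ d "d + int ?s"] by simp
      then show ?thesis by (simp add: tail_def 2(2))
    qed
  qed
qed

text \<open>
  Injectivity is the case of a negative bound in \<open>recover_degree\<close>; surjectivity holds because every solution
  of the system starts a flow.
\<close>
lemma recover_bij: "bij_betw (recover m n r c) (mat_kernel (rat_mat L)) (mat_kernel (rat_mat S))"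
proof -
  have cm: "c < m" using c_le h by auto
  have "inj_on (recover m n r c) (mat_kernel (rat_mat L))"
  proof (rule inj_onI)
    fix x y assume xy: "x \<in> mat_kernel (rat_mat L)" "y \<in> mat_kernel (rat_mat L)" "recover m n r c x = recover m n r c y"
    have car: "x \<in> carrier_vec N" "y \<in> carrier_vec N" using mat_kernelD(1)[OF L_carrier] xy by auto
    define w where "w = x + (-1) \<cdot>\<^sub>v y"
    have my: "(-1) \<cdot>\<^sub>v y \<in> mat_kernel (rat_mat L)" using mat_kernel_smult[OF L_carrier xy(2)] .
    have w: "w \<in> mat_kernel (rat_mat L)"
      using mat_kernelD[OF L_carrier xy(1)] mat_kernelD[OF L_carrier my] mult_add_distrib_mat_vec[OF L_carrier, of x "(-1) \<cdot>\<^sub>v y"]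
      unfolding w_def by (intro mat_kernelI[OF L_carrier]) auto
    have "recover m n r c w = recover m n r c x + (-1) \<cdot>\<^sub>v recover m n r c y"
      using car cm by (simp add: w_def recover_add recover_smult)
    moreover have "(recover m n r c y + (-1) \<cdot>\<^sub>v recover m n r c y) $ i = 0" if "i < n + r" for i
      using that by (auto simp: recover_def)
    ultimately have "recover m n r c w $ i = 0" if "i < n + r" for i
      using that by (simp only: xy(3))
    \<comment> \<open>the bound is chosen such that the entries of \<open>w\<close> satisfy the bound \<open>-1\<close>, that is, vanish\<close>
    hence "\<forall>i<n + r. recover m n r c w $ i \<in> degree_le (-1 - int (inversions m \<alpha>))" by simp
    with recover_degree[OF w, of "-1 - int (inversions m \<alpha>)"] have "\<forall>i<N. w $ i \<in> degree_le (-1)" by simp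
    hence "w $ i = 0" if "i < N" for i using that by (auto simp: degree_le_def)
    hence "x $ i = y $ i" if "i < N" for i using that car by (simp add: w_def)
    then show "x = y" using car by (intro eq_vecI) auto
  qed
  moreover have "\<exists>z\<in>mat_kernel (rat_mat L). recover m n r c z = x" if x: "x \<in> mat_kernel (rat_mat S)" for x
  proof -
    have xc: "x \<in> carrier_vec (n + r)" by (rule mat_kernelD(1)[OF S_carrier x])
    have sk: "system_kernel (($) x) (\<lambda>k. x $ (n + k))" using system_matrix_kernel[OF xc] x by simp
    obtain w a b where fl: "flow consecution w a b (\<lambda>k. x $ (n + k))" "a 0 = ($) x"
      by (rule flow_exists[OF sk])
    obtain f where f: "kernel_equation f" "\<And>i k. i < m \<Longrightarrow> k < n \<Longrightarrow> blk m n f i k = w i k"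
        "\<And>k. tail m n f k = x $ (n + k)" "\<And>k. k < n \<Longrightarrow> upper f 0 k = a 0 k"
      by (rule flow_kernel[OF fl(1)], rule that)
    obtain J where J: "inverse_pair N W J" using W_inverse by blast
    define z where "z = vec N (act J f)"
    have z: "z \<in> carrier_vec N" by (simp add: z_def)
    have Wz: "sol z p = f p" if "p < N" for p
    proof -
      have "sol z p = act W (act J f) p" using carriers(3) by (intro act_cong) (auto simp: z_def)
      also have "\<dots> = f p" using act_mult[of W N N J N p f] J that by (simp add: inverse_pair_def)
      finally show ?thesis .
    qed
    have "kernel_equation (sol z)" by (rule kernel_equation_cong[OF _ f(1)]) (simp add: Wz)
    hence "z \<in> mat_kernel (rat_mat L)" using kernel_iff[OF z] by simp
    moreover have "recover m n r c z = x"
    proof (rule eq_vecI)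
      fix i assume i: "i < dim_vec x"
      show "recover m n r c z $ i = x $ i"
      proof (cases "i < n")
        case True
        have "recover m n r c z $ i = blk m n (sol z) (c0 \<alpha>) i" using blk_W[OF True] by (simp add: recover_index True)
        also have "\<dots> = blk m n f (c0 \<alpha>) i" using blk_pos_less[OF c0_\<alpha>(2) True] by (simp add: blk_def Wz)
        also have "\<dots> = x $ i" using f(4)[OF True] fl(2) upper_zero[OF True, of f] by simp
        finally show ?thesis .
      next
        case False
        then obtain k where k: "i = n + k" by (metis le_iff_add not_le)
        hence kr: "k < r" using i xc by simp
        have "recover m n r c z $ i = tail m n (sol z) k" using tail_W[OF kr] by (simp add: recover_index kr k)
        also have "\<dots> = x $ i" using f(3)[of k] kr by (simp add: tail_def Wz k)
        finally show ?thesis .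
      qed
    qed (use xc in simp)
    ultimately show ?thesis by blast
  qed
  ultimately show ?thesis
    unfolding bij_betw_def using recover_kernel(1) by (auto simp: image_iff)
qed

theorem right_recovery:
  assumes "minimal_basis N (mat_kernel (rat_mat L)) vs"
  shows "minimal_basis (n + r) (mat_kernel (rat_mat S)) (map (recover m n r c) vs)"
    and "\<And>v. v \<in> set vs \<Longrightarrow> vec_degree v = vec_degree (recover m n r c v) + inversions m \<alpha>"
proof -
  have cm: "c < m" using c_le h by auto
  have car: "x \<in> carrier_vec N" if "x \<in> mat_kernel (rat_mat L)" for x
    by (rule mat_kernelD(1)[OF L_carrier that])
  have add: "recover m n r c (x + y) = recover m n r c x + recover m n r c y"
    if "x \<in> mat_kernel (rat_mat L)" "y \<in> mat_kernel (rat_mat L)" for x y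
    by (rule recover_add[OF cm car[OF that(1)] car[OF that(2)]])
  have smult: "recover m n r c (a \<cdot>\<^sub>v x) = a \<cdot>\<^sub>v recover m n r c x" if "x \<in> mat_kernel (rat_mat L)" for a x
    by (rule recover_smult[OF cm car[OF that]])
  note transfer = minimal_basis_transfer[OF L_carrier S_carrier recover_bij add smult
      recover_carrier recover_map_vec[OF cm] recover_degree assms]
  show "minimal_basis (n + r) (mat_kernel (rat_mat S)) (map (recover m n r c) vs)"
    by (rule transfer(1))
  show "vec_degree v = vec_degree (recover m n r c v) + inversions m \<alpha>" if "v \<in> set vs" for v
    by (rule transfer(2)[OF _ _ _ _ _ that])
qed

end

section \<open>Recovery of left minimal bases by transposition\<close>

lemma transpose_const_mat: "(const_mat M)\<^sup>T = const_mat M\<^sup>T"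
  by (intro eq_matI) (auto simp: const_mat_def)

lemma transpose_rat_mat: "(rat_mat M)\<^sup>T = rat_mat M\<^sup>T"
  by (intro eq_matI) (auto simp: rat_mat_def)

lemma transpose_pencil:
  "M \<in> carrier_mat k k \<Longrightarrow> N \<in> carrier_mat k k \<Longrightarrow> (pencil M N)\<^sup>T = pencil M\<^sup>T N\<^sup>T"
  by (intro eq_matI) (auto simp: pencil_def const_mat_def)

lemma transpose_kronecker: "(M \<otimes>\<^sub>k N)\<^sup>T = transpose_mat M \<otimes>\<^sub>k transpose_mat N"
proof (rule eq_matI)
  fix i j assume ij: "i < dim_row (transpose_mat M \<otimes>\<^sub>k transpose_mat N)" "j < dim_col (transpose_mat M \<otimes>\<^sub>k transpose_mat N)"
  have pos: "dim_row N > 0" "dim_col N > 0" using ij by (auto simp: kronecker_def intro: ccontr)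
  have "i div dim_col N < dim_col M" "j div dim_row N < dim_row M"
    using ij by (auto simp: kronecker_def less_mult_imp_div_less)
  with ij pos show "(M \<otimes>\<^sub>k N)\<^sup>T $$ (i, j) = (transpose_mat M \<otimes>\<^sub>k transpose_mat N) $$ (i, j)"
    by (simp add: kronecker_def)
qed (auto simp: kronecker_def)

lemma transpose_diag_block2:
  assumes "M \<in> carrier_mat a a" "N \<in> carrier_mat b b"
  shows "(diag_block_mat [M, N])\<^sup>T = diag_block_mat [transpose_mat M, transpose_mat N]"
  unfolding diag_block_mat2 using assms
  by (subst transpose_four_block_mat[of _ a a _ b _ b]) auto

lemma transpose_elem_mat:
  assumes X: "X \<in> carrier_mat n n"
  shows "(elem_mat m n i X)\<^sup>T = elem_mat m n i X\<^sup>T"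
proof -
  have F: "(four_block_mat Y (1\<^sub>m n) (1\<^sub>m n) Z)\<^sup>T = four_block_mat Y\<^sup>T (1\<^sub>m n) (1\<^sub>m n) Z\<^sup>T"
    if "Y \<in> carrier_mat n n" "Z \<in> carrier_mat n n" for Y Z :: "complex mat"
    using that by (subst transpose_four_block_mat[of _ n n _ n _ n]) auto
  have D: "(diag_block_mat [1\<^sub>m a, four_block_mat Y (1\<^sub>m n) (1\<^sub>m n) Z, 1\<^sub>m b])\<^sup>T =
      diag_block_mat [1\<^sub>m a, four_block_mat Y\<^sup>T (1\<^sub>m n) (1\<^sub>m n) Z\<^sup>T, 1\<^sub>m b]"
    if "Y \<in> carrier_mat n n" "Z \<in> carrier_mat n n" for Y Z :: "complex mat" and a b
  proof -
    have c: "four_block_mat Y (1\<^sub>m n) (1\<^sub>m n) Z \<in> carrier_mat (n + n) (n + n)" using that by auto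
    show ?thesis unfolding diag_block_mat3
      by (simp only: transpose_diag_block2[OF one_carrier_mat diag_block_mat2_carrier[OF c one_carrier_mat]]
          transpose_diag_block2[OF c one_carrier_mat] F[OF that] transpose_one)
  qed
  have Z: "(0\<^sub>m n n)\<^sup>T = (0\<^sub>m n n :: complex mat)" by simp
  show ?thesis unfolding elem_mat_def
    by (simp only: if_distrib[of transpose_mat] transpose_diag_block2[OF one_carrier_mat X]
        transpose_diag_block2[OF X one_carrier_mat] D[OF X zero_carrier_mat] D[OF zero_carrier_mat X] transpose_one Z)
qed

lemma transpose_ext_elem_mat:
  assumes "X \<in> carrier_mat n n" "m \<ge> 1" "i \<in> {- int m..int m - 1}"
  shows "(ext_elem_mat m n r i X)\<^sup>T = ext_elem_mat m n r i X\<^sup>T"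
  unfolding ext_elem_mat_def
  by (simp only: transpose_diag_block2[OF elem_mat_carrier[OF assms] one_carrier_mat] transpose_elem_mat[OF assms(1)] transpose_one)

lemma transpose_mat_prod:
  assumes "set Ms \<subseteq> carrier_mat N N"
  shows "(mat_prod N Ms)\<^sup>T = mat_prod N (rev (map transpose_mat Ms))"
  using assms
proof (induction Ms)
  case Nil
  then show ?case by (simp add: mat_prod_def)
next
  case (Cons M Ms)
  have c: "M \<in> carrier_mat N N" "mat_prod N Ms \<in> carrier_mat N N" using Cons.prems by (auto intro: mat_prod_carrier)
  have "(mat_prod N (M # Ms))\<^sup>T = (mat_prod N Ms)\<^sup>T * transpose_mat M"
    using transpose_mult[OF c] by (simp add: mat_prod_def)
  also have "\<dots> = mat_prod N (rev (map transpose_mat Ms)) * mat_prod N [transpose_mat M]"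
    using Cons c by (simp add: mat_prod_def)
  also have "\<dots> = mat_prod N (rev (map transpose_mat Ms) @ [transpose_mat M])"
    using Cons.prems by (intro mat_prod_append[symmetric]) auto
  finally show ?case by simp
qed

lemma transpose_elem_prod:
  assumes "length X = length t" "set X \<subseteq> carrier_mat n n" "m \<ge> 1" "set t \<subseteq> {- int m..int m - 1}"
  shows "(elem_prod m n r t X)\<^sup>T = elem_prod m n r (rev t) (rev (map transpose_mat X))"
proof -
  have el: "ext_elem_mat m n r i Y \<in> carrier_mat (m * n + r) (m * n + r)"
    "(ext_elem_mat m n r i Y)\<^sup>T = ext_elem_mat m n r i Y\<^sup>T" if "(i, Y) \<in> set (zip t X)" for i Y
    using that assms set_zip_leftD[OF that] set_zip_rightD[OF that]
    by (auto intro!: ext_elem_mat_carrier transpose_ext_elem_mat)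
  have "map transpose_mat (map2 (ext_elem_mat m n r) t X) = map2 (ext_elem_mat m n r) t (map transpose_mat X)"
    by (auto simp: zip_map2 el)
  moreover have "rev (map2 (ext_elem_mat m n r) t (map transpose_mat X)) = map2 (ext_elem_mat m n r) (rev t) (rev (map transpose_mat X))"
    using assms(1) by (simp add: zip_rev rev_map[symmetric])
  moreover have "set (map2 (ext_elem_mat m n r) t X) \<subseteq> carrier_mat (m * n + r) (m * n + r)" using el(1) by auto
  ultimately show ?thesis unfolding elem_prod_def by (simp only: transpose_mat_prod)
qed

lemma inverse_pair_transpose:
  assumes "inverse_pair N M J"
  shows "inverse_pair N M\<^sup>T J\<^sup>T"
proof (rule inverse_pairI)
  have c: "M \<in> carrier_mat N N" "J \<in> carrier_mat N N" using assms by (auto simp: inverse_pair_def)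
  then show "transpose_mat M \<in> carrier_mat N N" "transpose_mat J \<in> carrier_mat N N" by auto
  show "transpose_mat M * transpose_mat J = 1\<^sub>m N"
    using transpose_mult[OF c(2,1)] assms by (simp add: inverse_pair_def)
qed

lemma invertible_mat_transpose:
  fixes X :: "complex mat"
  assumes "invertible_mat X" "X \<in> carrier_mat n n"
  shows "invertible_mat X\<^sup>T"
proof -
  obtain J where "inverse_pair n X J" using assms by (rule invertible_matE)
  from inverse_pair_transpose[OF this] show ?thesis
    unfolding invertible_mat_def inverts_mat_def inverse_pair_def by fastforce
qed

lemma nonsingular_assignment_rev:
  assumes "nonsingular_assignment m n t X"
  shows "nonsingular_assignment m n (rev t) (rev (map transpose_mat X))"
proof -
  have X: "length X = length t" "set X \<subseteq> carrier_mat n n"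
    "\<And>j. j < length t \<Longrightarrow> t ! j \<in> {0, - int m} \<Longrightarrow> invertible_mat (X ! j)"
    using assms unfolding nonsingular_assignment_def matrix_assignment_def by auto
  have "invertible_mat (rev (map transpose_mat X) ! j)" if j: "j < length t" "rev t ! j \<in> {0, - int m}" for j
  proof -
    let ?k = "length t - Suc j"
    have k: "?k < length t" using j by simp
    have "rev (map transpose_mat X) ! j = (X ! ?k)\<^sup>T" using j X(1) by (simp add: rev_nth)
    moreover have "X ! ?k \<in> carrier_mat n n" using X(1,2) k nth_mem[of ?k X] by auto
    moreover have "invertible_mat (X ! ?k)" using X(3)[OF k] j by (simp add: rev_nth)
    ultimately show ?thesis by (simp add: invertible_mat_transpose)
  qed
  with X(1,2) show ?thesis unfolding nonsingular_assignment_def matrix_assignment_def by auto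
qed

lemma SIP_rev:
  assumes "SIP t"
  shows "SIP (rev t)"
  unfolding SIP_def
proof (intro allI impI)
  fix a b assume ab: "a < b \<and> b < length (rev t) \<and> rev t ! a = rev t ! b"
  let ?a = "length t - Suc b" and ?b = "length t - Suc a"
  have "?a < ?b" "?b < length t" "t ! ?a = t ! ?b" using ab by (auto simp: rev_nth)
  with assms obtain c where c: "?a < c" "c < ?b" "t ! c = t ! ?a + 1" unfolding SIP_def by blast
  let ?c = "length t - Suc c"
  have "a < ?c" "?c < b" using c ab by auto
  moreover have "rev t ! ?c = t ! c" using c by (simp add: rev_nth)
  moreover have "rev t ! a = t ! ?a" using ab by (simp add: rev_nth)
  ultimately show "\<exists>c>a. c < b \<and> rev t ! c = rev t ! a + 1" using c(3) by (intro exI[of _ ?c]) simp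
qed

lemma has_consecution_at_rev:
  assumes "distinct \<alpha>" "t \<in> set \<alpha>" "t + 1 \<in> set \<alpha>"
  shows "has_consecution_at (rev \<alpha>) t \<longleftrightarrow> \<not> has_consecution_at \<alpha> t"
proof
  assume "has_consecution_at (rev \<alpha>) t"
  then obtain us vs ws where r: "rev \<alpha> = us @ t # vs @ (t + 1) # ws"
    using has_consecution_at_split[of "rev \<alpha>" t] assms(1) by auto
  have a: "\<alpha> = rev ws @ (t + 1) # rev vs @ t # rev us" using arg_cong[OF r, of rev] by simp
  show "\<not> has_consecution_at \<alpha> t"
  proof
    assume "has_consecution_at \<alpha> t"
    then obtain us' vs' ws' where a': "\<alpha> = us' @ t # (vs' @ (t + 1) # ws')"
      using has_consecution_at_split[of \<alpha> t] assms(1) by auto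
    have "(rev ws @ (t + 1) # rev vs) @ t # rev us = us' @ t # (vs' @ (t + 1) # ws')" using a a' by simp
    moreover have "t \<notin> set (rev ws @ (t + 1) # rev vs)" "t \<notin> set (rev us)" using assms(1) unfolding a by auto
    ultimately have "rev us = vs' @ (t + 1) # ws'" using append_Cons_eq_iff by metis
    hence "t + 1 \<in> set (rev us)" by simp
    with assms(1) show False unfolding a by auto
  qed
next
  assume "\<not> has_consecution_at \<alpha> t"
  then obtain us vs ws where a: "\<alpha> = us @ (t + 1) # vs @ t # ws"
    using no_consecution_at_split[OF assms(1-3)] by metis
  have "rev \<alpha> = rev ws @ t # rev vs @ (t + 1) # rev us" using a by simp
  moreover have d: "distinct (rev \<alpha>)" using assms(1) by simp
  ultimately show "has_consecution_at (rev \<alpha>) t"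
    unfolding has_consecution_at_split[OF d] by blast
qed

lemma inversions_rev:
  assumes "distinct \<alpha>" "set \<alpha> = {0..int m - 1}"
  shows "inversions m (rev \<alpha>) = consecutions m \<alpha>"
proof -
  have "\<not> has_consecution_at (rev \<alpha>) t \<longleftrightarrow> has_consecution_at \<alpha> t" if "t \<in> {0..int m - 2}" for t
    using has_consecution_at_rev[of \<alpha> t] assms that by auto
  then have "{t \<in> {0..int m - 2}. \<not> has_consecution_at (rev \<alpha>) t} = {t \<in> {0..int m - 2}. has_consecution_at \<alpha> t}" by blast
  then show ?thesis unfolding inversions_def consecutions_def by simp
qed

lemma subseq_rev: "subseq xs ys \<Longrightarrow> subseq (rev xs) (rev ys)"
  by (induction rule: list_emb.induct) (auto intro: list_emb_append_mono subseq_rev_drop_many)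

lemma i0_eq_c0_rev: "i0 \<beta> = c0 (rev \<beta>)"
proof -
  have "subseq (rev xs) \<beta> \<longleftrightarrow> subseq xs (rev \<beta>)" for xs
    using subseq_rev[of "rev xs" \<beta>] subseq_rev[of xs "rev \<beta>"] by auto
  then show ?thesis unfolding i0_def c0_def by simp
qed

lemma gfpr_indices_rev:
  assumes "gfpr_indices m h \<sigma> \<tau> \<sigma>1 \<sigma>2 \<tau>1 \<tau>2"
  shows "gfpr_indices m h (rev \<sigma>) (rev \<tau>) (rev \<sigma>2) (rev \<sigma>1) (rev \<tau>2) (rev \<tau>1)"
  using assms SIP_rev[of "\<sigma>1 @ \<sigma> @ \<sigma>2"] SIP_rev[of "\<tau>1 @ \<tau> @ \<tau>2"]
  unfolding gfpr_indices_def is_permutation_of_def by simp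

context system_data
begin

abbreviation "FM\<^sub>T \<equiv> fiedler_sys m n r (\<lambda>i. (As i)\<^sup>T) A\<^sup>T C\<^sup>T B\<^sup>T E\<^sup>T"
abbreviation "FP\<^sub>T \<equiv> fiedler_prod m n r (\<lambda>i. (As i)\<^sup>T) A\<^sup>T C\<^sup>T B\<^sup>T E\<^sup>T"

lemma transpose_system_data:
  "system_data m n r (\<lambda>i. (As i)\<^sup>T) A\<^sup>T C\<^sup>T B\<^sup>T E\<^sup>T"
  using m As ABCE by unfold_locales auto

lemma transpose_fiedler_sys:
  assumes "i \<in> {- int m..int m - 1}"
  shows "(FM i)\<^sup>T = FM\<^sub>T i"
proof -
  interpret T: system_data m n r "\<lambda>i. (As i)\<^sup>T" "transpose_mat A" "transpose_mat C" "transpose_mat B" "transpose_mat E"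
    by (rule transpose_system_data)
  have pos: "(FM (int j))\<^sup>T = FM\<^sub>T (int j)" if "0 < j" "j < m" for j
    using that As[of j] m by (simp add: fiedler_sys_pos T.fiedler_sys_pos transpose_ext_elem_mat transpose_uminus)
  from assms show ?thesis
  proof (cases rule: index_cases)
    case 1
    have c: "fiedler_poly m n As 0 \<in> carrier_mat (m * n) (m * n)" "- (ecol m m \<otimes>\<^sub>k C) \<in> carrier_mat (m * n) r"
      "- ((ecol m m)\<^sup>T \<otimes>\<^sub>k B) \<in> carrier_mat r (m * n)" "- A \<in> carrier_mat r r"
      using fiedler_poly_carrier[of 0] ABCE m by (auto simp: kronecker_def ecol_def)
    have "(fiedler_poly m n As 0)\<^sup>T = fiedler_poly m n (\<lambda>i. (As i)\<^sup>T) 0"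
      using As[of 0] by (simp add: fiedler_poly_def transpose_elem_mat transpose_uminus)
    then show ?thesis unfolding 1 fiedler_sys_def
      by (simp add: transpose_four_block_mat[OF c] transpose_uminus transpose_kronecker)
  next
    case 2
    have "(fiedler_poly m n As (- int m))\<^sup>T = fiedler_poly m n (\<lambda>i. (As i)\<^sup>T) (- int m)"
      using As[of m] m by (simp add: fiedler_poly_def transpose_elem_mat)
    moreover have "fiedler_poly m n As (- int m) \<in> carrier_mat (m * n) (m * n)" "- E \<in> carrier_mat r r"
      using fiedler_poly_carrier[of "- int m"] ABCE m by auto
    ultimately show ?thesis using 2 by (simp add: fiedler_sys_def transpose_diag_block2 transpose_uminus del: diag_block_mat.simps)
  next
    case (3 j)
    with pos show ?thesis by simp
  next
    case (4 j)
    have "inverse_pair (m * n + r) (FM\<^sub>T (int j)) (FM (- int j))\<^sup>T"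
      using inverse_pair_transpose[OF fiedler_inverse_pair[OF 4(2,3)]] pos[OF 4(2,3)] by simp
    from mat_inv_inverse_pair[OF this] mat_inv_inverse_pair[OF T.fiedler_inverse_pair[OF 4(2,3)]] 4(1)
    show ?thesis by simp
  qed
qed

lemma transpose_fiedler_prod:
  assumes "set t \<subseteq> {- int m..int m - 1}"
  shows "(FP t)\<^sup>T =
    FP\<^sub>T (rev t)"
proof -
  have "map transpose_mat (map FM t) = map FM\<^sub>T t"
    using assms transpose_fiedler_sys by auto
  moreover have "set (map FM t) \<subseteq> carrier_mat (m * n + r) (m * n + r)" using assms FM_carrier by auto
  ultimately show ?thesis unfolding fiedler_prod_def by (simp only: transpose_mat_prod rev_map)
qed

lemma transpose_system_matrix:
  "(system_matrix (poly_mat n m As) A B C E)\<^sup>T =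
   system_matrix (poly_mat n m (\<lambda>i. (As i)\<^sup>T)) A\<^sup>T C\<^sup>T B\<^sup>T E\<^sup>T"
proof -
  have "(poly_mat n m As)\<^sup>T = poly_mat n m (\<lambda>i. (As i)\<^sup>T)"
  proof (rule eq_matI)
    fix i j assume "i < dim_row (poly_mat n m (\<lambda>i. (As i)\<^sup>T))" "j < dim_col (poly_mat n m (\<lambda>i. (As i)\<^sup>T))"
    hence ij: "i < n" "j < n" by (auto simp: poly_mat_def)
    have "As k $$ (j, i) = (As k)\<^sup>T $$ (i, j)" if "k \<le> m" for k using As[OF that] ij by auto
    with ij show "(poly_mat n m As)\<^sup>T $$ (i, j) = poly_mat n m (\<lambda>i. (As i)\<^sup>T) $$ (i, j)"
      by (auto simp: poly_mat_def intro!: sum.cong)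
  qed (auto simp: poly_mat_def)
  moreover have "(const_mat A - [:0, 1:] \<cdot>\<^sub>m const_mat E)\<^sup>T =
      const_mat A\<^sup>T - [:0, 1:] \<cdot>\<^sub>m const_mat E\<^sup>T"
    using ABCE by (intro eq_matI) (auto simp: const_mat_def)
  moreover have c: "poly_mat n m As \<in> carrier_mat n n" "const_mat C \<in> carrier_mat n r" "const_mat B \<in> carrier_mat r n"
      "const_mat A - [:0, 1:] \<cdot>\<^sub>m const_mat E \<in> carrier_mat r r"
    using ABCE by (auto simp: const_mat_def poly_mat_def)
  ultimately show ?thesis unfolding system_matrix_def
    by (simp only: transpose_four_block_mat[OF c] transpose_const_mat)
qed

end

context gfpr
begin

text \<open>
  Transposition reverses all products. The result is a GFPR of the transposed system matrix in which all
  tuples are reversed, the left and the right factors trade places, and so do \<open>B\<close> and \<open>C\<close>.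
\<close>
lemma transpose_gfpr:
  "gfpr m n r (\<lambda>i. (As i)\<^sup>T) A\<^sup>T C\<^sup>T B\<^sup>T E\<^sup>T
    h (rev \<sigma>) (rev \<tau>r) (rev \<tau>l) (rev \<sigma>2) (rev \<sigma>1) (rev \<tau>2) (rev \<tau>1)
    (rev (map transpose_mat X\<^sub>2)) (rev (map transpose_mat X\<^sub>1)) (rev (map transpose_mat Y\<^sub>2)) (rev (map transpose_mat Y\<^sub>1))"
proof (intro gfpr.intro transpose_system_data gfpr_axioms.intro)
  show "gfpr_indices m h (rev \<sigma>) (rev \<tau>r @ [- int m] @ rev \<tau>l) (rev \<sigma>2) (rev \<sigma>1) (rev \<tau>2) (rev \<tau>1)"
    using gfpr_indices_rev[OF indices] by simp
  show "invertible_mat E\<^sup>T" by (rule invertible_mat_transpose[OF invE ABCE(4)])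
qed (intro nonsingular_assignment_rev X1 X2 Y1 Y2)+

lemma transpose_L:
  "(rat_mat L)\<^sup>T = rat_mat (
     const_mat (elem_prod m n r (rev \<tau>2 @ rev \<sigma>2) (rev (map transpose_mat Y\<^sub>2) @ rev (map transpose_mat X\<^sub>2)))
     * pencil (FP\<^sub>T (rev \<tau>r @ [- int m] @ rev \<tau>l))
              (FP\<^sub>T (rev \<sigma>))
     * const_mat (elem_prod m n r (rev \<sigma>1 @ rev \<tau>1) (rev (map transpose_mat X\<^sub>1) @ rev (map transpose_mat Y\<^sub>1))))"
proof -
  have c: "const_mat M1 \<in> carrier_mat N N" "const_mat M2 \<in> carrier_mat N N" "pencil (FP \<tau>) (FP \<sigma>) \<in> carrier_mat N N"
    using carriers pencil_carrier by (auto simp: const_mat_def)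
  have s: "set \<tau>1 \<subseteq> {- int m..int m - 1}" "set \<sigma>1 \<subseteq> {- int m..int m - 1}" "set \<tau>2 \<subseteq> {- int m..int m - 1}" "set \<sigma>2 \<subseteq> {- int m..int m - 1}"
    "set \<tau> \<subseteq> {- int m..int m - 1}"
    using ranges h range_subsets(1,2) by force+
  have lens: "length X\<^sub>1 = length \<sigma>1" "length X\<^sub>2 = length \<sigma>2" "length Y\<^sub>1 = length \<tau>1" "length Y\<^sub>2 = length \<tau>2"
    "set X\<^sub>1 \<subseteq> carrier_mat n n" "set X\<^sub>2 \<subseteq> carrier_mat n n" "set Y\<^sub>1 \<subseteq> carrier_mat n n" "set Y\<^sub>2 \<subseteq> carrier_mat n n"
    using X1 X2 Y1 Y2 unfolding nonsingular_assignment_def matrix_assignment_def by auto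
  have m1: "transpose_mat M1 = elem_prod m n r (rev \<sigma>1 @ rev \<tau>1) (rev (map transpose_mat X\<^sub>1) @ rev (map transpose_mat Y\<^sub>1))"
    using s lens m by (subst transpose_elem_prod) auto
  have m2: "transpose_mat M2 = elem_prod m n r (rev \<tau>2 @ rev \<sigma>2) (rev (map transpose_mat Y\<^sub>2) @ rev (map transpose_mat X\<^sub>2))"
    using s lens m by (subst transpose_elem_prod) auto
  have fp: "(FP \<tau>)\<^sup>T = FP\<^sub>T (rev \<tau>r @ [- int m] @ rev \<tau>l)"
    using transpose_fiedler_prod[OF s(5)] by simp
  have "transpose_mat L = (const_mat M2)\<^sup>T * ((pencil (FP \<tau>) (FP \<sigma>))\<^sup>T * (const_mat M1)\<^sup>T)"
    using c by (simp only: transpose_mult[OF mult_carrier_mat[OF c(1,3)] c(2)] transpose_mult[OF c(1,3)])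
  also have "\<dots> = (const_mat M2)\<^sup>T * (pencil (FP \<tau>) (FP \<sigma>))\<^sup>T * (const_mat M1)\<^sup>T"
    using c by (intro assoc_mult_mat[symmetric, of _ N N _ N _ N]) auto
  finally show ?thesis
    by (simp only: transpose_rat_mat transpose_const_mat m1 m2 transpose_pencil[OF carriers(4,5)]
        fp transpose_fiedler_prod[OF range_subsets(3)])
qed

lemma c_less: "c < m"
  using c_le h by simp

lemma i0_less: "i0 (\<sigma>1 @ \<sigma>) < m"
  using gfpr.c_less[OF transpose_gfpr] by (simp add: i0_eq_c0_rev)

text \<open>
  This is right recovery for the transposed data. The reversal of the tuples turns \<open>i0\<close> into \<open>c0\<close>, and the
  consecutions of \<open>\<alpha>\<close> into the inversions of \<open>rev \<alpha>\<close>.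
\<close>
theorem left_recovery:
  assumes "minimal_basis N (mat_kernel (rat_mat L)\<^sup>T) vs"
  shows "minimal_basis (n + r) (mat_kernel (rat_mat S)\<^sup>T) (map (recover m n r (i0 (\<sigma>1 @ \<sigma>))) vs)"
    and "\<And>v. v \<in> set vs \<Longrightarrow> vec_degree v = vec_degree (recover m n r (i0 (\<sigma>1 @ \<sigma>)) v) + consecutions m \<alpha>"
proof -
  have i0: "i0 (\<sigma>1 @ \<sigma>) = c0 (rev \<sigma> @ rev \<sigma>1)" by (simp add: i0_eq_c0_rev)
  have inv: "inversions m (map uminus (rev (rev \<tau>r)) @ rev \<sigma> @ map uminus (rev (rev \<tau>l))) = consecutions m \<alpha>"
    using inversions_rev[OF distinct set_\<alpha>] by (simp add: rev_map)
  note rr = gfpr.right_recovery[OF transpose_gfpr assms[unfolded transpose_L]]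
  show "minimal_basis (n + r) (mat_kernel (rat_mat S)\<^sup>T) (map (recover m n r (i0 (\<sigma>1 @ \<sigma>))) vs)"
    unfolding i0 transpose_rat_mat transpose_system_matrix by (rule rr(1))
  show "vec_degree v = vec_degree (recover m n r (i0 (\<sigma>1 @ \<sigma>)) v) + consecutions m \<alpha>" if "v \<in> set vs" for v
    using rr(2)[OF that] unfolding i0 inv .
qed

end

text \<open>
  In row \<open>i\<close> the Kronecker product has its only 1 in column \<open>(m - Suc c) * n + i\<close>, the position of entry
  \<open>i\<close> of block \<open>c\<close>.
\<close>
lemma cols_recover:
  fixes Zmn Zr :: "complex poly mat"
  assumes Z: "Zmn \<in> carrier_mat (m * n) p" "Zr \<in> carrier_mat r p" and c: "c < m"
  shows "cols ((((ecol m (m - c))\<^sup>T \<otimes>\<^sub>k 1\<^sub>m n) * Zmn) @\<^sub>r Zr) = map (recover m n r c) (cols (Zmn @\<^sub>r Zr))"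
proof -
  let ?e = "(ecol m (m - c))\<^sup>T \<otimes>\<^sub>k 1\<^sub>m n :: complex poly mat"
  have e: "?e \<in> carrier_mat n (m * n)" by (simp add: kronecker_def ecol_def)
  have entry: "(?e * Zmn) $$ (i, j) = Zmn $$ ((m - Suc c) * n + i, j)" if ij: "i < n" "j < p" for i j
  proof -
    have pos: "(m - Suc c) * n + i < m * n" by (rule blk_pos_less[OF c ij(1)])
    have "?e $$ (i, q) = (if q = (m - Suc c) * n + i then 1 else 0)" if q: "q < m * n" for q
    proof -
      have qd: "q div n < m" using q by (simp add: less_mult_imp_div_less)
      have "q = (m - Suc c) * n + i \<longleftrightarrow> q div n = m - Suc c \<and> q mod n = i"
        using ij(1) by (metis add.commute div_mult_mod_eq div_mult_self1 div_less mod_less mod_mult_self1 add_0 not_less0 gr0I)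
      moreover have "q div n = m - Suc c \<longleftrightarrow> Suc (q div n) = m - c" using c by auto
      ultimately show ?thesis using q qd ij by (auto simp: kronecker_def ecol_def)
    qed
    hence "(\<Sum>q<m * n. ?e $$ (i, q) * Zmn $$ (q, j)) = (\<Sum>q<m * n. if q = (m - Suc c) * n + i then Zmn $$ (q, j) else 0)"
      by (intro sum.cong) auto
    also have "\<dots> = Zmn $$ ((m - Suc c) * n + i, j)" using pos by simp
    finally show ?thesis using e Z ij by (simp add: scalar_prod_def atLeast0LessThan)
  qed
  show ?thesis
  proof (rule nth_equalityI)
    show "length (cols ((?e * Zmn) @\<^sub>r Zr)) = length (map (recover m n r c) (cols (Zmn @\<^sub>r Zr)))"
      using Z e by (simp add: append_rows_def)
    fix j assume "j < length (cols ((?e * Zmn) @\<^sub>r Zr))"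
    hence j: "j < p" using Z e by (simp add: append_rows_def)
    have "col ((?e * Zmn) @\<^sub>r Zr) j = recover m n r c (col (Zmn @\<^sub>r Zr) j)"
    proof (rule eq_vecI)
      fix i assume "i < dim_vec (recover m n r c (col (Zmn @\<^sub>r Zr) j))"
      hence i: "i < n + r" by (simp add: recover_def)
      show "col ((?e * Zmn) @\<^sub>r Zr) j $ i = recover m n r c (col (Zmn @\<^sub>r Zr) j) $ i"
      proof (cases "i < n")
        case True
        have "(?e * Zmn) $$ (i, j) = recover m n r c (col (Zmn @\<^sub>r Zr) j) $ i"
          unfolding entry[OF True j] using Z j True blk_pos_less[OF c True]
          by (simp add: recover_def blk_def append_rows_def)
        moreover have "col ((?e * Zmn) @\<^sub>r Zr) j $ i = (?e * Zmn) $$ (i, j)"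
          using Z e j True by (simp add: append_rows_def del: index_mult_mat(1))
        ultimately show ?thesis by simp
      next
        case False
        then obtain k where "i = n + k" by (metis le_iff_add not_le)
        with Z e j i show ?thesis by (simp add: append_rows_def recover_def tail_def)
      qed
    qed (use Z e in \<open>simp add: append_rows_def recover_def\<close>)
    with j Z e show "cols ((?e * Zmn) @\<^sub>r Zr) ! j = map (recover m n r c) (cols (Zmn @\<^sub>r Zr)) ! j"
      by (simp add: append_rows_def)
  qed
qed

lemma indices_transfer:
  assumes transfer: "\<And>vs. minimal_basis a U vs \<Longrightarrow> minimal_basis b V (map \<Phi> vs)"
    and degree: "\<And>vs v. minimal_basis a U vs \<Longrightarrow> v \<in> set vs \<Longrightarrow> vec_degree v = vec_degree (\<Phi> v) + k"
    and carrier: "\<And>v. \<Phi> v \<in> carrier_vec b"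
    and ex: "\<exists>Z. (dim_row Z = a \<and> minimal_basis a U (cols Z)) \<and> es = sort (map vec_degree (cols Z))"
  shows "(\<forall>e\<in>set es. k \<le> e) \<and>
    (\<exists>Z. (dim_row Z = b \<and> minimal_basis b V (cols Z)) \<and> map (\<lambda>e. e - k) es = sort (map vec_degree (cols Z)))"
proof -
  obtain Z where Z: "minimal_basis a U (cols Z)" "es = sort (map vec_degree (cols Z))" using ex by blast
  define Z' where "Z' = mat_of_cols b (map \<Phi> (cols Z))"
  have c: "cols Z' = map \<Phi> (cols Z)" using carrier unfolding Z'_def by (intro cols_mat_of_cols) auto
  have shifted: "map vec_degree (cols Z') = map (\<lambda>e. e - k) (map vec_degree (cols Z))"
    unfolding c using degree[OF Z(1)] by auto
  have sort: "sort (map (\<lambda>e. e - k) xs) = map (\<lambda>e. e - k) (sort xs)" for xs :: "nat list"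
    by (rule properties_for_sort) (auto simp: sorted_map intro!: sorted_wrt_mono_rel[OF _ sorted_sort[of xs]] diff_le_mono)
  have "map (\<lambda>e. e - k) es = sort (map vec_degree (cols Z'))" unfolding Z(2) shifted sort ..
  moreover have "k \<le> e" if "e \<in> set es" for e using that degree[OF Z(1)] unfolding Z(2) by auto
  moreover have "dim_row Z' = b" by (simp add: Z'_def)
  ultimately show ?thesis using transfer[OF Z(1)] unfolding c[symmetric] by blast
qed

section \<open>Recovery of minimal bases and minimal indices\<close>

theorem theorem5p3:
  fixes m n r h :: nat
    and As :: "nat \<Rightarrow> complex mat"
    and A B C E :: "complex mat"
    and G :: "complex poly fract mat"
    and P S L :: "complex poly mat"
    and \<sigma> \<tau> \<sigma>\<^sub>1 \<sigma>\<^sub>2 \<tau>\<^sub>1 \<tau>\<^sub>2 :: "int list"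
    and X\<^sub>1 X\<^sub>2 Y\<^sub>1 Y\<^sub>2 :: "complex mat list"
  assumes "m \<ge> 1"
    and "\<And>i. i \<le> m \<Longrightarrow> As i \<in> carrier_mat n n"
    and "As m \<noteq> 0\<^sub>m n n"
    and P: "P = poly_mat n m As"
    and "minimal_realization n r G P A B C E"
    and S: "S = system_matrix P A B C E"
    and "gfpr_indices m h \<sigma> \<tau> \<sigma>\<^sub>1 \<sigma>\<^sub>2 \<tau>\<^sub>1 \<tau>\<^sub>2"
    and "nonsingular_assignment m n \<sigma>\<^sub>1 X\<^sub>1" and "nonsingular_assignment m n \<sigma>\<^sub>2 X\<^sub>2"
    and "nonsingular_assignment m n \<tau>\<^sub>1 Y\<^sub>1" and "nonsingular_assignment m n \<tau>\<^sub>2 Y\<^sub>2"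
    and L: "L = const_mat (elem_prod m n r (\<tau>\<^sub>1 @ \<sigma>\<^sub>1) (Y\<^sub>1 @ X\<^sub>1))
              * pencil (fiedler_prod m n r As A B C E \<tau>) (fiedler_prod m n r As A B C E \<sigma>)
              * const_mat (elem_prod m n r (\<sigma>\<^sub>2 @ \<tau>\<^sub>2) (X\<^sub>2 @ Y\<^sub>2))"
  shows "(\<forall>p Zmn Zr. Zmn \<in> carrier_mat (m * n) p \<longrightarrow> Zr \<in> carrier_mat r p \<longrightarrow>
            (right_minimal_basis (rat_mat L) (Zmn @\<^sub>r Zr) \<longrightarrow>
               right_minimal_basis (rat_mat S)
                 (((transpose_mat (ecol m (m - c0 (\<sigma> @ \<sigma>\<^sub>2))) \<otimes>\<^sub>k 1\<^sub>m n) * Zmn) @\<^sub>r Zr)) \<and>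
            (left_minimal_basis (rat_mat L) (Zmn @\<^sub>r Zr) \<longrightarrow>
               left_minimal_basis (rat_mat S)
                 (((transpose_mat (ecol m (m - i0 (\<sigma>\<^sub>1 @ \<sigma>))) \<otimes>\<^sub>k 1\<^sub>m n) * Zmn) @\<^sub>r Zr)))
       \<and> (\<forall>\<tau>\<^sub>l \<tau>\<^sub>r \<alpha> \<epsilon>s. \<tau> = \<tau>\<^sub>l @ [- int m] @ \<tau>\<^sub>r \<longrightarrow>
            \<alpha> = map uminus (rev \<tau>\<^sub>l) @ \<sigma> @ map uminus (rev \<tau>\<^sub>r) \<longrightarrow>
            (right_minimal_indices (rat_mat L) \<epsilon>s \<longrightarrow>
               (\<forall>\<epsilon> \<in> set \<epsilon>s. inversions m \<alpha> \<le> \<epsilon>) \<and>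
               right_minimal_indices (rat_mat S) (map (\<lambda>\<epsilon>. \<epsilon> - inversions m \<alpha>) \<epsilon>s)) \<and>
            (left_minimal_indices (rat_mat L) \<epsilon>s \<longrightarrow>
               (\<forall>\<epsilon> \<in> set \<epsilon>s. consecutions m \<alpha> \<le> \<epsilon>) \<and>
               left_minimal_indices (rat_mat S) (map (\<lambda>\<epsilon>. \<epsilon> - consecutions m \<alpha>) \<epsilon>s)))"
proof -
  have ABCE: "A \<in> carrier_mat r r" "B \<in> carrier_mat r n" "C \<in> carrier_mat n r" "E \<in> carrier_mat r r" "invertible_mat E"
    using assms(5) unfolding minimal_realization_def realization_def by auto
  have data: "system_data m n r As A B C E"
    using assms(1,2) ABCE by unfold_locales auto
  have gfpr: "gfpr m n r As A B C E h \<sigma> \<tau>\<^sub>l \<tau>\<^sub>r \<sigma>\<^sub>1 \<sigma>\<^sub>2 \<tau>\<^sub>1 \<tau>\<^sub>2 X\<^sub>1 X\<^sub>2 Y\<^sub>1 Y\<^sub>2" if "\<tau> = \<tau>\<^sub>l @ [- int m] @ \<tau>\<^sub>r" for \<tau>\<^sub>l \<tau>\<^sub>r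
    using data ABCE(5) assms(7-11) unfolding that by (intro gfpr.intro gfpr_axioms.intro)
  have "- int m \<in> set \<tau>" using assms(1,7) unfolding gfpr_indices_def is_permutation_of_def by auto
  \<comment> \<open>the recovered vectors do not depend on how \<open>\<tau>\<close> splits\<close>
  then obtain \<tau>l \<tau>r where \<tau>: "\<tau> = \<tau>l @ [- int m] @ \<tau>r" by (auto dest: split_list)
  note g = gfpr[OF \<tau>]
  have dim: "dim_row (rat_mat L) = m * n + r" "dim_col (rat_mat L) = m * n + r"
      "dim_row (rat_mat S) = n + r" "dim_col (rat_mat S) = n + r"
    using gfpr.L_carrier[OF g] gfpr.S_carrier[OF g] unfolding L S P \<tau> by auto
  let ?c = "c0 (\<sigma> @ \<sigma>\<^sub>2)" and ?i = "i0 (\<sigma>\<^sub>1 @ \<sigma>)"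
  have right: "minimal_basis (m * n + r) (mat_kernel (rat_mat L)) vs \<Longrightarrow>
      minimal_basis (n + r) (mat_kernel (rat_mat S)) (map (recover m n r ?c) vs)" for vs
    using gfpr.right_recovery(1)[OF g] unfolding L S P \<tau> .
  have left: "minimal_basis (m * n + r) (mat_kernel (transpose_mat (rat_mat L))) vs \<Longrightarrow>
      minimal_basis (n + r) (mat_kernel (transpose_mat (rat_mat S))) (map (recover m n r ?i) vs)" for vs
    using gfpr.left_recovery(1)[OF g] unfolding L S P \<tau> .
  show ?thesis
  proof (intro conjI allI impI)
    fix p and Zmn Zr :: "complex poly mat"
    assume Z: "Zmn \<in> carrier_mat (m * n) p" "Zr \<in> carrier_mat r p"
    have rows: "dim_row (((transpose_mat (ecol m (m - c)) \<otimes>\<^sub>k 1\<^sub>m n) * Zmn) @\<^sub>r Zr) = n + r" for c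
      using Z by (simp add: append_rows_def kronecker_def ecol_def)
    show "right_minimal_basis (rat_mat S) (((transpose_mat (ecol m (m - ?c)) \<otimes>\<^sub>k 1\<^sub>m n) * Zmn) @\<^sub>r Zr)"
      if "right_minimal_basis (rat_mat L) (Zmn @\<^sub>r Zr)"
      using that right unfolding right_minimal_basis_def right_null_space_def dim cols_recover[OF Z gfpr.c_less[OF g]] rows
      by blast
    show "left_minimal_basis (rat_mat S) (((transpose_mat (ecol m (m - ?i)) \<otimes>\<^sub>k 1\<^sub>m n) * Zmn) @\<^sub>r Zr)"
      if "left_minimal_basis (rat_mat L) (Zmn @\<^sub>r Zr)"
      using that left unfolding left_minimal_basis_def left_null_space_def dim cols_recover[OF Z gfpr.i0_less[OF g]] rows
      by blast
  next
    fix \<tau>\<^sub>l \<tau>\<^sub>r \<alpha> \<epsilon>s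
    assume \<tau>': "\<tau> = \<tau>\<^sub>l @ [- int m] @ \<tau>\<^sub>r" and \<alpha>: "\<alpha> = map uminus (rev \<tau>\<^sub>l) @ \<sigma> @ map uminus (rev \<tau>\<^sub>r)"
    note g' = gfpr[OF \<tau>']
    have degR: "vec_degree v = vec_degree (recover m n r ?c v) + inversions m \<alpha>"
      if "minimal_basis (m * n + r) (mat_kernel (rat_mat L)) vs" "v \<in> set vs" for vs v
      using gfpr.right_recovery(2)[OF g'] that unfolding L \<alpha> \<tau>' .
    have degL: "vec_degree v = vec_degree (recover m n r ?i v) + consecutions m \<alpha>"
      if "minimal_basis (m * n + r) (mat_kernel (transpose_mat (rat_mat L))) vs" "v \<in> set vs" for vs v
      using gfpr.left_recovery(2)[OF g'] that unfolding L \<alpha> \<tau>' .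
    have R: "(\<forall>\<epsilon>\<in>set \<epsilon>s. inversions m \<alpha> \<le> \<epsilon>) \<and>
        right_minimal_indices (rat_mat S) (map (\<lambda>\<epsilon>. \<epsilon> - inversions m \<alpha>) \<epsilon>s)"
      if "right_minimal_indices (rat_mat L) \<epsilon>s"
      using that unfolding right_minimal_indices_def right_minimal_basis_def right_null_space_def dim
      by (rule indices_transfer[OF right degR recover_carrier, rotated -1])
    have Le: "(\<forall>\<epsilon>\<in>set \<epsilon>s. consecutions m \<alpha> \<le> \<epsilon>) \<and>
        left_minimal_indices (rat_mat S) (map (\<lambda>\<epsilon>. \<epsilon> - consecutions m \<alpha>) \<epsilon>s)"
      if "left_minimal_indices (rat_mat L) \<epsilon>s"
      using that unfolding left_minimal_indices_def left_minimal_basis_def left_null_space_def dim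
      by (rule indices_transfer[OF left degL recover_carrier, rotated -1])
    show "\<forall>\<epsilon>\<in>set \<epsilon>s. inversions m \<alpha> \<le> \<epsilon>"
      "right_minimal_indices (rat_mat S) (map (\<lambda>\<epsilon>. \<epsilon> - inversions m \<alpha>) \<epsilon>s)"
      if "right_minimal_indices (rat_mat L) \<epsilon>s" using R[OF that] by auto
    show "\<forall>\<epsilon>\<in>set \<epsilon>s. consecutions m \<alpha> \<le> \<epsilon>"
      "left_minimal_indices (rat_mat S) (map (\<lambda>\<epsilon>. \<epsilon> - consecutions m \<alpha>) \<epsilon>s)"
      if "left_minimal_indices (rat_mat L) \<epsilon>s" using Le[OF that] by auto
  qed
qed

end
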